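(* Let $\varphi\in L^{2}(\mathbb{H}^{n})$ satisfy condition C and $\frac{1}{G^{\varphi}_{0,0}}\in L^{1}(0,1]$. Then the following are equivalent. (a) $\{L_{(2k,l,m)}\varphi:(k,l,m)\in\mathbb{Z}^{2n+1}\}$ is Hilbertian. (b) $\|G^{\varphi}_{0,0}\|_{\infty}<\infty$. (c) $\{L_{(2k,l,m)}\varphi:(k,l,m)\in\mathbb{Z}^{2n+1}\}$ is a Bessel sequence in $L^{2}(\mathbb{H}^{n})$.
   Context: The Heisenberg group $\mathbb{H}^{n}$ is $\mathbb{R}^{n}\times\mathbb{R}^{n}\times\mathbb{R}$ with group law $(x,y,t)(x',y',t')=(x+x',y+y',t+t'+\frac12(x'\cdot y-y'\cdot x))$ and Haar measure $dx\,dy\,dt$. Left translation: $L_{h}\varphi(X)=\varphi(h^{-1}X)$. In $(k,l,m)\in\mathbb{Z}^{2n+1}$, $k,l\in\mathbb{Z}^n$ and $m\in\mathbb{Z}$. For $\lambda\in\mathbb{R}^{\star}=\mathbb{R}\setminus\{0\}$, $\pi_{\lambda}(x,y,t)$ acts on $\phi\in L^{2}(\mathbb{R}^{n})$ by $\pi_{\lambda}(x,y,t)\phi(\xi)=e^{2\pi i\lambda t}e^{2\pi i\lambda(x\cdot\xi+\frac12x\cdot y)}\phi(\xi+y)$. The group Fourier transform is $\widehat{f}(\lambda)=\int_{\mathbb{H}^{n}}f(x,y,t)\pi_{\lambda}(x,y,t)\,dx\,dy\,dt$ for $f\in L^{1}(\mathbb{H}^{n})$, extended to an isometric isomorphism of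 $L^{2}(\mathbb{H}^{n})$ onto $L^{2}(\mathbb{R}^{\star},\mathcal{B}_{2};|\lambda|^{n}d\lambda)$, where $\mathcal{B}_{2}$ is the space of Hilbert–Schmidt operators on $L^{2}(\mathbb{R}^{n})$. For $(k,l)\in\mathbb{Z}^{2n}$ and $\lambda\in(0,1]$, $G^{\varphi}_{k,l}(\lambda)=\sum_{r\in\mathbb{Z}}\langle\widehat{\varphi}(\lambda+r),\widehat{L_{(2k,l,0)}\varphi}(\lambda+r)\rangle_{\mathcal{B}_{2}}|\lambda+r|^{n}$; $1/G^{\varphi}_{0,0}$ is $+\infty$ where $G^{\varphi}_{0,0}=0$, and $\|\cdot\|_\infty$ is the $L^\infty(0,1]$ norm. Condition C: $G^{\varphi}_{k,l}(\lambda)=0$ for a.e. $\lambda\in(0,1]$, for all $(k,l)\in\mathbb{Z}^{2n}\setminus\{(0,0)\}$. A family $\{f_{j}:j\in\mathbb{Z}^{d}\}$ in a Hilbert space $\mathcal{H}$ is Hilbertian if $\{c_{j}\}\in\ell^{2}(\mathbb{Z}^{d})$ implies that $\sum_{j\in\mathbb{Z}^{d}}c_{j}f_{j}$ converges; it is a Bessel sequence if there is $B>0$ with $\sum_{j}|\langle f,f_{j}\rangle|^{2}\le B\|f\|^{2}$ for all $f\in\mathcal{H}$. Convergence of a series over $\mathbb{Z}^{d}$ means norm convergence in $\mathcal{H}$ of the partial sums over $\{j:\max_i|j_i|\le N\}$ as $N\to\infty$. *)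

theory Defs
  imports "HOL-Analysis.Analysis" "HOL-Probability.Essential_Supremum"
begin

section \<open>The complex Hilbert space of square integrable functions\<close>

definition square_integrable :: "('a::euclidean_space \<Rightarrow> complex) \<Rightarrow> bool" where
  "square_integrable f \<longleftrightarrow>
     f \<in> borel_measurable lborel \<and> integrable lborel (\<lambda>x. (cmod (f x))\<^sup>2)"

lemma square_integrable_zero: "square_integrable (\<lambda>x. 0)"
  by (simp add: square_integrable_def)

lemma square_integrable_mult:
  assumes "square_integrable f" "square_integrable g"
  shows "integrable lborel (\<lambda>x. f x * cnj (g x))"
proof (rule Bochner_Integration.integrable_bound)
  show "integrable lborel (\<lambda>x. (cmod (f x))\<^sup>2 + (cmod (g x))\<^sup>2)"
    using assms by (simp add: square_integrable_def)
  have "cnj \<in> borel_measurable borel"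
    by (intro borel_measurable_continuous_onI continuous_intros)
  then have "(\<lambda>x. cnj (g x)) \<in> borel_measurable lborel"
    using assms(2) measurable_compose[of g lborel borel cnj borel] by (simp add: square_integrable_def)
  then show "(\<lambda>x. f x * cnj (g x)) \<in> borel_measurable lborel"
    using assms(1) unfolding square_integrable_def by (intro borel_measurable_times) auto
  have "a * b \<le> a\<^sup>2 + b\<^sup>2" if "a \<ge> 0" "b \<ge> 0" for a b :: real
    using that sum_squares_bound[of a b] mult_nonneg_nonneg[of a b] by linarith
  then show "AE x in lborel. norm (f x * cnj (g x)) \<le> norm ((cmod (f x))\<^sup>2 + (cmod (g x))\<^sup>2)"
    by (intro AE_I2) (simp add: norm_mult)
qed

lemma square_integrable_add:
  assumes "square_integrable f" "square_integrable g"
  shows "square_integrable (\<lambda>x. f x + g x)"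
  unfolding square_integrable_def
proof
  show m: "(\<lambda>x. f x + g x) \<in> borel_measurable lborel"
    using assms unfolding square_integrable_def by (intro borel_measurable_add) auto
  show "integrable lborel (\<lambda>x. (cmod (f x + g x))\<^sup>2)"
  proof (rule Bochner_Integration.integrable_bound)
    show "integrable lborel (\<lambda>x. 2 * (cmod (f x))\<^sup>2 + 2 * (cmod (g x))\<^sup>2)"
      using assms by (simp add: square_integrable_def)
    show "(\<lambda>x. (cmod (f x + g x))\<^sup>2) \<in> borel_measurable lborel"
      using m by simp
    have "(cmod (a + b))\<^sup>2 \<le> 2 * (cmod a)\<^sup>2 + 2 * (cmod b)\<^sup>2" for a b
    proof -
      have "(cmod (a + b))\<^sup>2 \<le> (cmod a + cmod b)\<^sup>2"
        by (simp add: norm_triangle_ineq power_mono)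
      also have "\<dots> \<le> 2 * (cmod a)\<^sup>2 + 2 * (cmod b)\<^sup>2"
        using sum_squares_bound[of "cmod a" "cmod b"] by (simp add: power2_sum)
      finally show ?thesis .
    qed
    then show "AE x in lborel. norm ((cmod (f x + g x))\<^sup>2)
                 \<le> norm (2 * (cmod (f x))\<^sup>2 + 2 * (cmod (g x))\<^sup>2)"
      by (intro AE_I2) simp
  qed
qed

lemma square_integrable_cmult:
  assumes "square_integrable f"
  shows "square_integrable (\<lambda>x. c * f x)"
proof -
  have "(\<lambda>x. c * f x) \<in> borel_measurable lborel"
    using assms unfolding square_integrable_def by (intro borel_measurable_times) auto
  then show ?thesis
    using assms by (simp add: square_integrable_def norm_mult power_mult_distrib)
qed

quotient_type (overloaded) 'a l2 = "'a::euclidean_space \<Rightarrow> complex" / partial: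
  "\<lambda>f g. square_integrable f \<and> square_integrable g \<and> (AE x in lborel. f x = g x)"
proof (rule part_equivpI)
  show "\<exists>f::'a \<Rightarrow> complex. square_integrable f \<and> square_integrable f \<and> (AE x in lborel. f x = f x)"
    using square_integrable_zero by auto
qed (auto intro!: sympI transpI elim: eventually_mono eventually_elim2)

text \<open>\<open>rep_l2 f\<close> is some representative of the class \<open>f\<close>, and \<open>abs_l2\<close> sends a square integrable
  function to its class.\<close>

lift_definition scaleC_l2 :: "complex \<Rightarrow> 'a::euclidean_space l2 \<Rightarrow> 'a l2" (infixr \<open>*\<^sub>C\<close> 75)
  is "\<lambda>c f x. c * f x"
  by (auto intro: square_integrable_cmult elim: eventually_mono)

text \<open>The inner product is linear in the first argument.\<close>

lift_definition cinner :: "'a::euclidean_space l2 \<Rightarrow> 'a l2 \<Rightarrow> complex"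
  is "\<lambda>f g. (LINT x|lborel. f x * cnj (g x))"
proof (rule integral_cong_AE, goal_cases)
  case (1 f f' g g')
  then show ?case using square_integrable_mult[of f g] by auto
next
  case (2 f f' g g')
  then show ?case using square_integrable_mult[of f' g'] by auto
next
  case (3 f f' g g')
  then have "AE x in lborel. f x = f' x" "AE x in lborel. g x = g' x" by auto
  then show ?case by eventually_elim simp
qed

lemma square_integrable_rep_l2: "square_integrable (rep_l2 f)"
  using Quotient3_rep_reflp[OF Quotient3_l2, of f] by blast

lemma cinner_self: "cinner f f = complex_of_real (LINT x|lborel. (cmod (rep_l2 f x))\<^sup>2)"
proof -
  have "cinner f f = (LINT x|lborel. rep_l2 f x * cnj (rep_l2 f x))"
    by (simp add: cinner_def)
  also have "\<dots> = (LINT x|lborel. complex_of_real ((cmod (rep_l2 f x))\<^sup>2))"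
    by (simp only: complex_norm_square)
  finally show ?thesis by (simp only: integral_complex_of_real)
qed

instantiation l2 :: (euclidean_space) real_inner
begin

lift_definition zero_l2 :: "'a l2" is "\<lambda>x. 0"
  by (simp add: square_integrable_zero)

lift_definition plus_l2 :: "'a l2 \<Rightarrow> 'a l2 \<Rightarrow> 'a l2" is "\<lambda>f g x. f x + g x"
  by (auto intro: square_integrable_add elim: eventually_elim2)

lift_definition uminus_l2 :: "'a l2 \<Rightarrow> 'a l2" is "\<lambda>f x. - f x"
  by (auto simp: square_integrable_def elim: eventually_mono)

definition minus_l2 :: "'a l2 \<Rightarrow> 'a l2 \<Rightarrow> 'a l2" where
  "minus_l2 f g = f + - g"

definition scaleR_l2 :: "real \<Rightarrow> 'a l2 \<Rightarrow> 'a l2" where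
  "scaleR_l2 r f = complex_of_real r *\<^sub>C f"

definition inner_l2 :: "'a l2 \<Rightarrow> 'a l2 \<Rightarrow> real" where
  "inner_l2 f g = Re (cinner f g)"

definition norm_l2 :: "'a l2 \<Rightarrow> real" where
  "norm_l2 f = sqrt (inner f f)"

definition dist_l2 :: "'a l2 \<Rightarrow> 'a l2 \<Rightarrow> real" where
  "dist_l2 f g = norm (f - g)"

definition sgn_l2 :: "'a l2 \<Rightarrow> 'a l2" where
  "sgn_l2 f = scaleR (inverse (norm f)) f"

definition uniformity_l2 :: "('a l2 \<times> 'a l2) filter" where
  "uniformity_l2 = (INF e\<in>{0<..}. principal {(f, g). dist f g < e})"

definition open_l2 :: "'a l2 set \<Rightarrow> bool" where
  "open_l2 U \<longleftrightarrow> (\<forall>f\<in>U. eventually (\<lambda>(f', g). f' = f \<longrightarrow> g \<in> U) uniformity)"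

instance
proof
  fix f g h :: "'a l2" and r s :: real
  show "f - g = f + - g" by (rule minus_l2_def)
  show "f + g + h = f + (g + h)"
    by transfer (auto simp: add.assoc intro: square_integrable_add)
  show "f + g = g + f"
    by transfer (auto simp: add.commute intro: square_integrable_add)
  show "0 + f = f" by transfer auto
  show "- f + f = 0" by transfer (auto simp: square_integrable_zero)
  show "r *\<^sub>R (f + g) = r *\<^sub>R f + r *\<^sub>R g" unfolding scaleR_l2_def
    by transfer (auto simp: distrib_left intro!: square_integrable_add square_integrable_cmult)
  show "(r + s) *\<^sub>R f = r *\<^sub>R f + s *\<^sub>R f" unfolding scaleR_l2_def
    by transfer (auto simp: distrib_right intro!: square_integrable_add square_integrable_cmult)
  show "r *\<^sub>R s *\<^sub>R f = (r * s) *\<^sub>R f" unfolding scaleR_l2_def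
    by transfer (auto simp: mult.assoc intro!: square_integrable_cmult)
  show "1 *\<^sub>R f = f" unfolding scaleR_l2_def by transfer auto
  show "dist f g = norm (f - g)" by (rule dist_l2_def)
  show "sgn f = scaleR (inverse (norm f)) f" by (rule sgn_l2_def)
  show "uniformity = (INF e\<in>{0<..}. principal {(f, g :: 'a l2). dist f g < e})"
    by (rule uniformity_l2_def)
  show "open U \<longleftrightarrow> (\<forall>f\<in>U. eventually (\<lambda>(f', g). f' = f \<longrightarrow> g \<in> U) uniformity)" for U :: "'a l2 set"
    by (rule open_l2_def)
  have "cinner f g = cnj (cinner g f)"
    by transfer (simp add: Bochner_Integration.integral_cnj[symmetric] mult.commute
        del: Bochner_Integration.integral_cnj)
  then show "inner f g = inner g f" unfolding inner_l2_def by simp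
  have "cinner (f + g) h = cinner f h + cinner g h"
    by transfer (simp add: distrib_right square_integrable_mult)
  then show "inner (f + g) h = inner f h + inner g h" unfolding inner_l2_def by simp
  have "cinner (c *\<^sub>C f) g = c * cinner f g" for c
    by transfer (simp add: mult.assoc)
  then show "inner (r *\<^sub>R f) g = r * inner f g" unfolding inner_l2_def scaleR_l2_def by simp
  show "0 \<le> inner f f" unfolding inner_l2_def by (simp add: cinner_self)
  show "inner f f = 0 \<longleftrightarrow> f = 0"
  proof
    assume "f = 0"
    then show "inner f f = 0" unfolding inner_l2_def by (simp, transfer, simp)
  next
    assume "inner f f = 0"
    then have "(LINT x|lborel. (cmod (rep_l2 f x))\<^sup>2) = 0"
      unfolding inner_l2_def by (simp add: cinner_self)
    then have "AE x in lborel. (cmod (rep_l2 f x))\<^sup>2 = 0"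
      using square_integrable_rep_l2[of f] by (subst (asm) integral_nonneg_eq_0_iff_AE)
        (auto simp: square_integrable_def)
    then have ae: "AE x in lborel. rep_l2 f x = 0" by simp
    have "abs_l2 (rep_l2 f) = abs_l2 (\<lambda>x. 0)"
      using ae square_integrable_rep_l2[of f] square_integrable_zero
      by (intro Quotient3_rel_abs[OF Quotient3_l2]) auto
    then show "f = 0"
      by (simp add: zero_l2_def Quotient3_abs_rep[OF Quotient3_l2])
  qed
  show "norm f = sqrt (inner f f)" by (rule norm_l2_def)
qed

end

lemma square_integrable_compose:
  fixes T :: "'a::euclidean_space \<Rightarrow> 'a"
  assumes T: "T \<in> borel_measurable borel" "distr lborel borel T = lborel" and f: "square_integrable f"
  shows "square_integrable (\<lambda>x. f (T x))"
proof -
  have "integrable (distr lborel borel T) (\<lambda>x. (cmod (f x))\<^sup>2)"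
    using f T by (simp add: square_integrable_def)
  then have "integrable lborel (\<lambda>x. (cmod (f (T x)))\<^sup>2)"
    using f T by (subst (asm) integrable_distr_eq) (auto simp: square_integrable_def)
  then show ?thesis
    using f T by (auto simp: square_integrable_def)
qed

lemma AE_compose:
  fixes T :: "'a::euclidean_space \<Rightarrow> 'a"
  assumes T: "T \<in> borel_measurable borel" "distr lborel borel T = lborel"
    and P: "AE x in lborel. P x"
  shows "AE x in lborel. P (T x)"
proof -
  have "AE x in distr lborel borel T. P x" using P by (simp only: T(2))
  then show ?thesis by (rule AE_distrD[rotated]) (use T in simp)
qed

section \<open>The Heisenberg group\<close>

type_synonym 'n heis = "(real ^ 'n) \<times> (real ^ 'n) \<times> real"

definition heis_mult :: "'n::finite heis \<Rightarrow> 'n heis \<Rightarrow> 'n heis" where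
  "heis_mult = (\<lambda>(x, y, t) (x', y', t').
     (x + x', y + y', t + t' + (1/2) * (inner x' y - inner y' x)))"

definition heis_inv :: "'n::finite heis \<Rightarrow> 'n heis" where
  "heis_inv = (\<lambda>(x, y, t). (- x, - y, - t))"

lemma heis_mult_assoc: "heis_mult (heis_mult g h) k = heis_mult g (heis_mult h k)"
  by (simp add: heis_mult_def inner_add_left inner_add_right field_simps split: prod.splits)

lemma heis_mult_one: "heis_mult (0, 0, 0) g = g" "heis_mult g (0, 0, 0) = g"
  by (auto simp: heis_mult_def split: prod.splits)

lemma heis_mult_inv: "heis_mult (heis_inv g) g = (0, 0, 0)" "heis_mult g (heis_inv g) = (0, 0, 0)"
  by (auto simp: heis_mult_def heis_inv_def inner_commute split: prod.splits)

lemma heis_mult_measurable: "heis_mult h \<in> borel_measurable borel"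
proof (cases h)
  case (fields a b c)
  have "continuous_on UNIV (heis_mult h)"
    unfolding fields heis_mult_def case_prod_beta by (intro continuous_intros)
  then show ?thesis by (rule borel_measurable_continuous_onI)
qed

lemma nn_integral_lborel_plus:
  fixes c :: "'a::euclidean_space"
  assumes "f \<in> borel_measurable borel"
  shows "(\<integral>\<^sup>+x. f (c + x) \<partial>lborel) = (\<integral>\<^sup>+x. f x \<partial>lborel)"
proof -
  have "(\<integral>\<^sup>+x. f x \<partial>distr lborel borel ((+) c)) = (\<integral>\<^sup>+x. f (c + x) \<partial>lborel)"
    using assms by (intro nn_integral_distr) auto
  then show ?thesis by (simp add: lborel_distr_plus)
qed

lemma lborel_distr_heis_mult: "distr lborel borel (heis_mult h) = lborel"
proof (rule measure_eqI)
  fix A assume "A \<in> sets (distr lborel borel (heis_mult h))"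
  then have A[measurable]: "A \<in> sets borel" by simp
  obtain a b c where h: "h = (a, b, c)" by (cases h)
  define f :: "'a heis \<Rightarrow> ennreal" where "f = indicator A"
  have f[measurable]: "f \<in> borel_measurable borel" unfolding f_def by simp
  note m = heis_mult_measurable[of h]
  have prod3: "(\<integral>\<^sup>+z. g z \<partial>lborel) = (\<integral>\<^sup>+x. \<integral>\<^sup>+y. \<integral>\<^sup>+t. g (x, y, t) \<partial>lborel \<partial>lborel \<partial>lborel)"
    if "g \<in> borel_measurable borel" for g :: "'a heis \<Rightarrow> ennreal"
  proof -
    have g1: "g \<in> borel_measurable (lborel \<Otimes>\<^sub>M lborel)"
      using that by (simp add: lborel_prod)
    have g2: "(\<lambda>p. g (x, p)) \<in> borel_measurable (lborel \<Otimes>\<^sub>M lborel)" for x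
      using that by (simp add: lborel_prod) 
    have "(\<integral>\<^sup>+z. g z \<partial>lborel) = (\<integral>\<^sup>+x. \<integral>\<^sup>+p. g (x, p) \<partial>lborel \<partial>lborel)"
      unfolding lborel_prod[symmetric, where 'b="(real^'a) \<times> real"] 
      by (subst lborel.nn_integral_fst[symmetric]) (use g1 in \<open>auto simp: lborel_prod\<close>)
    also have "\<dots> = (\<integral>\<^sup>+x. \<integral>\<^sup>+y. \<integral>\<^sup>+t. g (x, y, t) \<partial>lborel \<partial>lborel \<partial>lborel)"
      by (intro nn_integral_cong)
        (subst lborel_prod[symmetric], subst lborel.nn_integral_fst[symmetric], use g2 in auto)
    finally show ?thesis .
  qed
  have "emeasure (distr lborel borel (heis_mult h)) A = (\<integral>\<^sup>+z. f z \<partial>distr lborel borel (heis_mult h))"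
    unfolding f_def by simp
  also have "\<dots> = (\<integral>\<^sup>+z. f (heis_mult h z) \<partial>lborel)"
    using m by (intro nn_integral_distr) auto
  also have "\<dots> = (\<integral>\<^sup>+x. \<integral>\<^sup>+y. \<integral>\<^sup>+t. f (heis_mult h (x, y, t)) \<partial>lborel \<partial>lborel \<partial>lborel)"
    using m by (intro prod3) auto
  also have "\<dots> = (\<integral>\<^sup>+x. \<integral>\<^sup>+y. \<integral>\<^sup>+t. f (a + x, b + y, t) \<partial>lborel \<partial>lborel \<partial>lborel)"
  proof -
    have "(\<integral>\<^sup>+t. f (heis_mult h (x, y, t)) \<partial>lborel) = (\<integral>\<^sup>+t. f (a + x, b + y, t) \<partial>lborel)" for x y
      using nn_integral_lborel_plus[of "\<lambda>t. f (a + x, b + y, t)" "c + (1/2) * (inner x b - inner y a)"]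
      by (simp add: h heis_mult_def algebra_simps)
    then show ?thesis by simp
  qed
  also have "\<dots> = (\<integral>\<^sup>+x. \<integral>\<^sup>+y. \<integral>\<^sup>+t. f (a + x, y, t) \<partial>lborel \<partial>lborel \<partial>lborel)"
    by (intro nn_integral_cong nn_integral_lborel_plus[where f = "\<lambda>y. \<integral>\<^sup>+t. f (_, y, t) \<partial>lborel"])
       measurable
  also have "\<dots> = (\<integral>\<^sup>+x. \<integral>\<^sup>+y. \<integral>\<^sup>+t. f (x, y, t) \<partial>lborel \<partial>lborel \<partial>lborel)"
    by (intro nn_integral_lborel_plus[where f = "\<lambda>x. \<integral>\<^sup>+y. \<integral>\<^sup>+t. f (x, y, t) \<partial>lborel \<partial>lborel"])
       measurable
  also have "\<dots> = (\<integral>\<^sup>+z. f z \<partial>lborel)"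
    by (intro prod3[symmetric]) simp
  also have "\<dots> = emeasure lborel A" unfolding f_def by simp
  finally show "emeasure (distr lborel borel (heis_mult h)) A = emeasure lborel A" .
qed simp

lift_definition left_trans :: "'n::finite heis \<Rightarrow> 'n heis l2 \<Rightarrow> 'n heis l2"
  is "\<lambda>h f X. f (heis_mult (heis_inv h) X)"
  using square_integrable_compose[OF heis_mult_measurable lborel_distr_heis_mult]
    AE_compose[OF heis_mult_measurable lborel_distr_heis_mult]
  by blast

lift_definition schrodinger :: "real \<Rightarrow> 'n::finite heis \<Rightarrow> (real ^ 'n) l2 \<Rightarrow> (real ^ 'n) l2"
  is "\<lambda>(lam :: real) (x, y, t :: real) f \<xi>. exp (2 * pi * \<i> * lam * t)
        * exp (2 * pi * \<i> * lam * (inner x \<xi> + (1/2) * inner x y)) * f (\<xi> + y)"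
proof -
  fix lam :: real and X :: "'n heis" and f g :: "real ^ 'n \<Rightarrow> complex"
  obtain x y t where X: "X = (x, y, t)" by (cases X)
  assume fg: "square_integrable f \<and> square_integrable g \<and> (AE x in lborel. f x = g x)"
  define p where "p = (\<lambda>\<xi>::real^'n. exp (2 * pi * \<i> * lam * t)
        * exp (2 * pi * \<i> * lam * complex_of_real (inner x \<xi> + (1/2) * inner x y)))"
  have p_cont: "p \<in> borel_measurable borel" unfolding p_def
    by (intro borel_measurable_continuous_onI continuous_intros)
  have p_norm: "cmod (p \<xi>) = 1" for \<xi>
    unfolding p_def by (simp add: norm_mult)
  have si: "square_integrable (\<lambda>\<xi>. p \<xi> * u (\<xi> + y))" if "square_integrable u" for u
    using square_integrable_compose[OF _ lborel_distr_plus that, of y] p_cont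
    by (auto simp: square_integrable_def norm_mult p_norm add.commute)
  have "AE \<xi> in lborel. f (y + \<xi>) = g (y + \<xi>)"
    using fg AE_compose[OF _ lborel_distr_plus[of y], where P = "\<lambda>\<xi>. f \<xi> = g \<xi>"] by auto
  then have "AE \<xi> in lborel. p \<xi> * f (\<xi> + y) = p \<xi> * g (\<xi> + y)"
    by eventually_elim (simp add: add.commute)
  with si fg show "?thesis lam X f g"
    unfolding X p_def by simp
qed

section \<open>Hilbert-Schmidt operators\<close>

definition orthonormal_basis :: "(nat \<Rightarrow> 'a::euclidean_space l2) \<Rightarrow> bool" where
  "orthonormal_basis e \<longleftrightarrow>
     (\<forall>i j. cinner (e i) (e j) = (if i = j then 1 else 0)) \<and>
     (\<forall>f. (\<forall>i. cinner f (e i) = 0) \<longrightarrow> f = 0)"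

text \<open>The space is separable and infinite dimensional, so orthonormal bases indexed by \<open>nat\<close>
  exist. The quantities defined from the chosen one do not depend on the choice.\<close>

definition some_onb :: "nat \<Rightarrow> 'a::euclidean_space l2" where
  "some_onb = (SOME e. orthonormal_basis e)"

definition HS_norm_sq :: "('a::euclidean_space l2 \<Rightarrow> 'a l2) \<Rightarrow> ennreal" where
  "HS_norm_sq T = (\<Sum>i. ennreal ((norm (T (some_onb i)))\<^sup>2))"

definition HS_inner :: "('a::euclidean_space l2 \<Rightarrow> 'a l2) \<Rightarrow> ('a l2 \<Rightarrow> 'a l2) \<Rightarrow> complex" where
  "HS_inner S T = (\<Sum>i. cinner (S (some_onb i)) (T (some_onb i)))"

definition hilbert_schmidt :: "('a::euclidean_space l2 \<Rightarrow> 'a l2) \<Rightarrow> bool" where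
  "hilbert_schmidt T \<longleftrightarrow>
     bounded_linear T \<and> (\<forall>c f. T (c *\<^sub>C f) = c *\<^sub>C T f) \<and> HS_norm_sq T < \<infinity>"

section \<open>The group Fourier transform\<close>

text \<open>On integrable functions the operator-valued integral is taken in the weak sense.\<close>

definition fourier_L1 ::
    "('n::finite heis \<Rightarrow> complex) \<Rightarrow> real \<Rightarrow> (real ^ 'n) l2 \<Rightarrow> (real ^ 'n) l2" where
  "fourier_L1 f lam \<phi> =
     (THE v. \<forall>\<psi>. cinner v \<psi> = (LINT X|lborel. f X * cinner (schrodinger lam X \<phi>) \<psi>))"

text \<open>Square of the norm in \<open>L\<^sup>2(\<real> - {0}, B\<^sub>2; |lam|\<^sup>n d lam)\<close>, where \<open>B\<^sub>2\<close> is the space of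
  Hilbert-Schmidt operators.\<close>

definition field_norm_sq :: "(real \<Rightarrow> (real ^ 'n::finite) l2 \<Rightarrow> (real ^ 'n) l2) \<Rightarrow> ennreal" where
  "field_norm_sq F =
     (\<integral>\<^sup>+ lam \<in> - {0}. HS_norm_sq (F lam) * ennreal (\<bar>lam\<bar> ^ CARD('n)) \<partial>lebesgue)"

text \<open>As \<open>B\<^sub>2\<close> is separable, measurability of a field is equivalent to weak measurability.\<close>

definition L2_field :: "(real \<Rightarrow> (real ^ 'n::finite) l2 \<Rightarrow> (real ^ 'n) l2) \<Rightarrow> bool" where
  "L2_field F \<longleftrightarrow>
     (\<forall>lam. lam \<noteq> 0 \<longrightarrow> hilbert_schmidt (F lam)) \<and>
     (\<forall>\<phi> \<psi>. (\<lambda>lam. cinner (F lam \<phi>) \<psi>) \<in> borel_measurable (lebesgue_on (- {0}))) \<and>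
     field_norm_sq F < \<infinity>"

text \<open>\<open>F\<close> is the value at \<open>\<phi>\<close> of the continuous extension of the Fourier transform from
  \<open>L\<^sup>1 \<inter> L\<^sup>2\<close> to \<open>L\<^sup>2\<close>; it is unique up to null sets of \<open>lam\<close>.\<close>

definition is_fourier_L2 ::
    "'n::finite heis l2 \<Rightarrow> (real \<Rightarrow> (real ^ 'n) l2 \<Rightarrow> (real ^ 'n) l2) \<Rightarrow> bool" where
  "is_fourier_L2 \<phi> F \<longleftrightarrow> L2_field F \<and>
     (\<forall>g. (\<forall>j. integrable lborel (rep_l2 (g j))) \<and> g \<longlonglongrightarrow> \<phi> \<longrightarrow>
        (\<lambda>j. field_norm_sq (\<lambda>lam f. fourier_L1 (rep_l2 (g j)) lam f - F lam f)) \<longlonglongrightarrow> 0)"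

definition fourier_L2 ::
    "'n::finite heis l2 \<Rightarrow> real \<Rightarrow> (real ^ 'n) l2 \<Rightarrow> (real ^ 'n) l2" where
  "fourier_L2 \<phi> = (SOME F. is_fourier_L2 \<phi> F)"

section \<open>The functions \<open>G\<close> and the system of translates\<close>

definition real_vec :: "int ^ 'n::finite \<Rightarrow> real ^ 'n" where
  "real_vec k = (\<chi> i. real_of_int (k $ i))"

definition translate ::
    "'n::finite heis l2 \<Rightarrow> (int ^ 'n) \<times> (int ^ 'n) \<times> int \<Rightarrow> 'n heis l2" where
  "translate \<phi> = (\<lambda>(k, l, m). left_trans (2 *\<^sub>R real_vec k, real_vec l, real_of_int m) \<phi>)"

text \<open>The unordered sum over \<open>r\<close> converges for almost every \<open>lam\<close>; where it does not, its value
  is \<open>0\<close> by convention of \<open>infsum\<close>.\<close>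

definition G :: "'n::finite heis l2 \<Rightarrow> int ^ 'n \<Rightarrow> int ^ 'n \<Rightarrow> real \<Rightarrow> complex" where
  "G \<phi> k l lam = (\<Sum>\<^sub>\<infinity>r\<in>(UNIV :: int set).
     HS_inner (fourier_L2 \<phi> (lam + real_of_int r)) (fourier_L2 (translate \<phi> (k, l, 0)) (lam + real_of_int r))
       * complex_of_real (\<bar>lam + real_of_int r\<bar> ^ CARD('n)))"

definition condition_C :: "'n::finite heis l2 \<Rightarrow> bool" where
  "condition_C \<phi> \<longleftrightarrow>
     (\<forall>k l. (k, l) \<noteq> (0, 0) \<longrightarrow> (AE lam in lebesgue_on {0<..1}. G \<phi> k l lam = 0))"

text \<open>\<open>G \<phi> 0 0\<close> is nonnegative almost everywhere. In \<open>ennreal\<close>, \<open>1 / 0 = \<infinity>\<close>.\<close>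

definition recip_G00 :: "'n::finite heis l2 \<Rightarrow> real \<Rightarrow> ennreal" where
  "recip_G00 \<phi> lam = 1 / ennreal (Re (G \<phi> 0 0 lam))"

definition in_L1 :: "'a measure \<Rightarrow> ('a \<Rightarrow> ennreal) \<Rightarrow> bool" where
  "in_L1 M f \<longleftrightarrow> f \<in> borel_measurable M \<and> (\<integral>\<^sup>+ x. f x \<partial>M) < \<infinity>"

definition Linf_norm :: "'a measure \<Rightarrow> ('a \<Rightarrow> complex) \<Rightarrow> ereal" where
  "Linf_norm M f = esssup M (\<lambda>x. ereal (cmod (f x)))"

section \<open>Hilbertian families and Bessel sequences\<close>

text \<open>The index set of dimension \<open>d = 2n + 1\<close> is split as \<open>(k, l, m)\<close>.\<close>

type_synonym 'n idx = "(int ^ 'n) \<times> (int ^ 'n) \<times> int"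

definition cube :: "nat \<Rightarrow> 'n::finite idx set" where
  "cube N = {(k, l, m). (\<forall>i. \<bar>k $ i\<bar> \<le> int N) \<and> (\<forall>i. \<bar>l $ i\<bar> \<le> int N) \<and> \<bar>m\<bar> \<le> int N}"

lemma finite_cube: "finite (cube N :: 'n::finite idx set)"
proof -
  have vec: "finite {k :: int ^ 'n. \<forall>i. \<bar>k $ i\<bar> \<le> int N}"
  proof (rule finite_subset)
    show "{k :: int ^ 'n. \<forall>i. \<bar>k $ i\<bar> \<le> int N} \<subseteq> vec_lambda ` (UNIV \<rightarrow>\<^sub>E {- int N..int N})"
    proof
      fix k :: "int ^ 'n" assume "k \<in> {k. \<forall>i. \<bar>k $ i\<bar> \<le> int N}"
      then have "vec_nth k \<in> UNIV \<rightarrow>\<^sub>E {- int N..int N}" by (auto simp: abs_le_iff minus_le_iff)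
      then show "k \<in> vec_lambda ` (UNIV \<rightarrow>\<^sub>E {- int N..int N})"
        by (metis image_eqI vec_nth_inverse)
    qed
  qed (intro finite_imageI finite_PiE; simp)
  have "cube N \<subseteq> {k. \<forall>i. \<bar>k $ i\<bar> \<le> int N} \<times> {l. \<forall>i. \<bar>l $ i\<bar> \<le> int N} \<times> {- int N..int N}"
    by (auto simp: cube_def)
  then show ?thesis
    by (rule finite_subset) (intro finite_cartesian_product vec finite_atLeastAtMost_int)
qed

definition hilbertian :: "('n::finite idx \<Rightarrow> 'a::euclidean_space l2) \<Rightarrow> bool" where
  "hilbertian f \<longleftrightarrow>
     (\<forall>c :: 'n idx \<Rightarrow> complex. (\<lambda>j. (cmod (c j))\<^sup>2) summable_on UNIV \<longrightarrow>
        convergent (\<lambda>N. \<Sum>j\<in>cube N. c j *\<^sub>C f j))"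

definition bessel_sequence :: "('n::finite idx \<Rightarrow> 'a::euclidean_space l2) \<Rightarrow> bool" where
  "bessel_sequence f \<longleftrightarrow>
     (\<exists>B>0. \<forall>h. (\<lambda>j. (cmod (cinner h (f j)))\<^sup>2) summable_on UNIV \<and>
        (\<Sum>\<^sub>\<infinity>j. (cmod (cinner h (f j)))\<^sup>2) \<le> B * (norm h)\<^sup>2)"

end

theory Submission
  imports Defs "HOL-Probability.Probability"
begin

text \<open>The Fourier transform turns the square of the norm of a sum of translates into an integral of
trigonometric polynomials against \<open>G \<phi> 0 0\<close>, and then all three conditions say that this
weight is bounded.

In detail, realise the transform of \<open>\<phi>\<close> by a square integrable kernel \<open>K (lam, \<xi>, \<eta>)\<close>,
normalised so that \<open>\<phi> \<mapsto> K\<close> (the map \<open>heis_plancherel\<close>) is a complex linear isometry of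
Hilbert spaces. A translation by the central element \<open>(0, 0, m)\<close> multiplies \<open>K\<close> by
\<open>exp (2 \<pi> i m lam)\<close>. Integrating over \<open>\<xi>\<close> and \<open>\<eta>\<close> first and then cutting the line into the
intervals \<open>(r, r + 1]\<close> shows that the inner product of the translates with indices \<open>(0, 0, m)\<close> and
\<open>(k, l, 0)\<close> is a Fourier coefficient of \<open>G \<phi> k l\<close> (lemma \<open>cinner_translate_central\<close>). All
other inner products of translates are of this form, because left translations are unitary and the
points \<open>(2 k, l, m)\<close> form a subgroup (\<open>cinner_translate\<close>). Hence condition C makes the fibres
\<open>{(k, l, m). m \<in> \<int>}\<close> with different \<open>(k, l)\<close> orthogonal, and on one fibre the square of the
norm of \<open>\<Sum>m. a m *\<^sub>C translate \<phi> (k, l, m)\<close> is the integral over \<open>(0, 1]\<close> of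
\<open>\<bar>P\<bar>\<^sup>2 * G \<phi> 0 0\<close>, where \<open>P\<close> is the trigonometric polynomial with coefficients \<open>a\<close>
(\<open>norm_fibre_sum\<close>).

If \<open>G \<phi> 0 0 \<le> B\<close>, orthonormality of the exponentials gives
\<open>\<parallel>\<Sum>c j f j\<parallel>\<^sup>2 \<le> B \<Sum>\<bar>c j\<bar>\<^sup>2\<close> for finite sums (\<open>synthesis_bound_translate\<close>). By duality this
inequality is the Bessel property, and with completeness it implies convergence for every square
summable \<open>c\<close>. Conversely, if the family is Hilbertian, then the inequality holds with some constant
on the fibre \<open>k = l = 0\<close>: otherwise a gliding hump along the centre produces a divergent series
(\<open>hilbertian_imp_fibre_bound\<close>). Testing it with trigonometric polynomials that converge to the
indicator function of a compact set bounds \<open>G \<phi> 0 0\<close> (\<open>weight_bounded\<close>).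

The first part of the theory builds the transform: completeness of the Hilbert space and existence
of orthonormal bases, Plancherel's theorem on Euclidean space, the isometry from kernels to
Hilbert--Schmidt operators, and the identification of \<open>fourier_L2\<close> with the operator field of the
kernel \<open>K\<close>, which determines it almost everywhere on the chosen basis
(\<open>fourier_L2_eq_kernel_field\<close>).\<close>

section \<open>The Hilbert space of square integrable functions\<close>

lemma abs_rep_l2 [simp]: "abs_l2 (rep_l2 f) = f"
  by (simp add: Quotient3_abs_rep[OF Quotient3_l2])

lemma abs_l2_eqI:
  assumes "square_integrable f" "square_integrable g" "AE x in lborel. f x = g x"
  shows "abs_l2 f = abs_l2 g"
  using assms by (intro Quotient3_rel_abs[OF Quotient3_l2]) auto

lemma AE_rep_abs_l2:
  assumes "square_integrable f"
  shows "AE x in lborel. rep_l2 (abs_l2 f) x = f x"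
  using Quotient3_rep_abs[OF Quotient3_l2, of f] assms by auto

lemma l2_eqI:
  assumes "AE x in lborel. rep_l2 f x = rep_l2 g x"
  shows "f = g"
  using abs_l2_eqI[OF square_integrable_rep_l2 square_integrable_rep_l2 assms] by simp

lemma square_integrable_measurable [measurable_dest]:
  "square_integrable f \<Longrightarrow> f \<in> borel_measurable borel"
  by (simp add: square_integrable_def)

lemma measurable_rep_l2 [measurable]: "rep_l2 f \<in> borel_measurable borel"
  using square_integrable_rep_l2 square_integrable_measurable by blast

lemma square_integrable_minus:
  assumes "square_integrable f" "square_integrable g"
  shows "square_integrable (\<lambda>x. f x - g x)"
  using square_integrable_add[OF assms(1) square_integrable_cmult[OF assms(2), of "-1"]] by simp

lemma square_integrable_iff_nn:
  "square_integrable f \<longleftrightarrow>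
    f \<in> borel_measurable borel \<and> (\<integral>\<^sup>+x. ennreal ((cmod (f x))\<^sup>2) \<partial>lborel) < \<infinity>"
  unfolding square_integrable_def by (auto simp: integrable_iff_bounded)

lemma abs_l2_add:
  assumes "square_integrable f" "square_integrable g"
  shows "abs_l2 f + abs_l2 g = abs_l2 (\<lambda>x. f x + g x)"
  using assms by (intro plus_l2.abs_eq) auto

lemma abs_l2_scaleC:
  assumes "square_integrable f"
  shows "c *\<^sub>C abs_l2 f = abs_l2 (\<lambda>x. c * f x)"
  using assms by (intro scaleC_l2.abs_eq) auto

lemma scaleR_l2_eq: "r *\<^sub>R (f :: 'a::euclidean_space l2) = complex_of_real r *\<^sub>C f"
  by (simp add: scaleR_l2_def)

lemma abs_l2_minus:
  assumes "square_integrable f" "square_integrable g"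
  shows "abs_l2 f - abs_l2 g = abs_l2 (\<lambda>x. f x - g x)"
proof -
  have "abs_l2 f - abs_l2 g + abs_l2 g = abs_l2 (\<lambda>x. f x - g x) + abs_l2 g"
    by (simp add: abs_l2_add square_integrable_minus assms)
  then show ?thesis by simp
qed

lemma cinner_abs_l2:
  assumes "square_integrable f" "square_integrable g"
  shows "cinner (abs_l2 f) (abs_l2 g) = (LINT x|lborel. f x * cnj (g x))"
  using assms by (intro cinner.abs_eq) auto

lemma cinner_rep_l2: "cinner f g = (LINT x|lborel. rep_l2 f x * cnj (rep_l2 g x))"
  by (simp add: cinner_def)

lemma power2_norm_l2: "(norm f)\<^sup>2 = (LINT x|lborel. (cmod (rep_l2 f x))\<^sup>2)"
  unfolding norm_l2_def inner_l2_def by (simp add: cinner_self)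

lemma power2_norm_abs_l2:
  assumes "square_integrable f"
  shows "(norm (abs_l2 f))\<^sup>2 = (LINT x|lborel. (cmod (f x))\<^sup>2)"
  unfolding power2_norm_l2 using AE_rep_abs_l2[OF assms] assms
  by (intro integral_cong_AE) auto

lemma ennreal_power2_norm_abs_l2:
  assumes "square_integrable f"
  shows "ennreal ((norm (abs_l2 f))\<^sup>2) = (\<integral>\<^sup>+x. ennreal ((cmod (f x))\<^sup>2) \<partial>lborel)"
  unfolding power2_norm_abs_l2[OF assms]
  using assms by (intro nn_integral_eq_integral[symmetric]) (auto simp: square_integrable_def)

lemma ennreal_power2_norm_l2:
  "ennreal ((norm f)\<^sup>2) = (\<integral>\<^sup>+x. ennreal ((cmod (rep_l2 f x))\<^sup>2) \<partial>lborel)"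
  using ennreal_power2_norm_abs_l2[OF square_integrable_rep_l2[of f]] by simp

lemma AE_rep_minus: "AE x in lborel. rep_l2 (f - g) x = rep_l2 f x - rep_l2 g x"
  using AE_rep_abs_l2[OF square_integrable_minus[OF square_integrable_rep_l2[of f] square_integrable_rep_l2[of g]]]
  by (simp add: abs_l2_minus[symmetric] square_integrable_rep_l2)

lemma AE_rep_zero: "AE x in lborel. rep_l2 0 x = 0"
  using AE_rep_abs_l2[OF square_integrable_zero] by (simp add: zero_l2_def)

subsection \<open>The sesquilinear form\<close>

lemma cinner_commute: "cinner f g = cnj (cinner g f)"
  by transfer (simp add: Bochner_Integration.integral_cnj[symmetric] mult.commute
        del: Bochner_Integration.integral_cnj)

lemma cinner_add_left: "cinner (f + g) h = cinner f h + cinner g h"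
  by transfer (simp add: distrib_right square_integrable_mult)

lemma cinner_scaleC_left [simp]: "cinner (c *\<^sub>C f) g = c * cinner f g"
  by transfer (simp add: mult.assoc)

lemma cinner_add_right: "cinner h (f + g) = cinner h f + cinner h g"
  by (metis cinner_add_left cinner_commute complex_cnj_add)

lemma cinner_scaleC_right [simp]: "cinner f (c *\<^sub>C g) = cnj c * cinner f g"
  by (metis cinner_scaleC_left cinner_commute complex_cnj_mult)

lemma cinner_zero_left [simp]: "cinner 0 g = 0"
  using cinner_add_left[of 0 0 g] by simp

lemma cinner_zero_right [simp]: "cinner g 0 = 0"
  using cinner_add_right[of g 0 0] by simp

lemma cinner_diff_left: "cinner (f - g) h = cinner f h - cinner g h"
  using cinner_add_left[of "f - g" g h] by simp

lemma cinner_diff_right: "cinner h (f - g) = cinner h f - cinner h g"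
  using cinner_add_right[of h "f - g" g] by simp

lemma cinner_sum_left: "cinner (\<Sum>i\<in>A. f i) g = (\<Sum>i\<in>A. cinner (f i) g)"
  by (induction A rule: infinite_finite_induct) (auto simp: cinner_add_left)

lemma cinner_sum_right: "cinner g (\<Sum>i\<in>A. f i) = (\<Sum>i\<in>A. cinner g (f i))"
  by (induction A rule: infinite_finite_induct) (auto simp: cinner_add_right)

lemma scaleC_add_right: "c *\<^sub>C (f + g) = c *\<^sub>C f + c *\<^sub>C (g :: 'a::euclidean_space l2)"
  by transfer (auto simp: distrib_left intro!: square_integrable_add square_integrable_cmult)

lemma scaleC_add_left: "(c + d) *\<^sub>C f = c *\<^sub>C f + d *\<^sub>C (f :: 'a::euclidean_space l2)"
  by transfer (auto simp: distrib_right intro!: square_integrable_add square_integrable_cmult)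

lemma scaleC_scaleC [simp]: "c *\<^sub>C d *\<^sub>C f = (c * d) *\<^sub>C (f :: 'a::euclidean_space l2)"
  by transfer (auto simp: mult.assoc intro!: square_integrable_cmult)

lemma scaleC_zero_left [simp]: "0 *\<^sub>C f = (0 :: 'a::euclidean_space l2)"
  using scaleC_add_left[of 0 0 f] by simp

lemma scaleC_zero_right [simp]: "c *\<^sub>C 0 = (0 :: 'a::euclidean_space l2)"
  using scaleC_add_right[of c 0 0] by simp

lemma scaleC_diff_right: "c *\<^sub>C (f - g) = c *\<^sub>C f - c *\<^sub>C (g :: 'a::euclidean_space l2)"
  using scaleC_add_right[of c "f - g" g] by simp

lemma scaleC_sum_right: "c *\<^sub>C (\<Sum>i\<in>A. f i) = (\<Sum>i\<in>A. c *\<^sub>C (f i :: 'a::euclidean_space l2))"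
  by (induction A rule: infinite_finite_induct) (auto simp: scaleC_add_right)

lemma cinner_self_norm: "cinner f f = complex_of_real ((norm f)\<^sup>2)"
  by (simp add: cinner_self power2_norm_l2)

lemma norm_scaleC [simp]: "norm (c *\<^sub>C f) = cmod c * norm (f :: 'a::euclidean_space l2)"
proof -
  have "complex_of_real ((norm (c *\<^sub>C f))\<^sup>2) = c * cnj c * complex_of_real ((norm f)\<^sup>2)"
    by (simp add: cinner_self_norm[symmetric] del: of_real_power)
  also have "\<dots> = complex_of_real ((cmod c * norm f)\<^sup>2)"
    unfolding complex_norm_square[symmetric] by (simp add: power_mult_distrib)
  finally have "(norm (c *\<^sub>C f))\<^sup>2 = (cmod c * norm f)\<^sup>2"
    using of_real_eq_iff by blast
  then show ?thesis by (simp add: power2_eq_iff_nonneg)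
qed

text \<open>Multiplying \<open>f\<close> by a phase makes the complex inner product real, which reduces the estimate
  to the Cauchy--Schwarz inequality of the underlying real inner product space.\<close>

lemma cmod_cinner_le: "cmod (cinner f g) \<le> norm f * norm g"
proof (cases "cinner f g = 0")
  case False
  define c where "c = cnj (cinner f g) / cmod (cinner f g)"
  have c: "cmod c = 1" using False by (simp add: c_def norm_divide)
  have "c * cinner f g = complex_of_real (cmod (cinner f g))"
    using False by (simp add: c_def complex_norm_square[symmetric] mult.commute power2_eq_square divide_simps
        flip: of_real_mult)
  then have "cmod (cinner f g) = inner (c *\<^sub>C f) g"
    unfolding inner_l2_def by simp
  also have "\<dots> \<le> norm (c *\<^sub>C f) * norm g" by (rule norm_cauchy_schwarz)
  finally show ?thesis by (simp add: c)
qed simp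

lemma cinner_eq_zero_iff: "cinner f f = 0 \<longleftrightarrow> f = 0"
  by (simp add: cinner_self_norm)

lemma tendsto_cinner:
  assumes "(f \<longlongrightarrow> a) F" "(g \<longlongrightarrow> b) F"
  shows "((\<lambda>x. cinner (f x) (g x)) \<longlongrightarrow> cinner a b) F"
proof -
  have R: "Re (cinner u v) = inner u v" for u v :: "'b l2" by (simp add: inner_l2_def)
  have I: "Im (cinner u v) = inner u (\<i> *\<^sub>C v)" for u v :: "'b l2"
    by (simp add: inner_l2_def)
  have "norm (\<i> *\<^sub>C g x - \<i> *\<^sub>C b) = norm (g x - b)" for x
    by (simp flip: scaleC_diff_right)
  then have "((\<lambda>x. \<i> *\<^sub>C g x) \<longlongrightarrow> \<i> *\<^sub>C b) F"
    using assms(2) unfolding tendsto_iff dist_norm by simp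
  then show ?thesis
    unfolding tendsto_complex_iff R I using assms by (intro conjI tendsto_inner)
qed

lemma tendsto_scaleC:
  fixes f :: "'c \<Rightarrow> 'a::euclidean_space l2"
  assumes "(f \<longlongrightarrow> a) F" shows "((\<lambda>x. c *\<^sub>C f x) \<longlongrightarrow> c *\<^sub>C a) F"
proof -
  have "((\<lambda>x. cmod c * norm (f x - a)) \<longlongrightarrow> cmod c * 0) F"
    using assms by (intro tendsto_mult_left) (simp add: tendsto_norm_zero_iff LIM_zero)
  then show ?thesis
    by (subst LIM_zero_iff[symmetric], subst tendsto_norm_zero_iff[symmetric])
       (simp flip: scaleC_diff_right)
qed

text \<open>The inner product is determined by norms, so every norm preserving complex linear map
  preserves it.\<close>

lemma cinner_polarization:
  "4 * cinner f g = of_real ((norm (f + g))\<^sup>2) - of_real ((norm (f - g))\<^sup>2)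
     + \<i> * of_real ((norm (f + \<i> *\<^sub>C g))\<^sup>2) - \<i> * of_real ((norm (f - \<i> *\<^sub>C g))\<^sup>2)"
  unfolding cinner_self_norm[symmetric]
  by (simp add: cinner_add_left cinner_add_right cinner_diff_left cinner_diff_right algebra_simps)

subsection \<open>Completeness\<close>

text \<open>The weighted sum \<open>\<Sum>n. 2^n * \<bar>f n x\<bar>\<^sup>2\<close> still has a finite integral. It is therefore finite almost
  everywhere, which forces geometric decay of \<open>f n x\<close>.\<close>

lemma AE_summable_of_geometric_L2:
  fixes f :: "nat \<Rightarrow> 'a::euclidean_space \<Rightarrow> complex"
  assumes meas [measurable]: "\<And>n. f n \<in> borel_measurable borel"
    and le: "\<And>n. (\<integral>\<^sup>+x. ennreal ((cmod (f n x))\<^sup>2) \<partial>lborel) \<le> ennreal ((1/4)^n)"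
  shows "AE x in lborel. summable (\<lambda>n. f n x)"
proof -
  have "(\<integral>\<^sup>+x. (\<Sum>n. ennreal (2^n * (cmod (f n x))\<^sup>2)) \<partial>lborel)
      = (\<Sum>n. \<integral>\<^sup>+x. ennreal (2^n) * ennreal ((cmod (f n x))\<^sup>2) \<partial>lborel)"
    by (subst nn_integral_suminf) (auto simp: ennreal_mult)
  also have "\<dots> = (\<Sum>n. ennreal (2^n) * (\<integral>\<^sup>+x. ennreal ((cmod (f n x))\<^sup>2) \<partial>lborel))"
    by (intro suminf_cong nn_integral_cmult) measurable
  also have "\<dots> \<le> (\<Sum>n. ennreal (2^n) * ennreal ((1/4)^n))"
    using le by (intro suminf_le mult_left_mono) auto
  also have "\<dots> = (\<Sum>n. ennreal ((1/2)^n))"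
    by (intro suminf_cong) (simp add: ennreal_mult[symmetric] power_mult_distrib[symmetric])
  also have "\<dots> = ennreal (\<Sum>n. (1/2)^n)"
    by (intro suminf_ennreal_eq[OF _ summable_sums]) (auto intro!: summable_geometric)
  finally have "(\<integral>\<^sup>+x. (\<Sum>n. ennreal (2^n * (cmod (f n x))\<^sup>2)) \<partial>lborel) \<noteq> \<infinity>"
    by (auto simp: top_unique)
  then have "AE x in lborel. (\<Sum>n. ennreal (2^n * (cmod (f n x))\<^sup>2)) \<noteq> \<infinity>"
    by (intro nn_integral_PInf_AE) measurable
  then show ?thesis
  proof eventually_elim
    case (elim x)
    define a where "a n = ennreal (2^n * (cmod (f n x))\<^sup>2)" for n
    from elim have "suminf a \<noteq> top" by (simp add: a_def[abs_def])
    then obtain C where C: "C \<ge> 0" "suminf a = ennreal C" by (cases "suminf a") auto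
    have bound: "norm (f n x) \<le> sqrt C * (sqrt (1/2))^n" for n
    proof -
      have "(\<Sum>i\<in>{n}. a i) \<le> suminf a" by (intro sum_le_suminf) auto
      then have "ennreal (2^n * (cmod (f n x))\<^sup>2) \<le> ennreal C" by (simp add: C a_def)
      then have "2^n * (cmod (f n x))\<^sup>2 \<le> C" using C(1) by (subst (asm) ennreal_le_iff)
      then have "(cmod (f n x))\<^sup>2 \<le> C * (1/2)^n" by (simp add: field_simps)
      then have "sqrt ((cmod (f n x))\<^sup>2) \<le> sqrt (C * (1/2)^n)" by (rule real_sqrt_le_mono)
      then show ?thesis unfolding real_sqrt_mult real_sqrt_power by simp
    qed
    have "summable (\<lambda>n. sqrt C * (sqrt (1/2))^n)"
      by (intro summable_mult summable_geometric) (auto simp: real_less_lsqrt)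
    then show ?case using bound by (rule summable_comparison_test'[where N = 0]) 
  qed
qed

text \<open>Riesz--Fischer: a subsequence with geometrically small increments converges almost
  everywhere, and Fatou's lemma identifies the pointwise limit as the limit in norm.\<close>

instance l2 :: (euclidean_space) complete_space
proof
  fix X :: "nat \<Rightarrow> 'a l2" assume X: "Cauchy X"
  have "\<exists>N. \<forall>m\<ge>N. \<forall>n\<ge>N. dist (X m) (X n) < (1/2)^k" for k :: nat
    using X unfolding Cauchy_def by (simp add: zero_less_power)
  then obtain N where N: "\<And>k m n. m \<ge> N k \<Longrightarrow> n \<ge> N k \<Longrightarrow> dist (X m) (X n) < (1/2)^k"
    by metis
  define r where "r = rec_nat (N 0) (\<lambda>k rk. max (Suc rk) (N (Suc k)))"
  have rS: "r (Suc k) = max (Suc (r k)) (N (Suc k))" for k by (simp add: r_def)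
  have r: "strict_mono r" unfolding strict_mono_Suc_iff rS by auto
  have rN: "r k \<ge> N k" for k by (cases k) (auto simp: r_def)
  have small: "dist (X (r m)) (X (r k)) < (1/2)^k" if "m \<ge> k" for m k
    by (meson N rN r strict_mono_leD le_trans that)
  define f where "f = (\<lambda>n. rep_l2 (X (r n)))"
  have [measurable]: "f n \<in> borel_measurable borel" for n by (simp add: f_def)
  have diff: "(\<integral>\<^sup>+x. ennreal ((cmod (f m x - f n x))\<^sup>2) \<partial>lborel) = ennreal ((dist (X (r m)) (X (r n)))\<^sup>2)"
    for m n
    unfolding dist_norm ennreal_power2_norm_l2 f_def
    using AE_rep_minus[of "X (r m)" "X (r n)"] by (intro nn_integral_cong_AE) auto
  have sq: "((1/2::real)^n)\<^sup>2 = (1/4)^n" for n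
    unfolding power_mult[symmetric] by (simp add: mult.commute[of n 2] power_mult power2_eq_square)
  have "AE x in lborel. summable (\<lambda>n. f (Suc n) x - f n x)"
  proof (rule AE_summable_of_geometric_L2)
    fix n
    have "(dist (X (r (Suc n))) (X (r n)))\<^sup>2 \<le> ((1/2)^n)\<^sup>2"
      using small[of n "Suc n"] by (intro power_mono) auto
    then show "(\<integral>\<^sup>+x. ennreal ((cmod (f (Suc n) x - f n x))\<^sup>2) \<partial>lborel) \<le> ennreal ((1/4)^n)"
      unfolding diff sq by (rule ennreal_leI)
  qed measurable
  then have conv: "AE x in lborel. convergent (\<lambda>n. f n x)"
  proof eventually_elim
    case (elim x)
    have "(\<Sum>i<n. f (Suc i) x - f i x) = f n x - f 0 x" for n
      by (rule sum_lessThan_telescope)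
    with elim have "convergent (\<lambda>n. f n x - f 0 x)"
      by (simp add: summable_iff_convergent)
    then have "convergent (\<lambda>n. (f n x - f 0 x) + f 0 x)"
      by (intro convergent_add convergent_const)
    then show ?case by simp
  qed
  define g where "g x = lim (\<lambda>n. f n x)" for x
  have [measurable]: "g \<in> borel_measurable borel"
    unfolding g_def by (rule borel_measurable_lim_metric) measurable
  have fg: "(\<integral>\<^sup>+x. ennreal ((cmod (g x - f k x))\<^sup>2) \<partial>lborel) \<le> ennreal (((1/2)^k)\<^sup>2)" for k
  proof -
    have "(\<integral>\<^sup>+x. ennreal ((cmod (g x - f k x))\<^sup>2) \<partial>lborel)
        = (\<integral>\<^sup>+x. liminf (\<lambda>m. ennreal ((cmod (f m x - f k x))\<^sup>2)) \<partial>lborel)"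
    proof (intro nn_integral_cong_AE, use conv in eventually_elim)
      case (elim x)
      then have "(\<lambda>n. f n x) \<longlonglongrightarrow> g x" by (simp add: g_def convergent_LIMSEQ_iff)
      then have "(\<lambda>m. ennreal ((cmod (f m x - f k x))\<^sup>2)) \<longlonglongrightarrow> ennreal ((cmod (g x - f k x))\<^sup>2)"
        by (intro tendsto_intros)
      then show ?case by (simp add: lim_imp_Liminf del: tendsto_ennreal_iff)
    qed
    also have "\<dots> \<le> liminf (\<lambda>m. \<integral>\<^sup>+x. ennreal ((cmod (f m x - f k x))\<^sup>2) \<partial>lborel)"
      by (intro nn_integral_liminf) measurable
    also have "\<dots> \<le> liminf (\<lambda>m::nat. ennreal (((1/2)^k)\<^sup>2))"
    proof (intro Liminf_mono eventually_sequentiallyI[of k])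
      fix m assume "m \<ge> k"
      then show "(\<integral>\<^sup>+x. ennreal ((cmod (f m x - f k x))\<^sup>2) \<partial>lborel) \<le> ennreal (((1/2)^k)\<^sup>2)"
        unfolding diff using small[of k m] by (intro ennreal_leI power_mono) auto
    qed
    finally show ?thesis by (simp add: Liminf_const)
  qed
  have "square_integrable (\<lambda>x. g x - f 0 x)"
    unfolding square_integrable_iff_nn using fg[of 0] by (auto simp: le_less_trans)
  from square_integrable_add[OF this, of "f 0"] have g: "square_integrable g"
    by (simp add: f_def square_integrable_rep_l2)
  have "norm (abs_l2 g - X (r k)) \<le> (1/2)^k" for k
  proof -
    have "abs_l2 g - X (r k) = abs_l2 (\<lambda>x. g x - f k x)"
      using abs_l2_minus[OF g square_integrable_rep_l2[of "X (r k)"]] by (simp add: f_def)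
    then have "ennreal ((norm (abs_l2 g - X (r k)))\<^sup>2) \<le> ennreal (((1/2)^k)\<^sup>2)"
      using fg[of k] by (simp add: ennreal_power2_norm_abs_l2 square_integrable_minus g f_def square_integrable_rep_l2)
    then have "(norm (abs_l2 g - X (r k)))\<^sup>2 \<le> ((1/2)^k)\<^sup>2" by (subst (asm) ennreal_le_iff) auto
    then show ?thesis by (rule power2_le_imp_le) simp
  qed
  then have "(\<lambda>k. abs_l2 g - X (r k)) \<longlonglongrightarrow> 0"
    by (intro Lim_null_comparison[OF _ LIMSEQ_power_zero[of "1/2::real"]]) auto
  then have "(\<lambda>k. X (r k)) \<longlonglongrightarrow> abs_l2 g"
    using tendsto_diff[OF tendsto_const[of "abs_l2 g"], of "\<lambda>k. abs_l2 g - X (r k)" 0] by simp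
  then have "(X \<circ> r) \<longlonglongrightarrow> abs_l2 g" by (simp add: o_def)
  then show "convergent X"
    using Cauchy_converges_subseq[OF X r] unfolding convergent_def by blast
qed

instance l2 :: (euclidean_space) banach ..

subsection \<open>Approximation by compactly supported continuous functions\<close>

text \<open>Dominated convergence in the mean; the domination also supplies the square integrability needed
  to speak of the classes.\<close>

lemma tendsto_l2_dominated:
  fixes f :: "'a::euclidean_space \<Rightarrow> complex"
  assumes [measurable]: "f \<in> borel_measurable borel" "\<And>n. s n \<in> borel_measurable borel"
    and w: "integrable lborel (\<lambda>x. (w x)\<^sup>2)"
    and lim: "AE x in lborel. (\<lambda>n. s n x) \<longlonglongrightarrow> f x"
    and bound: "\<And>n. AE x in lborel. cmod (s n x) \<le> w x"
  shows "square_integrable f" "\<And>n. square_integrable (s n)" "(\<lambda>n. abs_l2 (s n)) \<longlonglongrightarrow> abs_l2 f"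
proof -
  have fw: "AE x in lborel. cmod (f x) \<le> w x"
  proof -
    have "AE x in lborel. \<forall>n. cmod (s n x) \<le> w x" using bound by (subst AE_all_countable) simp
    with lim show ?thesis
    proof eventually_elim
      case (elim x)
      then show ?case by (intro LIMSEQ_le_const2[OF tendsto_norm[OF elim(1)]]) auto
    qed
  qed
  have sq: "integrable lborel (\<lambda>x. (cmod (g x))\<^sup>2)"
    if [measurable]: "g \<in> borel_measurable borel" and "AE x in lborel. cmod (g x) \<le> w x"
    for g :: "'a \<Rightarrow> complex"
  proof (rule Bochner_Integration.integrable_bound[OF w])
    show "AE x in lborel. norm ((cmod (g x))\<^sup>2) \<le> norm ((w x)\<^sup>2)"
      using that(2) by eventually_elim (auto intro!: power_mono)
  qed measurable
  show f: "square_integrable f" using sq[OF _ fw] by (simp add: square_integrable_def)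
  show s: "square_integrable (s n)" for n using sq[OF _ bound[of n]] by (simp add: square_integrable_def)
  have "(\<lambda>n. LINT x|lborel. (cmod (s n x - f x))\<^sup>2) \<longlonglongrightarrow> (LINT x|(lborel :: 'a measure). 0)"
  proof (rule integral_dominated_convergence[where w = "\<lambda>x. 4 * (w x)\<^sup>2"])
    show "integrable lborel (\<lambda>x. 4 * (w x)\<^sup>2)" using w by simp
    show "AE x in lborel. (\<lambda>n. (cmod (s n x - f x))\<^sup>2) \<longlonglongrightarrow> 0"
      using lim
    proof eventually_elim
      case (elim x)
      then have "(\<lambda>n. (cmod (s n x - f x))\<^sup>2) \<longlonglongrightarrow> (cmod (f x - f x))\<^sup>2" by (intro tendsto_intros)
      then show ?case by simp
    qed
    show "AE x in lborel. norm ((cmod (s n x - f x))\<^sup>2) \<le> 4 * (w x)\<^sup>2" for n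
      using bound[of n] fw
    proof eventually_elim
      case (elim x)
      then have "cmod (s n x - f x) \<le> 2 * w x" using norm_triangle_ineq4[of "s n x" "f x"] by simp
      then have "(cmod (s n x - f x))\<^sup>2 \<le> (2 * w x)\<^sup>2" by (rule power_mono) simp
      then show ?case by (simp add: power_mult_distrib)
    qed
  qed measurable
  then have "(\<lambda>n. (norm (abs_l2 (s n) - abs_l2 f))\<^sup>2) \<longlonglongrightarrow> 0"
    by (simp add: abs_l2_minus s f power2_norm_abs_l2 square_integrable_minus)
  then have "(\<lambda>n. sqrt ((norm (abs_l2 (s n) - abs_l2 f))\<^sup>2)) \<longlonglongrightarrow> sqrt 0" by (rule tendsto_real_sqrt)
  then have "(\<lambda>n. abs_l2 (s n) - abs_l2 f) \<longlonglongrightarrow> 0" by (simp add: tendsto_norm_zero_iff)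
  then show "(\<lambda>n. abs_l2 (s n)) \<longlonglongrightarrow> abs_l2 f" by (simp add: LIM_zero_cancel)
qed

lemma integrable_indicator_cball:
  "integrable lborel (\<lambda>x. indicator (cball 0 R) x * c :: real)" for c :: real
  by (intro integrable_mult_left integrable_real_indicator)
     (auto simp: emeasure_bounded_finite[OF bounded_cball, simplified])

definition test_function :: "('a::euclidean_space \<Rightarrow> complex) \<Rightarrow> bool" where
  "test_function g \<longleftrightarrow> continuous_on UNIV g \<and> (\<exists>R. \<forall>x. norm x > R \<longrightarrow> g x = 0)"

lemma test_function_bound:
  assumes "test_function g"
  obtains M R where "M \<ge> 0" "\<And>x. cmod (g x) \<le> indicator (cball 0 R) x * M"
proof -
  from assms obtain R where R: "\<And>x. norm x > R \<Longrightarrow> g x = 0" and c: "continuous_on UNIV g"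
    unfolding test_function_def by auto
  have "compact (g ` cball 0 R)"
    by (intro compact_continuous_image continuous_on_subset[OF c]) auto
  then obtain M where M: "\<And>x. x \<in> cball 0 R \<Longrightarrow> cmod (g x) \<le> M"
    using compact_imp_bounded bounded_iff by (metis imageI)
  have "cmod (g x) \<le> indicator (cball 0 R) x * max 0 M" for x
  proof (cases "x \<in> cball 0 R")
    case False then show ?thesis using R[of x] by simp
  qed (use M[of x] in auto)
  then show ?thesis by (intro that[of "max 0 M" R]) auto
qed

lemma test_function_measurable: "test_function g \<Longrightarrow> g \<in> borel_measurable borel"
  unfolding test_function_def by (auto intro: borel_measurable_continuous_onI)

lemma test_function_integrable:
  assumes "test_function g"
  shows "integrable lborel g" "square_integrable g"
proof -
  note [measurable] = test_function_measurable[OF assms]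
  obtain M R where M: "M \<ge> 0" "\<And>x. cmod (g x) \<le> indicator (cball 0 R) x * M"
    using test_function_bound[OF assms] by blast
  show "integrable lborel g"
    by (rule Bochner_Integration.integrable_bound[OF integrable_indicator_cball[of R M]])
       (use M in \<open>auto intro!: AE_I2 simp: indicator_def\<close>)
  have "(cmod (g x))\<^sup>2 \<le> indicator (cball 0 R) x * M\<^sup>2" for x
    using M(2)[of x] by (auto simp: indicator_def intro: power_mono split: if_splits)
  then have "integrable lborel (\<lambda>x. (cmod (g x))\<^sup>2)"
    by (intro Bochner_Integration.integrable_bound[OF integrable_indicator_cball[of R "M\<^sup>2"]])
       (auto intro!: AE_I2)
  then show "square_integrable g" by (simp add: square_integrable_def)
qed

text \<open>A bounded function with bounded support is an almost everywhere limit of continuous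
  functions; retracting their values to a ball and multiplying with a cut-off function makes the
  convergence dominated.\<close>

lemma bounded_support_approx:
  fixes f :: "'a::euclidean_space \<Rightarrow> complex"
  assumes [measurable]: "f \<in> borel_measurable borel"
    and M: "\<And>x. cmod (f x) \<le> M" and R: "\<And>x. norm x > R \<Longrightarrow> f x = 0"
  obtains g where "\<And>n. test_function (g n)" "(\<lambda>n. abs_l2 (g n)) \<longlonglongrightarrow> abs_l2 f"
proof -
  define M' where "M' = max 1 M"
  have M'0: "M' > 0" and M': "\<And>x. cmod (f x) \<le> M'"
    using M by (auto simp: M'_def intro: order_trans[OF M])
  have "f measurable_on UNIV"
    by (intro lebesgue_measurable_imp_measurable_on measurable_completion) auto
  then obtain N h where N: "negligible N" and h: "\<And>n. continuous_on UNIV (h n)"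
    and lim: "\<And>x. x \<notin> N \<Longrightarrow> (\<lambda>n. h n x) \<longlonglongrightarrow> f x"
    unfolding measurable_on_def by (auto simp: )
  \<comment> \<open>the radial retraction onto the disc of radius \<open>M'\<close>\<close>
  define r :: "complex \<Rightarrow> complex" where "r z = z /\<^sub>R max 1 (cmod z / M')" for z
  have rc: "continuous_on UNIV r" unfolding r_def
    using M'0 by (intro continuous_intros) auto
  have rM: "cmod (r z) \<le> M'" for z
  proof (cases "cmod z \<le> M'")
    case True then show ?thesis using M'0 by (simp add: r_def max_def field_simps)
  next
    case False
    then have "max 1 (cmod z / M') = cmod z / M'" "cmod z > 0" using M'0 by (auto simp: max_def field_simps)
    then show ?thesis using M'0 by (simp add: r_def)
  qed
  have rid: "r z = z" if "cmod z \<le> M'" for z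
    using that M'0 by (simp add: r_def max_def field_simps)
  define cut :: "'a \<Rightarrow> real" where "cut x = max 0 (min 1 (R + 1 - norm x))" for x
  have cutc: "continuous_on UNIV cut" unfolding cut_def by (intro continuous_intros)
  define g where "g n x = complex_of_real (cut x) * r (h n x)" for n x
  have gc: "continuous_on UNIV (g n)" for n unfolding g_def
    by (intro continuous_intros cutc continuous_on_compose2[OF rc h]) auto
  have gt: "test_function (g n)" for n unfolding test_function_def
    by (intro conjI gc exI[of _ "R + 1"]) (auto simp: g_def cut_def)
  note [measurable] = test_function_measurable[OF gt]
  have "(\<lambda>n. abs_l2 (g n)) \<longlonglongrightarrow> abs_l2 f"
  proof (rule tendsto_l2_dominated(3)[where w = "\<lambda>x. indicator (cball 0 (R+1)) x * M'"])
    have "(\<lambda>x::'a. (indicator (cball 0 (R+1)) x * M')\<^sup>2) = (\<lambda>x. indicator (cball 0 (R+1)) x * M'\<^sup>2)"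
      by (auto simp: indicator_def)
    then show "integrable lborel (\<lambda>x::'a. (indicator (cball 0 (R+1)) x * M')\<^sup>2)"
      by (simp only: integrable_indicator_cball)
    show "AE x in lborel. (\<lambda>n. g n x) \<longlonglongrightarrow> f x"
    proof -
      have "AE x in lebesgue. x \<notin> N" using N by (simp add: negligible_iff_null_sets AE_not_in)
      then have "AE x in lborel. x \<notin> N" by (simp add: AE_completion_iff)
      then show ?thesis
      proof eventually_elim
        case (elim x)
        have "(\<lambda>n. g n x) \<longlonglongrightarrow> complex_of_real (cut x) * r (f x)"
          unfolding g_def using rc lim[OF elim]
          by (intro tendsto_mult tendsto_const) (auto simp: continuous_on_eq_continuous_at intro: isCont_tendsto_compose[of _ r])
        moreover have "complex_of_real (cut x) * r (f x) = f x"
        proof (cases "norm x > R")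
          case True then show ?thesis using R by (simp add: r_def)
        next
          case False then show ?thesis using rid[OF M'[of x]] by (simp add: cut_def)
        qed
        ultimately show ?case by simp
      qed
    qed
    show "AE x in lborel. cmod (g n x) \<le> indicator (cball 0 (R+1)) x * M'" for n
    proof (intro AE_I2)
      fix x
      show "cmod (g n x) \<le> indicator (cball 0 (R+1)) x * M'"
      proof (cases "x \<in> cball 0 (R+1)")
        case True
        have "cmod (g n x) = cut x * cmod (r (h n x))" by (simp add: g_def norm_mult cut_def)
        also have "\<dots> \<le> 1 * M'" using M'0 by (intro mult_mono rM) (auto simp: cut_def)
        finally show ?thesis using True by simp
      next
        case False then show ?thesis by (simp add: g_def cut_def)
      qed
    qed
  qed measurable
  with gt show ?thesis by (rule that)
qed

text \<open>Truncating the values and the support of \<open>f\<close> leads to the case treated above.\<close>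

lemma test_function_dense:
  fixes f :: "'a::euclidean_space l2"
  assumes "e > 0"
  obtains g where "test_function g" "norm (abs_l2 g - f) < e"
proof -
  define u where "u = rep_l2 f"
  have u [measurable]: "u \<in> borel_measurable borel" and su: "square_integrable u"
    by (auto simp: u_def square_integrable_rep_l2)
  define s where "s n x = (if cmod (u x) \<le> real n \<and> norm x \<le> real n then u x else 0)" for n x
  have [measurable]: "s n \<in> borel_measurable borel" for n unfolding s_def by measurable
  have "(\<lambda>n. abs_l2 (s n)) \<longlonglongrightarrow> abs_l2 u"
  proof (rule tendsto_l2_dominated(3)[where w = "\<lambda>x. cmod (u x)"])
    show "integrable lborel (\<lambda>x. (cmod (u x))\<^sup>2)" using su by (simp add: square_integrable_def)
    show "AE x in lborel. (\<lambda>n. s n x) \<longlonglongrightarrow> u x"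
    proof (intro AE_I2)
      fix x
      obtain n where n: "real n \<ge> max (cmod (u x)) (norm x)" using real_arch_simple by blast
      show "(\<lambda>n. s n x) \<longlonglongrightarrow> u x"
        by (rule tendsto_eventually, rule eventually_sequentiallyI[of n]) (use n in \<open>auto simp: s_def\<close>)
    qed
  qed (auto simp: s_def)
  from tendstoD[OF this, of "e/2"] assms obtain n where n: "norm (abs_l2 (s n) - abs_l2 u) < e/2"
    by (auto simp: dist_norm eventually_sequentially)
  obtain g where g: "\<And>k. test_function (g k)" "(\<lambda>k. abs_l2 (g k)) \<longlonglongrightarrow> abs_l2 (s n)"
    by (rule bounded_support_approx[of "s n" "real n" "real n"]) (auto simp: s_def)
  from tendstoD[OF g(2), of "e/2"] assms obtain k where k: "norm (abs_l2 (g k) - abs_l2 (s n)) < e/2"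
    by (auto simp: dist_norm eventually_sequentially)
  have "norm (abs_l2 (g k) - f) < e"
    using norm_triangle_lt[of "abs_l2 (g k) - abs_l2 (s n)" "abs_l2 (s n) - abs_l2 u" e] n k by (simp add: u_def)
  with g(1) show ?thesis by (rule that)
qed

subsection \<open>Orthonormal bases and Parseval's identity\<close>

definition orthonormal :: "'a::euclidean_space l2 set \<Rightarrow> bool" where
  "orthonormal S \<longleftrightarrow> (\<forall>e\<in>S. \<forall>e'\<in>S. cinner e e' = (if e = e' then 1 else 0))"

definition orth_proj :: "'a::euclidean_space l2 set \<Rightarrow> 'a l2 \<Rightarrow> 'a l2" where
  "orth_proj S f = (\<Sum>e\<in>S. cinner f e *\<^sub>C e)"

lemma cinner_orth_proj:
  assumes "finite S" "orthonormal S" "e \<in> S"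
  shows "cinner (orth_proj S f) e = cinner f e"
proof -
  have "cinner (orth_proj S f) e = (\<Sum>e'\<in>S. cinner f e' * (if e' = e then 1 else 0))"
    unfolding orth_proj_def cinner_sum_left
    using assms by (intro sum.cong) (auto simp: orthonormal_def)
  also have "\<dots> = (\<Sum>e'\<in>S. if e' = e then cinner f e' else 0)" by (intro sum.cong) auto
  also have "\<dots> = cinner f e" using assms by simp
  finally show ?thesis .
qed

lemma norm_orth_proj:
  assumes "finite S" "orthonormal S"
  shows "(norm (orth_proj S f))\<^sup>2 = (\<Sum>e\<in>S. (cmod (cinner f e))\<^sup>2)"
proof -
  have "complex_of_real ((norm (orth_proj S f))\<^sup>2) = (\<Sum>e\<in>S. cnj (cinner f e) * cinner (orth_proj S f) e)"
    unfolding cinner_self_norm[symmetric] by (subst (2) orth_proj_def) (simp add: cinner_sum_right)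
  also have "\<dots> = (\<Sum>e\<in>S. complex_of_real ((cmod (cinner f e))\<^sup>2))"
    using assms by (intro sum.cong refl) (simp add: cinner_orth_proj complex_norm_square mult.commute
        del: of_real_power)
  finally show ?thesis unfolding of_real_sum[symmetric] of_real_eq_iff .
qed

lemma bessel_finite:
  assumes "finite S" "orthonormal S"
  shows "(\<Sum>e\<in>S. (cmod (cinner f e))\<^sup>2) \<le> (norm f)\<^sup>2"
proof -
  have "cinner f (orth_proj S f) = cinner (orth_proj S f) (orth_proj S f)"
    unfolding orth_proj_def[of S f] cinner_sum_right
    using assms by (intro sum.cong refl) (simp add: cinner_orth_proj flip: orth_proj_def)
  then have "(norm (orth_proj S f))\<^sup>2 = cmod (cinner f (orth_proj S f))"
    by (simp add: cinner_self_norm norm_power)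
  also have "\<dots> \<le> norm f * norm (orth_proj S f)" by (rule cmod_cinner_le)
  finally have "norm (orth_proj S f) \<le> norm f"
    by (cases "orth_proj S f = 0") (auto simp: power2_eq_square)
  then have "(norm (orth_proj S f))\<^sup>2 \<le> (norm f)\<^sup>2" by (simp add: power_mono)
  then show ?thesis by (simp add: norm_orth_proj assms)
qed

text \<open>Sets on which the integral of \<open>f\<close> vanishes are closed under complements and disjoint unions, so
  they include all Borel sets as soon as they include an intersection stable generator.\<close>

lemma set_integral_zero_from_generator:
  fixes f :: "'a::euclidean_space \<Rightarrow> complex"
  assumes int: "integrable lborel f"
    and E: "Int_stable E" "sets borel = sigma_sets UNIV E"
    and zero: "\<And>A. A \<in> E \<Longrightarrow> (LINT x:A|lborel. f x) = 0" and all: "(LINT x|lborel. f x) = 0"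
  shows "AE x in lborel. f x = 0"
proof (rule sigma_finite_measure.density_unique_banach[OF lborel.sigma_finite_measure_axioms, of f "\<lambda>_. 0"])
  fix A :: "'a set" assume "A \<in> sets lborel"
  then have A: "A \<in> sigma_sets UNIV E" by (simp add: E(2))
  have si: "set_integrable lborel B f" if "B \<in> sets borel" for B
    using that int integrable_mult_indicator[of B lborel f] by (simp add: set_integrable_def)
  have "(LINT x:A|lborel. f x) = 0"
  proof (rule sigma_sets_induct_disjoint[OF E(1) _ A, of "\<lambda>A. (LINT x:A|lborel. f x) = 0"])
    fix B assume B: "B \<in> sigma_sets UNIV E" "(LINT x:B|lborel. f x) = 0"
    then have [measurable]: "B \<in> sets borel" by (simp add: E(2))
    have "(LINT x:B \<union> (UNIV - B)|lborel. f x) = (LINT x:B|lborel. f x) + (LINT x:UNIV - B|lborel. f x)"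
      by (intro set_integral_Un si) auto
    moreover have "(LINT x:B \<union> (UNIV - B)|lborel. f x) = 0" using all by (simp add: set_lebesgue_integral_def)
    ultimately show "(LINT x:UNIV - B|lborel. f x) = 0" using B by simp
  next
    fix B :: "nat \<Rightarrow> 'a set"
    assume B: "disjoint_family B" "range B \<subseteq> sigma_sets UNIV E" "\<And>i. (LINT x:B i|lborel. f x) = 0"
    then have m [measurable]: "B i \<in> sets borel" for i by (auto simp: E(2))
    have "(LINT x:(\<Union>i. B i)|lborel. f x) = (\<Sum>i. (LINT x:(B i)|lborel. f x))"
      using B(1) by (intro lebesgue_integral_countable_add si) (auto simp: disjoint_family_on_def)
    then show "(LINT x:(\<Union>i. B i)|lborel. f x) = 0" by (simp add: B(3))
  qed (use zero in \<open>auto simp: set_lebesgue_integral_def\<close>)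
  then show "(LINT x:A|lborel. f x) = (LINT x:A|lborel. 0)" by (simp add: set_lebesgue_integral_def)
qed (use int in auto)

text \<open>The family consists of the indicator functions of the boxes with rational corners, which form
  a countable intersection stable generator of the Borel sets.\<close>

lemma countable_total_family:
  obtains d :: "nat \<Rightarrow> 'a::euclidean_space l2" where "\<And>f. (\<And>n. cinner f (d n) = 0) \<Longrightarrow> f = 0"
proof -
  define a' b' :: "('a \<Rightarrow> real \<times> real) \<Rightarrow> 'a"
    where "a' f = (\<Sum>i\<in>Basis. fst (f i) *\<^sub>R i)" and "b' f = (\<Sum>i\<in>Basis. snd (f i) *\<^sub>R i)" for f
  define Q :: "('a \<Rightarrow> real \<times> real) set" where "Q = (Basis \<rightarrow>\<^sub>E \<rat> \<times> \<rat>)"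
  define E where "E = (\<lambda>f. box (a' f) (b' f)) ` Q"
  have a'i: "a' f \<bullet> i = fst (f i)" and b'i: "b' f \<bullet> i = snd (f i)" if "i \<in> Basis" for f i
    using that by (auto simp: a'_def b'_def)
  have "countable Q" unfolding Q_def by (intro countable_PiE countable_SIGMA countable_rat) auto
  then have cE: "countable E" by (simp add: E_def)
  have EI: "box a b \<in> E" if "\<And>i. i \<in> Basis \<Longrightarrow> a \<bullet> i \<in> \<rat> \<and> b \<bullet> i \<in> \<rat>" for a b
  proof -
    define f where "f = restrict (\<lambda>i. (a \<bullet> i, b \<bullet> i)) Basis"
    have "f \<in> Q" using that by (auto simp: f_def Q_def)
    moreover have "a' f = a" by (rule euclidean_eqI) (subst a'i, auto simp: f_def)
    moreover have "b' f = b" by (rule euclidean_eqI) (subst b'i, auto simp: f_def)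
    ultimately show ?thesis by (auto simp: E_def intro!: image_eqI[of _ _ f])
  qed
  have int: "A \<inter> B \<in> E" if "A \<in> E" "B \<in> E" for A B
  proof -
    from that obtain f g where fg: "f \<in> Q" "g \<in> Q" "A = box (a' f) (b' f)" "B = box (a' g) (b' g)"
      unfolding E_def by auto
    show ?thesis unfolding fg box_Int_box
    proof (rule EI)
      fix i :: 'a assume i: "i \<in> Basis"
      then have "f i \<in> \<rat> \<times> \<rat>" "g i \<in> \<rat> \<times> \<rat>" using fg by (auto simp: Q_def)
      with i show "(\<Sum>i\<in>Basis. max (a' f \<bullet> i) (a' g \<bullet> i) *\<^sub>R i) \<bullet> i \<in> \<rat> \<and>
          (\<Sum>i\<in>Basis. min (b' f \<bullet> i) (b' g \<bullet> i) *\<^sub>R i) \<bullet> i \<in> \<rat>"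
        by (auto simp: a'i b'i max_def min_def mem_Times_iff)
    qed
  qed
  then have stable: "Int_stable E" by (auto simp: Int_stable_def)
  have gen: "sets borel = sigma_sets UNIV E"
  proof -
    have "borel = sigma UNIV E" unfolding E_def
    proof (rule borel_eq_sigmaI1[where X = "{S. open S}"])
      show "(borel :: 'a measure) = sigma UNIV {S. open S}" by (simp add: borel_def)
      fix S :: "'a set" assume "S \<in> {S. open S}"
      then have S: "S = (\<Union>f\<in>{f\<in>Q. box (a' f) (b' f) \<subseteq> S}. box (a' f) (b' f))"
        using open_UNION_box[of S] by (simp add: a'_def b'_def Q_def)
      have "(\<Union>f\<in>{f\<in>Q. box (a' f) (b' f) \<subseteq> S}. box (a' f) (b' f)) \<in> sets (sigma UNIV ((\<lambda>f. box (a' f) (b' f)) ` Q))"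
        using \<open>countable Q\<close> by (intro sets.countable_UN') (auto simp: E_def intro: countable_subset[of _ Q])
      then show "S \<in> sets (sigma UNIV ((\<lambda>f. box (a' f) (b' f)) ` Q))" using S by simp
    qed auto
    moreover have "sets (sigma UNIV E) = sigma_sets UNIV E" by (rule sets_measure_of) auto
    ultimately show ?thesis by metis
  qed
  define d where "d n = abs_l2 (indicator (from_nat_into E n) :: 'a \<Rightarrow> complex)" for n
  have "box 0 0 \<in> E" by (rule EI) auto
  then have nE: "E \<noteq> {}" by auto
  have fin: "emeasure lborel A < \<infinity>" if "A \<in> E" for A
    using that emeasure_bounded_finite[OF bounded_box] unfolding E_def by blast
  have sqE: "square_integrable (indicator A :: 'a \<Rightarrow> complex)" if "A \<in> E" for A
  proof -
    have [measurable]: "A \<in> sets borel" using that by (auto simp: E_def)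
    have "(\<lambda>x. (cmod (indicator A x))\<^sup>2) = (indicator A :: 'a \<Rightarrow> real)" by (auto simp: indicator_def)
    then show ?thesis using fin[OF that] by (auto simp: square_integrable_def)
  qed
  show ?thesis
  proof (rule that[of d])
    fix f assume f: "\<And>n. cinner f (d n) = 0"
    have zero: "(LINT x|lborel. indicator A x *\<^sub>R rep_l2 f x) = 0" if "A \<in> E" for A
    proof -
      obtain n where n: "from_nat_into E n = A" using from_nat_into_surj[OF cE \<open>A \<in> E\<close>] by blast
      have "cinner (abs_l2 (rep_l2 f)) (abs_l2 (indicator A)) = (LINT x|lborel. rep_l2 f x * cnj (indicator A x))"
        by (rule cinner_abs_l2[OF square_integrable_rep_l2 sqE[OF that]])
      moreover have "rep_l2 f x * cnj (indicator A x) = indicator A x *\<^sub>R rep_l2 f x" for x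
        by (simp add: indicator_def)
      ultimately have "(LINT x|lborel. indicator A x *\<^sub>R rep_l2 f x) = cinner f (abs_l2 (indicator A))"
        by simp
      then show ?thesis using f[of n] n by (simp add: d_def)
    qed
    \<comment> \<open>a square integrable function is only locally integrable, so the generator is applied on cubes\<close>
    define B :: "nat \<Rightarrow> 'a set" where "B n = box (- real n *\<^sub>R One) (real n *\<^sub>R One)" for n
    have BE: "B n \<in> E" for n unfolding B_def by (rule EI) (auto simp: )
    have "AE x in lborel. indicator (B n) x *\<^sub>R rep_l2 f x = 0" for n
    proof (rule set_integral_zero_from_generator[OF _ stable gen])
      have "integrable lborel (\<lambda>x. rep_l2 f x * cnj (indicator (B n) x))"
        by (intro square_integrable_mult square_integrable_rep_l2 sqE BE)
      moreover have "(\<lambda>x. rep_l2 f x * cnj (indicator (B n) x)) = (\<lambda>x. indicator (B n) x *\<^sub>R rep_l2 f x)"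
        by (auto simp: indicator_def)
      ultimately show "integrable lborel (\<lambda>x. indicator (B n) x *\<^sub>R rep_l2 f x)" by simp
      fix A assume "A \<in> E"
      then have "(LINT x|lborel. indicator (A \<inter> B n) x *\<^sub>R rep_l2 f x) = 0" by (intro zero int BE)
      then show "(LINT x:A|lborel. indicator (B n) x *\<^sub>R rep_l2 f x) = 0"
        by (simp add: set_lebesgue_integral_def indicator_inter_arith)
    qed (rule zero[OF BE])
    then have "AE x in lborel. \<forall>n. indicator (B n) x *\<^sub>R rep_l2 f x = 0"
      unfolding AE_all_countable by blast
    then have "AE x in lborel. rep_l2 f x = rep_l2 0 x"
      using AE_rep_zero
    proof eventually_elim
      case (elim x)
      have "x \<in> (\<Union>i::nat. box (- (real i *\<^sub>R One)) (real i *\<^sub>R One))"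
        unfolding UN_box_eq_UNIV by simp
      then obtain n where "x \<in> B n" by (auto simp: B_def)
      then have "indicator (B n) x = (1::real)" by simp
      then have "rep_l2 f x = 0" using elim(1) by (metis scaleR_one)
      then show ?case by (simp add: elim(2))
    qed
    then show "f = 0" by (rule l2_eqI)
  qed
qed

lemma infinite_orthonormal_family:
  obtains u :: "nat \<Rightarrow> 'a::euclidean_space l2"
  where "\<And>i j. cinner (u i) (u j) = (if i = j then 1 else 0)"
proof -
  define B :: "nat \<Rightarrow> 'a set" where "B n = box (real n *\<^sub>R One) (real (Suc n) *\<^sub>R One)" for n
  have [measurable]: "B n \<in> sets borel" for n by (simp add: B_def)
  have m: "emeasure lborel (B n) = 1" for n
    unfolding B_def by (subst emeasure_lborel_box) (auto simp: inner_diff_left simp flip: scaleR_left.diff)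
  have sq: "square_integrable (indicator (B n) :: 'a \<Rightarrow> complex)" for n
  proof -
    have "(\<lambda>x. (cmod (indicator (B n) x))\<^sup>2) = (indicator (B n) :: 'a \<Rightarrow> real)" by (auto simp: indicator_def)
    then show ?thesis using m[of n] by (auto simp: square_integrable_def)
  qed
  have disj: "B i \<inter> B j = {}" if "i \<noteq> j" for i j
  proof -
    obtain b :: 'a where b: "b \<in> Basis" by (meson nonempty_Basis ex_in_conv)
    have "i = j" if "x \<in> B i" "x \<in> B j" for x
      using that b by (force simp: B_def box_def)
    then show ?thesis using that by blast
  qed
  show ?thesis
  proof (rule that[of "\<lambda>n. abs_l2 (indicator (B n))"])
    fix i j
    have "indicator (B i) x * cnj (indicator (B j) x) = complex_of_real (indicator (B i \<inter> B j) x)" for x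
      by (simp add: indicator_def)
    then have "cinner (abs_l2 (indicator (B i))) (abs_l2 (indicator (B j)))
      = (LINT x|lborel. complex_of_real (indicator (B i \<inter> B j) x))"
      by (simp add: cinner_abs_l2[OF sq sq])
    also have "\<dots> = complex_of_real (measure lborel (B i \<inter> B j))" by simp
    also have "\<dots> = (if i = j then 1 else 0)" using m disj by (simp add: measure_def)
    finally show "cinner (abs_l2 (indicator (B i))) (abs_l2 (indicator (B j))) = (if i = j then 1 else 0)" .
  qed
qed

primrec gram_schmidt :: "(nat \<Rightarrow> 'a::euclidean_space l2) \<Rightarrow> nat \<Rightarrow> 'a l2 set" where
  "gram_schmidt d 0 = {}"
| "gram_schmidt d (Suc n) = (let S = gram_schmidt d n; v = d n - orth_proj S (d n) in
     if v = 0 then S else insert ((1 / norm v) *\<^sub>R v) S)"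

lemma gram_schmidt_orthonormal: "finite (gram_schmidt d n) \<and> orthonormal (gram_schmidt d n)"
proof (induction n)
  case (Suc n)
  define S where "S = gram_schmidt d n"
  define v where "v = d n - orth_proj S (d n)"
  have S: "finite S" "orthonormal S" using Suc by (auto simp: S_def)
  have vS: "cinner v e = 0" "cinner e v = 0" if "e \<in> S" for e
  proof -
    show "cinner v e = 0" using cinner_orth_proj[OF S that] by (simp add: v_def cinner_diff_left)
    then show "cinner e v = 0" by (subst cinner_commute) simp
  qed
  show ?case
  proof (cases "v = 0")
    case False
    have "cinner v v = complex_of_real (norm v) * complex_of_real (norm v)"
      by (simp add: cinner_self_norm power2_eq_square)
    then have vv: "cinner ((1 / norm v) *\<^sub>R v) ((1 / norm v) *\<^sub>R v) = 1"
      using False by (simp add: scaleR_l2_eq)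
    have "cinner ((1 / norm v) *\<^sub>R v) e = 0" "cinner e ((1 / norm v) *\<^sub>R v) = 0" if "e \<in> S" for e
      using vS[OF that] by (auto simp: scaleR_l2_eq)
    with S(2) vv have "orthonormal (insert ((1 / norm v) *\<^sub>R v) S)"
      unfolding orthonormal_def by auto
    then show ?thesis using S False by (simp add: Let_def v_def S_def)
  qed (use S in \<open>simp add: Let_def v_def S_def\<close>)
qed (simp add: orthonormal_def)

text \<open>The Gram--Schmidt process applied to a total sequence gives a countable orthonormal set with
  trivial orthogonal complement. It is infinite, hence can be enumerated by the natural numbers:
  if it had \<open>d\<close> elements, counting the squares of the inner products with \<open>d + 1\<close> orthonormal
  vectors in two ways would give \<open>d + 1 \<le> d\<close>.\<close>

lemma orthonormal_basis_exists: "\<exists>e :: nat \<Rightarrow> 'a::euclidean_space l2. orthonormal_basis e"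
proof -
  obtain d :: "nat \<Rightarrow> 'a l2" where d: "\<And>f. (\<And>n. cinner f (d n) = 0) \<Longrightarrow> f = 0"
    using countable_total_family by blast
  define S where "S = gram_schmidt d"
  have S: "finite (S n)" "orthonormal (S n)" for n using gram_schmidt_orthonormal by (auto simp: S_def)
  have "S n \<subseteq> S (Suc n)" for n by (auto simp: S_def Let_def)
  then have mono: "S m \<subseteq> S n" if "m \<le> n" for m n using that by (rule lift_Suc_mono_le)
  define U where "U = (\<Union>n. S n)"
  have U: "countable U" unfolding U_def using S(1) by (auto intro: countable_finite)
  have oU: "orthonormal U"
    unfolding orthonormal_def
  proof (intro ballI)
    fix e e' assume "e \<in> U" "e' \<in> U"
    then obtain m n where "e \<in> S m" "e' \<in> S n" by (auto simp: U_def)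
    then have "e \<in> S (max m n)" "e' \<in> S (max m n)" using mono[of m "max m n"] mono[of n "max m n"] by auto
    then show "cinner e e' = (if e = e' then 1 else 0)" using S(2)[of "max m n"] by (auto simp: orthonormal_def)
  qed
  have total: "f = 0" if f: "\<And>e. e \<in> U \<Longrightarrow> cinner f e = 0" for f
  proof (rule d)
    fix n
    define v where "v = d n - orth_proj (S n) (d n)"
    have "cinner f (orth_proj (S n) (d n)) = 0"
      unfolding orth_proj_def cinner_sum_right using f by (intro sum.neutral ballI) (auto simp: U_def)
    moreover have "cinner f v = 0"
    proof (cases "v = 0")
      case False
      then have "(1 / norm v) *\<^sub>R v \<in> S (Suc n)" by (simp add: S_def v_def Let_def)
      then have "cinner f ((1 / norm v) *\<^sub>R v) = 0" using f by (auto simp: U_def)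
      then show ?thesis using False by (simp add: scaleR_l2_eq)
    qed simp
    ultimately show "cinner f (d n) = 0" by (simp add: v_def cinner_diff_right)
  qed
  have inf: "infinite U"
  proof
    assume fin: "finite U"
    obtain u :: "nat \<Rightarrow> 'a l2" where u: "\<And>i j. cinner (u i) (u j) = (if i = j then 1 else 0)"
      using infinite_orthonormal_family by blast
    define N where "N = Suc (card U)"
    have uinj: "inj u"
    proof (rule injI)
      fix i j assume "u i = u j" then show "i = j" using u[of i j] u[of i i] by (auto split: if_splits)
    qed
    have ou: "orthonormal (u ` {..<N})" using u by (auto simp: orthonormal_def) (metis u zero_neq_one)
    have nu: "(norm (u k))\<^sup>2 = 1" for k
      using u[of k k] unfolding cinner_self_norm by (simp flip: of_real_power)
    have nU: "(norm e)\<^sup>2 = 1" if "e \<in> U" for e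
      using oU that cinner_self_norm[of e] by (simp add: orthonormal_def flip: of_real_power)
    have "(norm (u k))\<^sup>2 = (\<Sum>e\<in>U. (cmod (cinner (u k) e))\<^sup>2)" for k
    proof -
      have "u k - orth_proj U (u k) = 0"
        by (rule total) (simp add: cinner_diff_left cinner_orth_proj[OF fin oU])
      then show ?thesis using norm_orth_proj[OF fin oU, of "u k"] by simp
    qed
    then have "real N = (\<Sum>k<N. \<Sum>e\<in>U. (cmod (cinner (u k) e))\<^sup>2)" by (simp add: nu)
    also have "\<dots> = (\<Sum>e\<in>U. \<Sum>k<N. (cmod (cinner e (u k)))\<^sup>2)"
      by (subst sum.swap, subst cinner_commute) simp
    also have "\<dots> = (\<Sum>e\<in>U. \<Sum>v\<in>u ` {..<N}. (cmod (cinner e v))\<^sup>2)"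
      using uinj by (subst sum.reindex) (auto simp: inj_on_def)
    also have "\<dots> \<le> (\<Sum>e\<in>U. (norm e)\<^sup>2)" by (intro sum_mono bessel_finite ou) auto
    also have "\<dots> = real (card U)" by (simp add: nU)
    finally show False by (simp add: N_def)
  qed
  have bij: "bij_betw (from_nat_into U) UNIV U" using U inf by (rule bij_betw_from_nat_into)
  then have fU: "from_nat_into U i \<in> U" and eq: "from_nat_into U i = from_nat_into U j \<longleftrightarrow> i = j" for i j
    by (auto simp: bij_betw_def inj_eq)
  have "orthonormal_basis (from_nat_into U)"
    unfolding orthonormal_basis_def
  proof (intro conjI allI impI)
    fix i j show "cinner (from_nat_into U i) (from_nat_into U j) = (if i = j then 1 else 0)"
      using oU fU[of i] fU[of j] eq[of i j] by (simp add: orthonormal_def)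
  next
    fix f assume f: "\<forall>i. cinner f (from_nat_into U i) = 0"
    show "f = 0"
    proof (rule total)
      fix e assume "e \<in> U"
      then obtain i where "e = from_nat_into U i" using from_nat_into_surj[OF U] by blast
      then show "cinner f e = 0" using f by simp
    qed
  qed
  then show ?thesis by blast
qed

lemma some_onb: "orthonormal_basis (some_onb :: nat \<Rightarrow> 'a::euclidean_space l2)"
  unfolding some_onb_def by (rule someI_ex[OF orthonormal_basis_exists])

text \<open>The partial sums of the expansion form a Cauchy sequence by Bessel's inequality. Their limit
  has the same coefficients as \<open>f\<close>, so it equals \<open>f\<close>.\<close>

lemma parseval:
  assumes e: "orthonormal_basis e"
  shows "(\<lambda>i. (cmod (cinner f (e i)))\<^sup>2) sums (norm f)\<^sup>2"
proof -
  have ee: "cinner (e i) (e j) = (if i = j then 1 else 0)" for i j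
    using e by (simp add: orthonormal_basis_def)
  have inj: "inj e"
  proof (rule injI)
    fix i j assume "e i = e j" then show "i = j" using ee[of i j] ee[of i i] by (auto split: if_splits)
  qed
  have oe: "orthonormal (e ` A)" for A using ee by (auto simp: orthonormal_def) (metis ee zero_neq_one)
  have sumA: "(\<Sum>v\<in>e ` A. g v) = (\<Sum>i\<in>A. g (e i))" for A and g :: "'a l2 \<Rightarrow> 'b::comm_monoid_add"
    using inj by (subst sum.reindex) (auto simp: inj_on_def)
  define c where "c i = cinner f (e i)" for i
  define s where "s n = (\<Sum>i<n. c i *\<^sub>C e i)" for n
  have sp: "s n = orth_proj (e ` {..<n}) f" for n by (simp add: orth_proj_def sumA s_def c_def)
  have ns: "(norm (s n))\<^sup>2 = (\<Sum>i<n. (cmod (c i))\<^sup>2)" for n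
    unfolding sp by (simp add: norm_orth_proj oe sumA c_def)
  have sm: "summable (\<lambda>i. (cmod (c i))\<^sup>2)"
  proof (rule summableI_nonneg_bounded)
    fix n show "(\<Sum>i<n. (cmod (c i))\<^sup>2) \<le> (norm f)\<^sup>2"
      using bessel_finite[of "e ` {..<n}" f] oe by (simp add: sumA c_def)
  qed simp
  have diff: "(norm (s n - s m))\<^sup>2 = (\<Sum>i\<in>{m..<n}. (cmod (c i))\<^sup>2)" if "m \<le> n" for m n
  proof -
    have "{..<n} = {..<m} \<union> {m..<n}" using that by auto
    then have "s n = s m + (\<Sum>i\<in>{m..<n}. c i *\<^sub>C e i)"
      unfolding s_def by (simp add: sum.union_disjoint ivl_disj_int)
    then have "s n - s m = orth_proj (e ` {m..<n}) f" by (simp add: orth_proj_def sumA c_def)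
    then show ?thesis by (simp add: norm_orth_proj oe sumA c_def)
  qed
  have "Cauchy s"
  proof (rule metric_CauchyI)
    fix r :: real assume r: "r > 0"
    then obtain N where N: "\<And>m n. m \<ge> N \<Longrightarrow> norm (\<Sum>i\<in>{m..<n}. (cmod (c i))\<^sup>2) < r\<^sup>2"
      using sm unfolding summable_Cauchy by (meson zero_less_power)
    have "dist (s n) (s m) < r" if "m \<ge> N" "m \<le> n" for m n
    proof -
      have "(norm (s n - s m))\<^sup>2 < r\<^sup>2" using N[of m n] that by (simp add: diff sum_nonneg)
      then show ?thesis using r by (simp add: dist_norm power2_less_imp_less)
    qed
    then show "\<exists>M. \<forall>m\<ge>M. \<forall>n\<ge>M. dist (s m) (s n) < r" by (metis dist_commute nat_le_linear)
  qed
  then obtain g where g: "s \<longlonglongrightarrow> g" using Cauchy_convergent convergent_def by blast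
  have "f - g = 0"
  proof -
    have "cinner (f - g) (e j) = 0" for j
    proof -
      have "(\<lambda>n. cinner (s n) (e j)) \<longlonglongrightarrow> cinner g (e j)" by (intro tendsto_cinner g tendsto_const)
      moreover have "(\<lambda>n. cinner (s n) (e j)) \<longlonglongrightarrow> c j"
      proof (rule tendsto_eventually, rule eventually_sequentiallyI[of "Suc j"])
        fix n assume "Suc j \<le> n"
        then show "cinner (s n) (e j) = c j"
          unfolding sp by (subst cinner_orth_proj) (auto simp: oe c_def)
      qed
      ultimately have "cinner g (e j) = c j" by (rule LIMSEQ_unique)
      then show ?thesis by (simp add: cinner_diff_left c_def)
    qed
    then show ?thesis using e unfolding orthonormal_basis_def by blast
  qed
  then have "s \<longlonglongrightarrow> f" using g by simp
  then have "(\<lambda>n. (norm (s n))\<^sup>2) \<longlonglongrightarrow> (norm f)\<^sup>2" by (intro tendsto_intros)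
  then show ?thesis unfolding sums_def ns c_def .
qed

lemma parseval_ennreal:
  assumes "orthonormal_basis e"
  shows "(\<Sum>i. ennreal ((cmod (cinner f (e i)))\<^sup>2)) = ennreal ((norm f)\<^sup>2)"
  using parseval[OF assms, of f] by (intro suminf_ennreal_eq) auto

section \<open>Plancherel's theorem on Euclidean space\<close>

lemma measurable_cis [measurable]: "cis \<in> borel_measurable borel"
  by (intro borel_measurable_continuous_onI continuous_on_cis continuous_on_id)

lemma measurable_cnj [measurable]: "cnj \<in> borel_measurable borel"
  by (intro borel_measurable_continuous_onI continuous_intros)

lemma nn_integral_lborel_affine:
  fixes t :: "'a::euclidean_space"
  assumes [measurable]: "f \<in> borel_measurable borel" and c: "c \<noteq> 0"
  shows "(\<integral>\<^sup>+x. f x \<partial>lborel) = ennreal (\<bar>c\<bar>^DIM('a)) * (\<integral>\<^sup>+x. f (t + c *\<^sub>R x) \<partial>lborel)"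
proof -
  have "(\<integral>\<^sup>+x. f x \<partial>lborel) = (\<integral>\<^sup>+x. f x \<partial>density (distr lborel borel (\<lambda>x. t + c *\<^sub>R x)) (\<lambda>_. ennreal (\<bar>c\<bar>^DIM('a))))"
    by (simp only: lborel_affine[OF c, of t, symmetric])
  also have "\<dots> = ennreal (\<bar>c\<bar>^DIM('a)) * (\<integral>\<^sup>+x. f x \<partial>distr lborel borel (\<lambda>x. t + c *\<^sub>R x))"
    by (subst nn_integral_density) (auto simp: nn_integral_cmult)
  also have "(\<integral>\<^sup>+x. f x \<partial>distr lborel borel (\<lambda>x. t + c *\<^sub>R x)) = (\<integral>\<^sup>+x. f (t + c *\<^sub>R x) \<partial>lborel)"
    by (rule nn_integral_distr) auto
  finally show ?thesis .
qed

lemma integral_lborel_affine: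
  fixes t :: "'a::euclidean_space" and f :: "'a \<Rightarrow> complex"
  assumes [measurable]: "f \<in> borel_measurable borel" and c: "c \<noteq> 0"
  shows "(LINT x|lborel. f x) = of_real (\<bar>c\<bar>^DIM('a)) * (LINT x|lborel. f (t + c *\<^sub>R x))"
proof -
  have "(LINT x|lborel. f x) = (LINT x|density (distr lborel borel (\<lambda>x. t + c *\<^sub>R x)) (\<lambda>_. ennreal (\<bar>c\<bar>^DIM('a))). f x)"
    by (simp only: lborel_affine[OF c, of t, symmetric])
  also have "\<dots> = (LINT x|distr lborel borel (\<lambda>x. t + c *\<^sub>R x). \<bar>c\<bar>^DIM('a) *\<^sub>R f x)"
    by (rule integral_density) auto
  also have "\<dots> = of_real (\<bar>c\<bar>^DIM('a)) * (LINT x|distr lborel borel (\<lambda>x. t + c *\<^sub>R x). f x)"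
    unfolding scaleR_conv_of_real by (rule integral_mult_right_zero)
  also have "(LINT x|distr lborel borel (\<lambda>x. t + c *\<^sub>R x). f x) = (LINT x|lborel. f (t + c *\<^sub>R x))"
    by (rule integral_distr[where f = f]) measurable
  finally show ?thesis .
qed

lemma distr_lborel_diff: "distr lborel borel (\<lambda>x. x - u) = (lborel :: 'a::euclidean_space measure)"
proof -
  have "(\<lambda>x. x - u) = (+) (- u)" by auto
  then show ?thesis by (simp only: lborel_distr_plus)
qed

text \<open>The product form of the standard Gaussian density lets its integrals factor into
  one-dimensional ones; \<open>gauss_eq\<close> gives the radial form.\<close>

definition gauss :: "'a::euclidean_space \<Rightarrow> real" where
  "gauss z = (\<Prod>b\<in>Basis. std_normal_density (z \<bullet> b))"

lemma gauss_measurable [measurable]: "gauss \<in> borel_measurable borel"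
  unfolding gauss_def by measurable

lemma gauss_nonneg: "gauss z \<ge> 0"
  by (auto simp: gauss_def intro!: prod_nonneg)

lemma gauss_eq: "gauss (z :: 'a::euclidean_space) = (1 / sqrt (2 * pi)) ^ DIM('a) * exp (- (norm z)\<^sup>2 / 2)"
proof -
  have "gauss z = (\<Prod>b\<in>Basis. (1 / sqrt (2 * pi)) * exp (- (z \<bullet> b)\<^sup>2 / 2))"
    by (simp add: gauss_def std_normal_density_def)
  also have "\<dots> = (1 / sqrt (2 * pi)) ^ DIM('a) * exp (\<Sum>b\<in>Basis. - (z \<bullet> b)\<^sup>2 / 2)"
    by (simp only: prod.distrib prod_constant exp_sum[OF finite_Basis])
  also have "(\<Sum>b\<in>Basis. - (z \<bullet> b)\<^sup>2 / 2) = - (norm z)\<^sup>2 / 2"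
    unfolding power2_norm_eq_inner euclidean_inner[of z z]
    by (simp add: sum_negf sum_divide_distrib power2_eq_square)
  finally show ?thesis .
qed

lemma integrable_gauss: "integrable lborel (gauss :: 'a::euclidean_space \<Rightarrow> real)"
proof (rule integrableI_nonneg)
  have "(\<integral>\<^sup>+z. ennreal (gauss (z::'a)) \<partial>lborel) = (\<integral>\<^sup>+z. (\<Prod>b\<in>Basis. ennreal (std_normal_density (z \<bullet> b))) \<partial>(lborel :: 'a measure))"
    by (intro nn_integral_cong) (simp add: gauss_def prod_ennreal)
  also have "\<dots> = (\<Prod>b\<in>(Basis::'a set). (\<integral>\<^sup>+x. ennreal (std_normal_density x) \<partial>lborel))"
    by (subst nn_integral_lborel_prod) auto
  also have "\<dots> < \<infinity>"
    by (simp add: nn_integral_eq_integral)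
  finally show "(\<integral>\<^sup>+z. ennreal (gauss (z::'a)) \<partial>lborel) < \<infinity>" .
qed (auto simp: gauss_nonneg)

lemma integral_gauss_cis:
  "(LINT z|lborel. of_real (gauss (z::'a::euclidean_space)) * cis (z \<bullet> w)) = of_real (exp (- (norm w)\<^sup>2 / 2))"
proof -
  interpret product_sigma_finite "\<lambda>b::'a. lborel :: real measure" ..
  define F :: "'a \<Rightarrow> real \<Rightarrow> complex" where "F b x = of_real (std_normal_density x) * cis (x * (w \<bullet> b))" for b x
  have c1: "(LINT x|lborel. F b x) = of_real (exp (- (w \<bullet> b)\<^sup>2 / 2))" for b
  proof -
    have "of_real (exp (- (w \<bullet> b)\<^sup>2 / 2)) = char std_normal_distribution (w \<bullet> b)"
      by (simp add: char_std_normal_distribution)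
    also have "\<dots> = (LINT x|lborel. F b x)"
      unfolding char_def F_def
      by (subst integral_density) (auto simp: cis_conv_exp scaleR_conv_of_real mult_ac)
    finally show ?thesis ..
  qed
  have F: "integrable lborel (F b)" for b unfolding F_def
    by (rule Bochner_Integration.integrable_bound[OF integrable_normal_density[of 1 0]])
       (auto simp: norm_mult)
  have i: "(\<Sum>b\<in>Basis. x b *\<^sub>R b) \<bullet> b = x b" if "b \<in> Basis" for x and b :: 'a
    using that by simp
  have fac: "of_real (gauss z) * cis (z \<bullet> w) = (\<Prod>b\<in>Basis. F b (z \<bullet> b))" for z :: 'a
  proof -
    have "cis (z \<bullet> w) = (\<Prod>b\<in>Basis. cis ((z \<bullet> b) * (w \<bullet> b)))"
      unfolding euclidean_inner[of z w] cis_conv_exp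
      by (simp add: exp_sum[symmetric] sum_distrib_left)
    then show ?thesis by (simp add: F_def gauss_def prod.distrib)
  qed
  have "(LINT z|lborel. of_real (gauss z) * cis (z \<bullet> w))
      = (LINT x|(\<Pi>\<^sub>M b\<in>(Basis::'a set). lborel). (\<Prod>b\<in>Basis. F b (x b)))"
    unfolding fac
    by (subst lborel_eq, subst integral_distr) (auto simp: F_def intro!: Bochner_Integration.integral_cong prod.cong)
  also have "\<dots> = (\<Prod>b\<in>(Basis::'a set). (LINT x|lborel. F b x))"
    by (rule product_integral_prod) (auto intro: F)
  also have "\<dots> = of_real (exp (\<Sum>b\<in>(Basis::'a set). - (w \<bullet> b)\<^sup>2 / 2))"
    by (simp add: c1 exp_sum)
  also have "(\<Sum>b\<in>Basis. - (w \<bullet> b)\<^sup>2 / 2) = - (norm w)\<^sup>2 / 2"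
    unfolding power2_norm_eq_inner euclidean_inner[of w w]
    by (simp add: sum_negf sum_divide_distrib power2_eq_square)
  finally show ?thesis .
qed

lemma integral_gauss: "(LINT z|lborel. gauss (z::'a::euclidean_space)) = 1"
proof -
  have "(LINT z|lborel. complex_of_real (gauss (z::'a))) = 1"
    using integral_gauss_cis[of "0::'a"] by simp
  then show ?thesis unfolding integral_complex_of_real by simp
qed

text \<open>A Gaussian cut-off on the frequency side that tends to the constant \<open>1\<close> as \<open>c\<close> tends to
  \<open>0\<close>; its Fourier transform is the approximate identity obtained by dilating \<open>gauss\<close>.\<close>

definition gauss_cut :: "real \<Rightarrow> 'a::euclidean_space \<Rightarrow> real" where
  "gauss_cut c \<omega> = exp (- (2 * pi * c * norm \<omega>)\<^sup>2 / 2)"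

lemma gauss_cut_measurable [measurable]: "gauss_cut c \<in> borel_measurable borel"
  unfolding gauss_cut_def by measurable

lemma gauss_cut_eq:
  "gauss_cut c (\<omega> :: 'a::euclidean_space) = (sqrt (2 * pi)) ^ DIM('a) * gauss ((2 * pi * c) *\<^sub>R \<omega>)"
proof -
  have "sqrt (2 * pi) ^ DIM('a) * (1 / sqrt (2 * pi)) ^ DIM('a) = 1"
    by (simp flip: power_mult_distrib)
  moreover have "(2 * pi * c * norm \<omega>)\<^sup>2 = (norm ((2 * pi * c) *\<^sub>R \<omega>))\<^sup>2"
    unfolding norm_scaleR power_mult_distrib power2_abs ..
  ultimately show ?thesis
    unfolding gauss_cut_def gauss_eq by (metis mult.assoc mult_1)
qed

lemma integrable_gauss_cut:
  assumes "c > 0" shows "integrable lborel (gauss_cut c :: 'a::euclidean_space \<Rightarrow> real)"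
proof -
  have c: "2 * pi * c \<noteq> 0" using assms by simp
  have "ennreal (\<bar>2 * pi * c\<bar>^DIM('a)) * (\<integral>\<^sup>+x. ennreal (gauss (0 + (2 * pi * c) *\<^sub>R (x::'a))) \<partial>lborel)
     = (\<integral>\<^sup>+x. ennreal (gauss (x::'a)) \<partial>lborel)"
    by (rule nn_integral_lborel_affine[symmetric]) (use c in auto)
  also have "\<dots> < \<infinity>" using integrable_gauss by (simp add: integrable_iff_bounded gauss_nonneg)
  finally have "(\<integral>\<^sup>+x. ennreal (gauss ((2 * pi * c) *\<^sub>R (x::'a))) \<partial>lborel) < \<infinity>"
    using c by (auto simp: ennreal_mult_less_top)
  then have "integrable lborel (\<lambda>x::'a. gauss ((2 * pi * c) *\<^sub>R x))"
    by (intro integrableI_nonneg) (auto simp: gauss_nonneg)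
  then show ?thesis unfolding gauss_cut_eq[abs_def] by simp
qed

lemma integral_gauss_cut_cis:
  assumes c: "c > 0"
  shows "(LINT \<omega>|lborel. of_real (gauss_cut c \<omega>) * cis (2 * pi * (\<omega> \<bullet> u)))
    = of_real (gauss ((u::'a::euclidean_space) /\<^sub>R c) / c ^ DIM('a))"
proof -
  have "of_real (exp (- (norm (u /\<^sub>R c))\<^sup>2 / 2)) = (LINT z|lborel. of_real (gauss z) * cis (z \<bullet> (u /\<^sub>R c)))"
    by (rule integral_gauss_cis[symmetric])
  also have "\<dots> = of_real (\<bar>2 * pi * c\<bar>^DIM('a)) *
      (LINT \<omega>|lborel. of_real (gauss (0 + (2 * pi * c) *\<^sub>R \<omega>)) * cis ((0 + (2 * pi * c) *\<^sub>R \<omega>) \<bullet> (u /\<^sub>R c)))"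
    by (rule integral_lborel_affine) (use c in auto)
  also have "(\<lambda>\<omega>. of_real (gauss (0 + (2 * pi * c) *\<^sub>R \<omega>)) * cis ((0 + (2 * pi * c) *\<^sub>R \<omega>) \<bullet> (u /\<^sub>R c)))
      = (\<lambda>\<omega>. of_real (1 / sqrt (2 * pi) ^ DIM('a)) * (of_real (gauss_cut c \<omega>) * cis (2 * pi * (\<omega> \<bullet> u))))"
  proof
    fix \<omega> :: 'a
    have "(0 + (2 * pi * c) *\<^sub>R \<omega>) \<bullet> (u /\<^sub>R c) = 2 * pi * (\<omega> \<bullet> u)" using c by simp
    then show "of_real (gauss (0 + (2 * pi * c) *\<^sub>R \<omega>)) * cis ((0 + (2 * pi * c) *\<^sub>R \<omega>) \<bullet> (u /\<^sub>R c))
      = of_real (1 / sqrt (2 * pi) ^ DIM('a)) * (of_real (gauss_cut c \<omega>) * cis (2 * pi * (\<omega> \<bullet> u)))"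
      by (simp only: gauss_cut_eq) simp
  qed
  also have "of_real (\<bar>2 * pi * c\<bar>^DIM('a)) * (LINT \<omega>|lborel. \<dots> \<omega>) =
      of_real ((2 * pi * c) ^ DIM('a) / sqrt (2 * pi) ^ DIM('a)) *
        (LINT \<omega>|lborel. of_real (gauss_cut c \<omega>) * cis (2 * pi * (\<omega> \<bullet> u)))"
    using c by (simp add: power_mult_distrib)
  also have "(2 * pi * c) ^ DIM('a) / sqrt (2 * pi) ^ DIM('a) = (sqrt (2 * pi)) ^ DIM('a) * c ^ DIM('a)"
  proof -
    have "2 * pi * c = sqrt (2 * pi) * (sqrt (2 * pi) * c)" by (simp flip: mult.assoc)
    then have "(2 * pi * c) ^ DIM('a) = sqrt (2 * pi) ^ DIM('a) * (sqrt (2 * pi) ^ DIM('a) * c ^ DIM('a))"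
      by (metis power_mult_distrib)
    then show ?thesis by simp
  qed
  finally have eq: "complex_of_real (exp (- (norm (u /\<^sub>R c))\<^sup>2 / 2)) = of_real (sqrt (2 * pi) ^ DIM('a) * c ^ DIM('a)) *
    (LINT \<omega>|lborel. of_real (gauss_cut c \<omega>) * cis (2 * pi * (\<omega> \<bullet> u)))" (is "of_real ?E = of_real ?A * ?I") .
  have A: "?A \<noteq> 0" using c by simp
  have "?I = of_real ?A * ?I / of_real ?A"
    by (rule nonzero_mult_div_cancel_left[symmetric]) (use A in \<open>simp only: of_real_eq_0_iff simp_thms\<close>)
  also have "\<dots> = of_real (?E / ?A)" unfolding eq[symmetric] of_real_divide ..
  also have "?E / ?A = gauss (u /\<^sub>R c) / c ^ DIM('a)"
    unfolding gauss_eq power_one_over by (simp only: divide_divide_eq_left times_divide_eq_left mult_1)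
  finally show ?thesis .
qed

text \<open>The sign in the exponent is the one of the Schroedinger representation.\<close>

definition fourier :: "('a::euclidean_space \<Rightarrow> complex) \<Rightarrow> 'a \<Rightarrow> complex" where
  "fourier f \<omega> = (LINT x|lborel. f x * cis (2 * pi * (\<omega> \<bullet> x)))"

lemma square_integrable_shift:
  assumes "square_integrable f" shows "square_integrable (\<lambda>x. f (x - u))"
  by (rule square_integrable_compose[OF _ distr_lborel_diff assms]) simp

lemma integral_shift:
  fixes f :: "'a::euclidean_space \<Rightarrow> 'b::{banach, second_countable_topology}"
  assumes [measurable]: "f \<in> borel_measurable borel"
  shows "(LINT x|lborel. f (x - u)) = (LINT x|lborel. f x)"
  using integral_distr[of "\<lambda>x. x - u" lborel borel f] by (simp add: distr_lborel_diff)

lemma norm_shift: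
  assumes "square_integrable f"
  shows "norm (abs_l2 (\<lambda>x. f (x - u))) = norm (abs_l2 f)"
proof -
  have [measurable]: "f \<in> borel_measurable borel" using assms by measurable
  have "(norm (abs_l2 (\<lambda>x. f (x - u))))\<^sup>2 = (norm (abs_l2 f))\<^sup>2"
    using assms integral_shift[of "\<lambda>x. (cmod (f x))\<^sup>2" u]
    by (simp add: power2_norm_abs_l2 square_integrable_shift)
  then show ?thesis by (simp add: power2_eq_iff_nonneg)
qed

text \<open>Translation is continuous in the mean: clear for test functions by dominated convergence,
  and in general by density since translations are isometric.\<close>

lemma translation_continuous:
  fixes f :: "'a::euclidean_space \<Rightarrow> complex"
  assumes f: "square_integrable f" and u: "u \<longlonglongrightarrow> 0"
  shows "(\<lambda>n. abs_l2 (\<lambda>x. f (x - u n))) \<longlonglongrightarrow> abs_l2 f"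
proof (rule metric_LIMSEQ_I)
  fix e :: real assume e: "e > 0"
  then obtain g where g: "test_function g" "norm (abs_l2 g - abs_l2 f) < e/3"
    using test_function_dense[of "e/3" "abs_l2 f"] by auto
  note gi = test_function_integrable[OF g(1)]
  note [measurable] = test_function_measurable[OF g(1)]
  obtain U where U: "\<And>n. norm (u n) \<le> U"
    using convergent_imp_Bseq[of u] u by (auto simp: convergent_def Bseq_def)
  obtain M R where M: "M \<ge> 0" "\<And>x. cmod (g x) \<le> indicator (cball 0 R) x * M"
    using test_function_bound[OF g(1)] by blast
  have "(\<lambda>n. abs_l2 (\<lambda>x. g (x - u n))) \<longlonglongrightarrow> abs_l2 g"
  proof (rule tendsto_l2_dominated(3)[where w = "\<lambda>x. indicator (cball 0 (R+U)) x * M"])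
    have "(\<lambda>x::'a. (indicator (cball 0 (R+U)) x * M)\<^sup>2) = (\<lambda>x. indicator (cball 0 (R+U)) x * M\<^sup>2)"
      by (auto simp: indicator_def)
    then show "integrable lborel (\<lambda>x::'a. (indicator (cball 0 (R+U)) x * M)\<^sup>2)"
      by (simp only: integrable_indicator_cball)
    show "AE x in lborel. (\<lambda>n. g (x - u n)) \<longlonglongrightarrow> g x"
    proof (intro AE_I2)
      fix x
      have "(\<lambda>n. x - u n) \<longlonglongrightarrow> x - 0" by (intro tendsto_intros u)
      moreover have "isCont g (x - 0)"
        using g(1) by (simp add: test_function_def continuous_on_eq_continuous_at)
      ultimately show "(\<lambda>n. g (x - u n)) \<longlonglongrightarrow> g x" using isCont_tendsto_compose by fastforce
    qed
    show "AE x in lborel. cmod (g (x - u n)) \<le> indicator (cball 0 (R+U)) x * M" for n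
    proof (intro AE_I2)
      fix x
      have "norm x \<le> norm (x - u n) + U" using norm_triangle_ineq[of "x - u n" "u n"] U[of n] by simp
      then have "indicator (cball 0 R) (x - u n) * M \<le> indicator (cball 0 (R+U)) x * M"
        using M(1) by (intro mult_right_mono) (auto simp: indicator_def)
      then show "cmod (g (x - u n)) \<le> indicator (cball 0 (R+U)) x * M"
        using M(2)[of "x - u n"] by simp
    qed
  qed measurable
  from metric_LIMSEQ_D[OF this, of "e/3"] e
  obtain N where N: "\<And>n. n \<ge> N \<Longrightarrow> norm (abs_l2 (\<lambda>x. g (x - u n)) - abs_l2 g) < e/3"
    by (auto simp: dist_norm)
  have "dist (abs_l2 (\<lambda>x. f (x - u n))) (abs_l2 f) < e" if "n \<ge> N" for n
  proof -
    have "norm (abs_l2 (\<lambda>x. f (x - u n)) - abs_l2 (\<lambda>x. g (x - u n))) = norm (abs_l2 (\<lambda>x. f (x - u n) - g (x - u n)))"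
      by (simp add: abs_l2_minus square_integrable_shift f gi)
    also have "\<dots> = norm (abs_l2 (\<lambda>x. f x - g x))"
      by (rule norm_shift[OF square_integrable_minus[OF f gi(2)]])
    also have "\<dots> = norm (abs_l2 g - abs_l2 f)"
      unfolding abs_l2_minus[OF f gi(2), symmetric] by (rule norm_minus_commute)
    finally have 1: "norm (abs_l2 (\<lambda>x. f (x - u n)) - abs_l2 (\<lambda>x. g (x - u n))) < e/3" using g(2) by simp
    define A B C D where "A = abs_l2 (\<lambda>x. f (x - u n))" and "B = abs_l2 (\<lambda>x. g (x - u n))"
      and "C = abs_l2 g" and "D = abs_l2 f"
    have "dist A D \<le> norm (A - B) + norm (B - C) + norm (C - D)"
      using norm_triangle_ineq[of "A - B + (B - C)" "C - D"] norm_triangle_ineq[of "A - B" "B - C"]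
      by (simp add: dist_norm)
    also have "\<dots> < e/3 + e/3 + e/3" using 1 N[OF that] g(2) unfolding A_def B_def C_def D_def by (intro add_strict_mono)
    finally show ?thesis by (simp add: A_def D_def)
  qed
  then show "\<exists>N. \<forall>n\<ge>N. dist (abs_l2 (\<lambda>x. f (x - u n))) (abs_l2 f) < e" by blast
qed

definition autocorrelation :: "('a::euclidean_space \<Rightarrow> complex) \<Rightarrow> 'a \<Rightarrow> complex" where
  "autocorrelation f u = (LINT x|lborel. f x * cnj (f (x - u)))"

lemma autocorrelation_cinner:
  assumes "square_integrable f"
  shows "autocorrelation f u = cinner (abs_l2 f) (abs_l2 (\<lambda>x. f (x - u)))"
  unfolding autocorrelation_def by (simp add: cinner_abs_l2 assms square_integrable_shift)

lemma autocorrelation_le: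
  assumes "square_integrable f" shows "cmod (autocorrelation f u) \<le> (norm (abs_l2 f))\<^sup>2"
  unfolding autocorrelation_cinner[OF assms]
  using cmod_cinner_le[of "abs_l2 f" "abs_l2 (\<lambda>x. f (x - u))"] norm_shift[OF assms, of u]
  by (simp add: power2_eq_square)

lemma measurable_autocorrelation [measurable]:
  assumes [measurable]: "f \<in> borel_measurable borel"
  shows "autocorrelation f \<in> borel_measurable borel"
  unfolding autocorrelation_def by measurable

lemma measurable_fourier [measurable]:
  assumes [measurable]: "f \<in> borel_measurable borel"
  shows "fourier f \<in> borel_measurable borel"
  unfolding fourier_def by measurable

lemma cnj_integral: "cnj (LINT x|M. f x) = (LINT x|M. cnj (f x))"
  by (rule Bochner_Integration.integral_cnj[symmetric])

lemma pair_integrable_mult: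
  fixes f :: "'a::euclidean_space \<Rightarrow> complex" and g :: "'b::euclidean_space \<Rightarrow> complex"
  assumes "integrable lborel f" "integrable lborel g"
  shows "integrable (lborel \<Otimes>\<^sub>M lborel) (\<lambda>(x, y). f x * g y)"
  using assms by (intro lborel_pair.Fubini_integrable) (auto simp: norm_mult)

text \<open>Both sides are the triple integral of
  \<open>f x * cnj (f y) * gauss_cut c \<omega> * cis (2 * pi * (\<omega> \<bullet> (x - y)))\<close>, evaluated in different
  orders.\<close>

lemma fourier_gauss_cut:
  fixes f :: "'a::euclidean_space \<Rightarrow> complex"
  assumes f: "integrable lborel f" "square_integrable f" and c: "c > 0"
  shows "(LINT \<omega>|lborel. of_real (gauss_cut c \<omega>) * (fourier f \<omega> * cnj (fourier f \<omega>)))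
    = (LINT z|lborel. of_real (gauss z) * autocorrelation f (c *\<^sub>R z))"
proof -
  have [measurable]: "f \<in> borel_measurable borel" using f by measurable
  interpret P: pair_sigma_finite "lborel :: 'a measure" "lborel \<Otimes>\<^sub>M lborel :: ('a \<times> 'a) measure"
    by (intro pair_sigma_finite.intro sigma_finite_lborel lborel_pair.sigma_finite_measure_axioms)
  define ff where "ff = (\<lambda>(x::'a, y::'a). f x * cnj (f y))"
  have iff: "integrable (lborel \<Otimes>\<^sub>M lborel) ff" unfolding ff_def
    by (rule pair_integrable_mult) (use f in auto)
  have [measurable]: "ff \<in> borel_measurable (lborel \<Otimes>\<^sub>M lborel)" using iff by simp
  define T where "T = (\<lambda>\<omega> p. of_real (gauss_cut c \<omega>) * ff p * cis (2 * pi * (\<omega> \<bullet> (fst p - snd p))))"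
  have T: "integrable (lborel \<Otimes>\<^sub>M (lborel \<Otimes>\<^sub>M lborel)) (case_prod T)"
  proof (rule P.Fubini_integrable)
    show "case_prod T \<in> borel_measurable (lborel \<Otimes>\<^sub>M (lborel \<Otimes>\<^sub>M lborel))" unfolding T_def by measurable
    have "(\<lambda>\<omega>. LINT p|(lborel \<Otimes>\<^sub>M lborel). norm (T \<omega> p)) = (\<lambda>\<omega>. gauss_cut c \<omega> * (LINT p|(lborel \<Otimes>\<^sub>M lborel). norm (ff p)))"
      by (simp add: T_def norm_mult gauss_cut_def)
    then show "integrable lborel (\<lambda>\<omega>. LINT p|(lborel \<Otimes>\<^sub>M lborel). norm (case (\<omega>, p) of (\<omega>, p) \<Rightarrow> T \<omega> p))"
      using integrable_gauss_cut[OF c, where 'a = 'a] by simp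
    show "AE \<omega> in lborel. integrable (lborel \<Otimes>\<^sub>M lborel) (\<lambda>p. case (\<omega>, p) of (\<omega>, p) \<Rightarrow> T \<omega> p)"
    proof (intro AE_I2)
      fix \<omega> :: 'a
      have "integrable (lborel \<Otimes>\<^sub>M lborel) (\<lambda>p. of_real (gauss_cut c \<omega>) * ff p)" using iff by simp
      then show "integrable (lborel \<Otimes>\<^sub>M lborel) (\<lambda>p. case (\<omega>, p) of (\<omega>, p) \<Rightarrow> T \<omega> p)"
        by (rule Bochner_Integration.integrable_bound) (auto simp: T_def norm_mult)
    qed
  qed
  have swap: "(LINT \<omega>|lborel. LINT p|(lborel \<Otimes>\<^sub>M lborel). T \<omega> p) = (LINT p|(lborel \<Otimes>\<^sub>M lborel). LINT \<omega>|lborel. T \<omega> p)"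
    by (rule P.Fubini_integral[symmetric]) (use T in simp)
  have left: "(LINT p|(lborel \<Otimes>\<^sub>M lborel). T \<omega> p) = of_real (gauss_cut c \<omega>) * (fourier f \<omega> * cnj (fourier f \<omega>))" for \<omega>
  proof -
    have i: "integrable (lborel \<Otimes>\<^sub>M lborel) (\<lambda>(x, y). (f x * cis (2 * pi * (\<omega> \<bullet> x))) * cnj (f y * cis (2 * pi * (\<omega> \<bullet> y))))"
    proof (rule pair_integrable_mult)
      show "integrable lborel (\<lambda>x. f x * cis (2 * pi * (\<omega> \<bullet> x)))"
        by (rule Bochner_Integration.integrable_bound[OF f(1)]) (auto simp: norm_mult)
      show "integrable lborel (\<lambda>y. cnj (f y * cis (2 * pi * (\<omega> \<bullet> y))))"
        by (rule Bochner_Integration.integrable_bound[OF f(1)]) (auto simp: norm_mult)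
    qed
    have "T \<omega> p = of_real (gauss_cut c \<omega>) *
        (case p of (x, y) \<Rightarrow> (f x * cis (2 * pi * (\<omega> \<bullet> x))) * cnj (f y * cis (2 * pi * (\<omega> \<bullet> y))))" for p
      by (cases p) (simp add: T_def ff_def inner_diff_right right_diff_distrib cis_cnj cis_mult mult_ac)
    then have "(LINT p|(lborel \<Otimes>\<^sub>M lborel). T \<omega> p) = of_real (gauss_cut c \<omega>) *
      (LINT p|(lborel \<Otimes>\<^sub>M lborel). (case p of (x, y) \<Rightarrow> (f x * cis (2 * pi * (\<omega> \<bullet> x))) * cnj (f y * cis (2 * pi * (\<omega> \<bullet> y)))))"
      by simp
    also have "(LINT p|(lborel \<Otimes>\<^sub>M lborel). (case p of (x, y) \<Rightarrow> (f x * cis (2 * pi * (\<omega> \<bullet> x))) * cnj (f y * cis (2 * pi * (\<omega> \<bullet> y)))))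
      = fourier f \<omega> * cnj (fourier f \<omega>)"
      unfolding lborel_pair.integral_fst'[OF i, symmetric] by (simp add: fourier_def cnj_integral)
    finally show ?thesis .
  qed
  have right: "(LINT \<omega>|lborel. T \<omega> p) = ff p * of_real (gauss ((fst p - snd p) /\<^sub>R c) / c ^ DIM('a))" for p
    unfolding integral_gauss_cut_cis[OF c, symmetric] T_def
    by (simp add: mult_ac flip: integral_mult_right_zero)
  have i: "integrable (lborel \<Otimes>\<^sub>M lborel) (\<lambda>p. LINT \<omega>|lborel. T \<omega> p)"
    using P.integrable_snd[of T] T by simp
  have "(LINT p|(lborel \<Otimes>\<^sub>M lborel). LINT \<omega>|lborel. T \<omega> p) = (LINT x|lborel. LINT y|lborel. LINT \<omega>|lborel. T \<omega> (x, y))"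
    using lborel_pair.integral_fst'[OF i] by simp
  also have "\<dots> = (LINT x|lborel. LINT z|lborel. f x * cnj (f (x - c *\<^sub>R z)) * of_real (gauss z))"
  proof (rule Bochner_Integration.integral_cong[OF refl])
    fix x :: 'a
    have m: "(\<lambda>y. f x * cnj (f y) * of_real (gauss ((x - y) /\<^sub>R c) / c ^ DIM('a))) \<in> borel_measurable borel"
      by measurable
    have "(LINT y|lborel. LINT \<omega>|lborel. T \<omega> (x, y))
      = (LINT y|lborel. f x * cnj (f y) * of_real (gauss ((x - y) /\<^sub>R c) / c ^ DIM('a)))"
      by (simp add: right ff_def)
    also have "\<dots> = of_real (\<bar>-c\<bar>^DIM('a)) * (LINT z|lborel. f x * cnj (f (x + (-c) *\<^sub>R z)) *
        of_real (gauss ((x - (x + (-c) *\<^sub>R z)) /\<^sub>R c) / c ^ DIM('a)))"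
      by (rule integral_lborel_affine[OF m]) (use c in auto)
    also have "\<dots> = (LINT z|lborel. of_real (c^DIM('a)) * (f x * cnj (f (x + (-c) *\<^sub>R z)) *
        of_real (gauss ((x - (x + (-c) *\<^sub>R z)) /\<^sub>R c) / c ^ DIM('a))))"
      using c by (simp only: abs_minus_cancel abs_of_pos integral_mult_right_zero)
    also have "\<dots> = (LINT z|lborel. f x * cnj (f (x - c *\<^sub>R z)) * of_real (gauss z))"
      using c by (intro Bochner_Integration.integral_cong) auto
    finally show "(LINT y|lborel. LINT \<omega>|lborel. T \<omega> (x, y)) = (LINT z|lborel. f x * cnj (f (x - c *\<^sub>R z)) * of_real (gauss z))" .
  qed
  also have "\<dots> = (LINT z|lborel. LINT x|lborel. f x * cnj (f (x - c *\<^sub>R z)) * of_real (gauss z))"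
  proof (rule lborel_pair.Fubini_integral)
    have "integrable (lborel \<Otimes>\<^sub>M lborel) (\<lambda>(z::'a, x). f x * cnj (f (x - c *\<^sub>R z)) * of_real (gauss z))"
    proof (rule lborel_pair.Fubini_integrable)
      define n where "n z = (LINT x|lborel. cmod (f x) * cmod (f (x - c *\<^sub>R z)))" for z
      have fs: "square_integrable (\<lambda>x. of_real (cmod (g x)))" if "square_integrable g" for g :: "'a \<Rightarrow> complex"
        using that by (auto simp: square_integrable_def)
      have nle: "norm (n z) \<le> (norm (abs_l2 (\<lambda>x. of_real (cmod (f x)) :: complex)))\<^sup>2" for z
      proof -
        have "of_real (n z) = autocorrelation (\<lambda>x. of_real (cmod (f x))) (c *\<^sub>R z)"
          unfolding n_def autocorrelation_def by (simp flip: integral_complex_of_real)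
        then have "norm (n z) = cmod (autocorrelation (\<lambda>x. of_real (cmod (f x))) (c *\<^sub>R z))"
          by (metis norm_of_real real_norm_def)
        then show ?thesis using autocorrelation_le[OF fs[OF f(2)]] by simp
      qed
      have [measurable]: "n \<in> borel_measurable borel" unfolding n_def by measurable
      have "integrable lborel (\<lambda>z. gauss z * n z)"
        by (rule Bochner_Integration.integrable_bound[OF integrable_mult_right[OF integrable_gauss,
              of "(norm (abs_l2 (\<lambda>x. of_real (cmod (f x)) :: complex)))\<^sup>2"]])
           (use nle in \<open>auto simp: abs_mult gauss_nonneg mult.commute intro!: AE_I2 mult_left_mono\<close>)
      moreover have "(LINT x|lborel. norm (f x * cnj (f (x - c *\<^sub>R z)) * of_real (gauss z))) = gauss z * n z" for z
        by (simp add: n_def norm_mult gauss_nonneg mult_ac)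
      ultimately show "integrable lborel (\<lambda>z. LINT x|lborel. norm (case (z, x) of (z, x) \<Rightarrow> f x * cnj (f (x - c *\<^sub>R z)) * of_real (gauss z)))"
        by simp
      show "AE z in lborel. integrable lborel (\<lambda>x. case (z, x) of (z, x) \<Rightarrow> f x * cnj (f (x - c *\<^sub>R z)) * of_real (gauss z))"
        using square_integrable_mult[OF f(2) square_integrable_shift[OF f(2)]] by simp
    qed measurable
    then show "integrable (lborel \<Otimes>\<^sub>M lborel) (case_prod (\<lambda>z x. f x * cnj (f (x - c *\<^sub>R z)) * of_real (gauss z)))" by simp
  qed
  also have "\<dots> = (LINT z|lborel. of_real (gauss z) * autocorrelation f (c *\<^sub>R z))"
    unfolding autocorrelation_def by (simp add: mult.commute)
  finally show ?thesis using swap left by simp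
qed

text \<open>As the cut-off is removed, the left-hand side of \<open>fourier_gauss_cut\<close> increases to the integral of
  \<open>\<bar>fourier f\<bar>\<^sup>2\<close>, while the right-hand side tends to the value of the autocorrelation at \<open>0\<close>,
  which is the integral of \<open>\<bar>f\<bar>\<^sup>2\<close>, because translation is continuous in the mean.\<close>

theorem plancherel:
  fixes f :: "'a::euclidean_space \<Rightarrow> complex"
  assumes f: "integrable lborel f" "square_integrable f"
  shows "(\<integral>\<^sup>+\<omega>. ennreal ((cmod (fourier f \<omega>))\<^sup>2) \<partial>lborel) = (\<integral>\<^sup>+x. ennreal ((cmod (f x))\<^sup>2) \<partial>lborel)"
proof -
  have [measurable]: "f \<in> borel_measurable borel" using f by measurable
  define c :: "nat \<Rightarrow> real" where "c n = 1 / real (Suc n)" for n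
  have c: "c n > 0" for n by (simp add: c_def)
  have c0: "c \<longlonglongrightarrow> 0" unfolding c_def using LIMSEQ_inverse_real_of_nat by (simp add: inverse_eq_divide)
  define K where "K = (norm (abs_l2 f))\<^sup>2"
  have bound: "cmod (fourier f \<omega>) \<le> (LINT x|lborel. cmod (f x))" for \<omega>
    unfolding fourier_def
    by (rule order_trans[OF integral_norm_bound]) (simp add: norm_mult)
  have igc: "integrable lborel (\<lambda>\<omega>. gauss_cut (c n) \<omega> * (cmod (fourier f \<omega>))\<^sup>2)" for n
  proof (rule Bochner_Integration.integrable_bound[OF integrable_mult_right[OF integrable_gauss_cut[OF c[of n]],
        of "(LINT x|lborel. cmod (f x))\<^sup>2"]])
    show "AE \<omega> in lborel. norm (gauss_cut (c n) \<omega> * (cmod (fourier f \<omega>))\<^sup>2) \<le> norm ((LINT x|lborel. cmod (f x))\<^sup>2 * gauss_cut (c n) (\<omega>::'a))"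
      using bound by (intro AE_I2) (auto simp: gauss_cut_def norm_mult abs_mult mult.commute intro!: mult_right_mono power_mono)
  qed measurable
  have lhs: "(\<lambda>n. \<integral>\<^sup>+\<omega>. ennreal (gauss_cut (c n) \<omega> * (cmod (fourier f \<omega>))\<^sup>2) \<partial>lborel)
      \<longlonglongrightarrow> (\<integral>\<^sup>+\<omega>. ennreal ((cmod (fourier f \<omega>))\<^sup>2) \<partial>lborel)"
  proof (rule nn_integral_LIMSEQ)
    show "incseq (\<lambda>n \<omega>. ennreal (gauss_cut (c n) \<omega> * (cmod (fourier f \<omega>))\<^sup>2))"
    proof (intro incseq_SucI le_funI ennreal_leI mult_right_mono)
      fix n and \<omega> :: 'a
      have "c (Suc n) \<le> c n" by (simp add: c_def frac_le)
      then have "(2 * pi * c (Suc n) * norm \<omega>)\<^sup>2 \<le> (2 * pi * c n * norm \<omega>)\<^sup>2"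
        using c[of "Suc n"] by (intro power_mono mult_right_mono mult_left_mono) auto
      then show "gauss_cut (c n) \<omega> \<le> gauss_cut (c (Suc n)) \<omega>" by (simp add: gauss_cut_def)
    qed simp
    fix \<omega> :: 'a
    have "(\<lambda>n. gauss_cut (c n) \<omega>) \<longlonglongrightarrow> exp (- (2 * pi * 0 * norm \<omega>)\<^sup>2 / 2)"
      unfolding gauss_cut_def by (intro tendsto_intros c0) auto
    then have "(\<lambda>n. gauss_cut (c n) \<omega> * (cmod (fourier f \<omega>))\<^sup>2) \<longlonglongrightarrow> 1 * (cmod (fourier f \<omega>))\<^sup>2"
      by (intro tendsto_mult) auto
    then show "(\<lambda>n. ennreal (gauss_cut (c n) \<omega> * (cmod (fourier f \<omega>))\<^sup>2)) \<longlonglongrightarrow> ennreal ((cmod (fourier f \<omega>))\<^sup>2)"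
      by (intro tendsto_ennrealI) simp
  qed measurable
  define r where "r n = (LINT \<omega>|lborel. gauss_cut (c n) \<omega> * (cmod (fourier f \<omega>))\<^sup>2)" for n
  have "(\<lambda>n. LINT z|lborel. of_real (gauss z) * autocorrelation f (c n *\<^sub>R z))
      \<longlonglongrightarrow> (LINT z|(lborel::'a measure). of_real (gauss z) * of_real K)"
  proof (rule integral_dominated_convergence[where w = "\<lambda>z. gauss z * K"])
    show "integrable lborel (\<lambda>z::'a. gauss z * K)" using integrable_gauss[where 'a = 'a] by simp
    show "AE z in lborel. (\<lambda>n. of_real (gauss z) * autocorrelation f (c n *\<^sub>R z)) \<longlonglongrightarrow> of_real (gauss z) * of_real K"
    proof (intro AE_I2 tendsto_mult tendsto_const)
      fix z :: 'a
      have "(\<lambda>n. c n *\<^sub>R z) \<longlonglongrightarrow> 0 *\<^sub>R z" by (intro tendsto_intros c0)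
      then have "(\<lambda>n. abs_l2 (\<lambda>x. f (x - c n *\<^sub>R z))) \<longlonglongrightarrow> abs_l2 f"
        by (intro translation_continuous f) simp
      then have "(\<lambda>n. autocorrelation f (c n *\<^sub>R z)) \<longlonglongrightarrow> cinner (abs_l2 f) (abs_l2 f)"
        unfolding autocorrelation_cinner[OF f(2)] by (intro tendsto_cinner tendsto_const)
      then show "(\<lambda>n. autocorrelation f (c n *\<^sub>R z)) \<longlonglongrightarrow> of_real K" by (simp add: cinner_self_norm K_def)
    qed
    show "AE z in lborel. norm (of_real (gauss z) * autocorrelation f (c n *\<^sub>R z)) \<le> gauss z * K" for n
      using autocorrelation_le[OF f(2)] by (auto simp: norm_mult gauss_nonneg K_def intro!: mult_left_mono)
  qed measurable
  moreover have "(LINT z|lborel. of_real (gauss z) * autocorrelation f (c n *\<^sub>R z)) = of_real (r n)" for n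
    unfolding fourier_gauss_cut[OF f c, symmetric] r_def
    by (simp add: complex_norm_square[symmetric] flip: integral_complex_of_real)
  moreover have "(LINT z|(lborel::'a measure). of_real (gauss z) * of_real K) = complex_of_real K"
    by (simp add: integral_gauss flip: of_real_mult)
  ultimately have "(\<lambda>n. complex_of_real (r n)) \<longlonglongrightarrow> of_real K" by (simp only:)
  then have "r \<longlonglongrightarrow> K" by (simp only: tendsto_of_real_iff)
  then have "(\<lambda>n. ennreal (r n)) \<longlonglongrightarrow> ennreal K" by (rule tendsto_ennrealI)
  moreover have "ennreal (r n) = (\<integral>\<^sup>+\<omega>. ennreal (gauss_cut (c n) \<omega> * (cmod (fourier f \<omega>))\<^sup>2) \<partial>lborel)" for n
    unfolding r_def by (rule nn_integral_eq_integral[symmetric, OF igc]) (auto simp: gauss_cut_def)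
  ultimately have "(\<integral>\<^sup>+\<omega>. ennreal ((cmod (fourier f \<omega>))\<^sup>2) \<partial>lborel) = ennreal K"
    using LIMSEQ_unique lhs by (simp add: LIMSEQ_unique)
  then show ?thesis by (simp add: K_def ennreal_power2_norm_abs_l2 f)
qed

section \<open>Hilbert--Schmidt operators given by kernels\<close>

text \<open>The values lie in the extended nonnegative reals so that the Cauchy--Schwarz inequality can be
  integrated over a parameter.\<close>

lemma power2_cmod_integral_le:
  fixes k f :: "'a::euclidean_space \<Rightarrow> complex"
  assumes [measurable]: "k \<in> borel_measurable borel" "f \<in> borel_measurable borel"
  shows "ennreal ((cmod (LINT y|lborel. k y * f y))\<^sup>2)
    \<le> (\<integral>\<^sup>+y. ennreal ((cmod (k y))\<^sup>2) \<partial>lborel) * (\<integral>\<^sup>+y. ennreal ((cmod (f y))\<^sup>2) \<partial>lborel)"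
proof -
  have "ennreal (cmod (LINT y|lborel. k y * f y)) \<le> (\<integral>\<^sup>+y. ennreal (cmod (k y)) * ennreal (cmod (f y)) \<partial>lborel)"
  proof (cases "integrable lborel (\<lambda>y. k y * f y)")
    case True
    then show ?thesis using integral_norm_bound_ennreal[OF True] by (simp add: norm_mult ennreal_mult)
  qed (simp add: not_integrable_integral_eq)
  then have "(ennreal (cmod (LINT y|lborel. k y * f y)))\<^sup>2 \<le> (\<integral>\<^sup>+y. ennreal (cmod (k y)) * ennreal (cmod (f y)) \<partial>lborel)\<^sup>2"
    by (intro power_mono) auto
  also have "\<dots> \<le> (\<integral>\<^sup>+y. (ennreal (cmod (k y)))\<^sup>2 \<partial>lborel) * (\<integral>\<^sup>+y. (ennreal (cmod (f y)))\<^sup>2 \<partial>lborel)"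
    by (rule Cauchy_Schwarz_nn_integral) measurable
  finally show ?thesis by (simp add: ennreal_power)
qed

lemma nn_integral_lborel_fst:
  fixes h :: "'a::euclidean_space \<times> 'b::euclidean_space \<Rightarrow> ennreal"
  assumes "h \<in> borel_measurable borel"
  shows "(\<integral>\<^sup>+p. h p \<partial>lborel) = (\<integral>\<^sup>+x. \<integral>\<^sup>+y. h (x, y) \<partial>lborel \<partial>lborel)"
  using assms by (subst lborel_prod[symmetric], subst lborel.nn_integral_fst[symmetric]) (auto simp: lborel_prod)

lemma nn_integral_lborel_snd:
  fixes h :: "'a::euclidean_space \<times> 'b::euclidean_space \<Rightarrow> ennreal"
  assumes "h \<in> borel_measurable borel"
  shows "(\<integral>\<^sup>+p. h p \<partial>lborel) = (\<integral>\<^sup>+y. \<integral>\<^sup>+x. h (x, y) \<partial>lborel \<partial>lborel)"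
  using assms by (subst lborel_prod[symmetric], subst lborel_pair.nn_integral_snd[symmetric]) (auto simp: lborel_prod)

lemma measurable_slice:
  fixes k :: "'a::euclidean_space \<times> 'b::euclidean_space \<Rightarrow> 'c::topological_space"
  assumes "k \<in> borel_measurable borel"
  shows "(\<lambda>y. k (x, y)) \<in> borel_measurable borel"
  using assms unfolding borel_prod[symmetric] by measurable

lemma measurable_prodI:
  fixes k :: "'a::euclidean_space \<times> 'b::euclidean_space \<Rightarrow> 'c::topological_space"
  assumes "k \<in> borel_measurable borel"
  shows "k \<in> borel_measurable (borel \<Otimes>\<^sub>M borel)"
  using assms unfolding borel_prod .

lemma AE_slice_square_integrable:
  fixes k :: "'a::euclidean_space \<times> 'b::euclidean_space \<Rightarrow> complex"
  assumes k: "square_integrable k"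
  shows "AE x in lborel. square_integrable (\<lambda>y. k (x, y))"
proof -
  have [measurable]: "k \<in> borel_measurable borel" "k \<in> borel_measurable (borel \<Otimes>\<^sub>M borel)"
    using k by (auto intro: measurable_prodI square_integrable_measurable)
  have "(\<integral>\<^sup>+x. \<integral>\<^sup>+y. ennreal ((cmod (k (x, y)))\<^sup>2) \<partial>lborel \<partial>lborel) \<noteq> \<infinity>"
    using k by (subst nn_integral_lborel_fst[symmetric]) (auto simp: square_integrable_iff_nn)
  then have "AE x in lborel. (\<integral>\<^sup>+y. ennreal ((cmod (k (x, y)))\<^sup>2) \<partial>lborel) \<noteq> \<infinity>"
    by (intro nn_integral_PInf_AE) measurable
  then show ?thesis
    by eventually_elim (auto simp: square_integrable_iff_nn less_top intro: measurable_slice)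
qed

definition kernel_op :: "('a::euclidean_space \<times> 'a \<Rightarrow> complex) \<Rightarrow> 'a l2 \<Rightarrow> 'a l2" where
  "kernel_op k f = abs_l2 (\<lambda>x. LINT y|lborel. k (x, y) * rep_l2 f y)"

lemma kernel_op_square_integrable:
  fixes k :: "'a::euclidean_space \<times> 'a \<Rightarrow> complex"
  assumes k: "square_integrable k" and f: "square_integrable f"
  shows "square_integrable (\<lambda>x. LINT y|lborel. k (x, y) * f y)"
proof -
  have [measurable]: "k \<in> borel_measurable borel" "k \<in> borel_measurable (borel \<Otimes>\<^sub>M borel)" "f \<in> borel_measurable borel"
    using k f by (auto intro: measurable_prodI square_integrable_measurable)
  have "(\<integral>\<^sup>+x. ennreal ((cmod (LINT y|lborel. k (x, y) * f y))\<^sup>2) \<partial>lborel)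
    \<le> (\<integral>\<^sup>+x. (\<integral>\<^sup>+y. ennreal ((cmod (k (x, y)))\<^sup>2) \<partial>lborel) * (\<integral>\<^sup>+y. ennreal ((cmod (f y))\<^sup>2) \<partial>lborel) \<partial>lborel)"
    by (intro nn_integral_mono power2_cmod_integral_le measurable_slice) auto
  also have "\<dots> = (\<integral>\<^sup>+p. ennreal ((cmod (k p))\<^sup>2) \<partial>lborel) * (\<integral>\<^sup>+y. ennreal ((cmod (f y))\<^sup>2) \<partial>lborel)"
    by (subst nn_integral_multc) (auto simp: nn_integral_lborel_fst)
  also have "\<dots> < \<infinity>" using k f by (auto simp: square_integrable_iff_nn ennreal_mult_less_top)
  finally show ?thesis unfolding square_integrable_iff_nn by auto
qed

lemma AE_slice_integrable:
  fixes k :: "'a::euclidean_space \<times> 'b::euclidean_space \<Rightarrow> complex"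
  assumes k: "square_integrable k" and f: "square_integrable f"
  shows "AE x in lborel. integrable lborel (\<lambda>y. k (x, y) * f y)"
  using AE_slice_square_integrable[OF k]
proof eventually_elim
  case (elim x)
  have "square_integrable (\<lambda>y. cnj (f y))" using f by (auto simp: square_integrable_def)
  from square_integrable_mult[OF elim this] show ?case by simp
qed

lemma AE_slice:
  fixes P :: "'a::euclidean_space \<times> 'b::euclidean_space \<Rightarrow> bool"
  assumes "AE p in lborel. P p"
  shows "AE x in lborel. AE y in lborel. P (x, y)"
proof -
  have "AE p in lborel \<Otimes>\<^sub>M lborel. P p" using assms by (simp only: lborel_prod)
  then show ?thesis by (rule lborel_pair.AE_pair)
qed

lemma kernel_op_cong:
  fixes k k' :: "'a::euclidean_space \<times> 'a \<Rightarrow> complex"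
  assumes k: "square_integrable k" "square_integrable k'" and eq: "AE p in lborel. k p = k' p"
  shows "kernel_op k = kernel_op k'"
proof
  fix f :: "'a l2"
  have f: "square_integrable (rep_l2 f)" by (rule square_integrable_rep_l2)
  have [measurable]: "k \<in> borel_measurable borel" "k' \<in> borel_measurable borel" using k by auto
  have "AE x in lborel. (LINT y|lborel. k (x, y) * rep_l2 f y) = (LINT y|lborel. k' (x, y) * rep_l2 f y)"
    using AE_slice[OF eq]
  proof eventually_elim
    case (elim x)
    have [measurable]: "(\<lambda>y. k (x, y)) \<in> borel_measurable borel" "(\<lambda>y. k' (x, y)) \<in> borel_measurable borel"
      by (auto intro: measurable_slice)
    show ?case by (rule integral_cong_AE) (use elim in auto)
  qed
  then show "kernel_op k f = kernel_op k' f"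
    unfolding kernel_op_def by (intro abs_l2_eqI kernel_op_square_integrable k f)
qed

lemma kernel_op_abs_l2:
  fixes k :: "'a::euclidean_space \<times> 'a \<Rightarrow> complex"
  assumes k: "square_integrable k" and f: "square_integrable f"
  shows "kernel_op k (abs_l2 f) = abs_l2 (\<lambda>x. LINT y|lborel. k (x, y) * f y)"
proof -
  have [measurable]: "k \<in> borel_measurable borel" "f \<in> borel_measurable borel" using k f by auto
  have "(LINT y|lborel. k (x, y) * rep_l2 (abs_l2 f) y) = (LINT y|lborel. k (x, y) * f y)" for x
  proof (rule integral_cong_AE)
    have [measurable]: "(\<lambda>y. k (x, y)) \<in> borel_measurable borel" by (auto intro: measurable_slice)
    show "(\<lambda>y. k (x, y) * rep_l2 (abs_l2 f) y) \<in> borel_measurable lborel" by measurable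
    show "(\<lambda>y. k (x, y) * f y) \<in> borel_measurable lborel" by measurable
  qed (use AE_rep_abs_l2[OF f] in auto)
  then show ?thesis by (simp add: kernel_op_def)
qed

lemma kernel_op_add:
  fixes k :: "'a::euclidean_space \<times> 'a \<Rightarrow> complex"
  assumes k: "square_integrable k"
  shows "kernel_op k (f + g) = kernel_op k f + kernel_op k g"
proof -
  note r = square_integrable_rep_l2
  have "kernel_op k (f + g) = kernel_op k (abs_l2 (\<lambda>y. rep_l2 f y + rep_l2 g y))"
    by (simp add: abs_l2_add[symmetric] r)
  also have "\<dots> = abs_l2 (\<lambda>x. LINT y|lborel. k (x, y) * (rep_l2 f y + rep_l2 g y))"
    by (intro kernel_op_abs_l2 k square_integrable_add r)
  also have "\<dots> = abs_l2 (\<lambda>x. (LINT y|lborel. k (x, y) * rep_l2 f y) + (LINT y|lborel. k (x, y) * rep_l2 g y))"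
  proof (intro abs_l2_eqI kernel_op_square_integrable k square_integrable_add r)
    show "AE x in lborel. (LINT y|lborel. k (x, y) * (rep_l2 f y + rep_l2 g y))
        = (LINT y|lborel. k (x, y) * rep_l2 f y) + (LINT y|lborel. k (x, y) * rep_l2 g y)"
      using AE_slice_integrable[OF k r[of f]] AE_slice_integrable[OF k r[of g]]
      by eventually_elim (simp add: distrib_left)
  qed
  also have "\<dots> = kernel_op k f + kernel_op k g"
    unfolding kernel_op_def by (intro abs_l2_add[symmetric] kernel_op_square_integrable k r)
  finally show ?thesis .
qed

lemma kernel_op_scaleC:
  fixes k :: "'a::euclidean_space \<times> 'a \<Rightarrow> complex"
  assumes k: "square_integrable k"
  shows "kernel_op k (c *\<^sub>C f) = c *\<^sub>C kernel_op k f"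
proof -
  note r = square_integrable_rep_l2
  have "kernel_op k (c *\<^sub>C f) = kernel_op k (abs_l2 (\<lambda>y. c * rep_l2 f y))"
    by (simp add: abs_l2_scaleC[symmetric] r)
  also have "\<dots> = abs_l2 (\<lambda>x. LINT y|lborel. k (x, y) * (c * rep_l2 f y))"
    by (intro kernel_op_abs_l2 k square_integrable_cmult r)
  also have "(\<lambda>x. LINT y|lborel. k (x, y) * (c * rep_l2 f y)) = (\<lambda>x. c * (LINT y|lborel. k (x, y) * rep_l2 f y))"
    by (simp add: mult.left_commute)
  also have "abs_l2 \<dots> = c *\<^sub>C kernel_op k f"
    unfolding kernel_op_def by (intro abs_l2_scaleC[symmetric] kernel_op_square_integrable k r)
  finally show ?thesis .
qed

lemma kernel_op_kernel_add:
  fixes k k' :: "'a::euclidean_space \<times> 'a \<Rightarrow> complex"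
  assumes k: "square_integrable k" "square_integrable k'"
  shows "kernel_op (\<lambda>p. k p + k' p) f = kernel_op k f + kernel_op k' f"
proof -
  note r = square_integrable_rep_l2[of f]
  have "kernel_op (\<lambda>p. k p + k' p) f = abs_l2 (\<lambda>x. (LINT y|lborel. k (x, y) * rep_l2 f y) + (LINT y|lborel. k' (x, y) * rep_l2 f y))"
    unfolding kernel_op_def
  proof (intro abs_l2_eqI kernel_op_square_integrable[OF square_integrable_add[OF k] r] kernel_op_square_integrable k square_integrable_add r)
    show "AE x in lborel. (LINT y|lborel. (k (x, y) + k' (x, y)) * rep_l2 f y)
        = (LINT y|lborel. k (x, y) * rep_l2 f y) + (LINT y|lborel. k' (x, y) * rep_l2 f y)"
      using AE_slice_integrable[OF k(1) r] AE_slice_integrable[OF k(2) r]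
      by eventually_elim (simp add: distrib_right)
  qed
  also have "\<dots> = kernel_op k f + kernel_op k' f"
    unfolding kernel_op_def by (intro abs_l2_add[symmetric] kernel_op_square_integrable k r)
  finally show ?thesis .
qed

lemma kernel_op_kernel_cmult:
  fixes k :: "'a::euclidean_space \<times> 'a \<Rightarrow> complex"
  assumes k: "square_integrable k"
  shows "kernel_op (\<lambda>p. c * k p) f = c *\<^sub>C kernel_op k f"
  unfolding kernel_op_def
  by (simp add: abs_l2_scaleC kernel_op_square_integrable k square_integrable_rep_l2 mult.assoc)

lemma kernel_op_kernel_diff:
  fixes k k' :: "'a::euclidean_space \<times> 'a \<Rightarrow> complex"
  assumes k: "square_integrable k" "square_integrable k'"
  shows "kernel_op (\<lambda>p. k p - k' p) f = kernel_op k f - kernel_op k' f"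
proof -
  have "kernel_op (\<lambda>p. k p - k' p + k' p) f = kernel_op (\<lambda>p. k p - k' p) f + kernel_op k' f"
    by (intro kernel_op_kernel_add square_integrable_minus k)
  then show ?thesis by simp
qed

lemma norm_kernel_op_le:
  fixes k :: "'a::euclidean_space \<times> 'a \<Rightarrow> complex"
  assumes k: "square_integrable k"
  shows "norm (kernel_op k f) \<le> norm (abs_l2 k) * norm f"
proof -
  have [measurable]: "k \<in> borel_measurable borel" "k \<in> borel_measurable (borel \<Otimes>\<^sub>M borel)"
    using k by (auto intro: measurable_prodI square_integrable_measurable)
  note r = square_integrable_rep_l2[of f]
  have "ennreal ((norm (kernel_op k f))\<^sup>2) = (\<integral>\<^sup>+x. ennreal ((cmod (LINT y|lborel. k (x, y) * rep_l2 f y))\<^sup>2) \<partial>lborel)"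
    unfolding kernel_op_def by (intro ennreal_power2_norm_abs_l2 kernel_op_square_integrable k r)
  also have "\<dots> \<le> (\<integral>\<^sup>+x. (\<integral>\<^sup>+y. ennreal ((cmod (k (x, y)))\<^sup>2) \<partial>lborel) * (\<integral>\<^sup>+y. ennreal ((cmod (rep_l2 f y))\<^sup>2) \<partial>lborel) \<partial>lborel)"
    by (intro nn_integral_mono power2_cmod_integral_le measurable_slice) auto
  also have "\<dots> = (\<integral>\<^sup>+p. ennreal ((cmod (k p))\<^sup>2) \<partial>lborel) * (\<integral>\<^sup>+y. ennreal ((cmod (rep_l2 f y))\<^sup>2) \<partial>lborel)"
    by (subst nn_integral_multc) (auto simp: nn_integral_lborel_fst)
  also have "\<dots> = ennreal ((norm (abs_l2 k) * norm f)\<^sup>2)"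
    by (simp add: ennreal_power2_norm_abs_l2[OF k, symmetric] ennreal_power2_norm_l2[symmetric] power_mult_distrib ennreal_mult)
  finally have "(norm (kernel_op k f))\<^sup>2 \<le> (norm (abs_l2 k) * norm f)\<^sup>2" by (simp add: ennreal_le_iff)
  then show ?thesis by (rule power2_le_imp_le) simp
qed

text \<open>Expanding the slices \<open>k (x, -)\<close> in the basis turns the sum over the basis into the norm of
  the kernel. Since the operator pairs \<open>k (x, -)\<close> with the basis bilinearly, Parseval's identity
  is applied to the complex conjugate of the slice.\<close>

lemma HS_norm_sq_kernel_op:
  fixes k :: "'a::euclidean_space \<times> 'a \<Rightarrow> complex"
  assumes k: "square_integrable k"
  shows "HS_norm_sq (kernel_op k) = ennreal ((norm (abs_l2 k))\<^sup>2)"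
proof -
  have [measurable]: "k \<in> borel_measurable borel" "k \<in> borel_measurable (borel \<Otimes>\<^sub>M borel)"
    using k by (auto intro: measurable_prodI square_integrable_measurable)
  define e :: "nat \<Rightarrow> 'a l2" where "e = some_onb"
  have e: "orthonormal_basis e" by (simp add: e_def some_onb)
  define r where "r i = rep_l2 (e i)" for i
  have r: "square_integrable (r i)" and [measurable]: "r i \<in> borel_measurable borel" for i
    by (auto simp: r_def square_integrable_rep_l2)
  have "HS_norm_sq (kernel_op k) = (\<Sum>i. \<integral>\<^sup>+x. ennreal ((cmod (LINT y|lborel. k (x, y) * r i y))\<^sup>2) \<partial>lborel)"
    unfolding HS_norm_sq_def e_def[symmetric] kernel_op_def r_def[symmetric]
    by (intro suminf_cong ennreal_power2_norm_abs_l2 kernel_op_square_integrable k r)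
  also have "\<dots> = (\<integral>\<^sup>+x. (\<Sum>i. ennreal ((cmod (LINT y|lborel. k (x, y) * r i y))\<^sup>2)) \<partial>lborel)"
    by (intro nn_integral_suminf[symmetric]) measurable
  also have "\<dots> = (\<integral>\<^sup>+x. \<integral>\<^sup>+y. ennreal ((cmod (k (x, y)))\<^sup>2) \<partial>lborel \<partial>lborel)"
  proof (rule nn_integral_cong_AE, use AE_slice_square_integrable[OF k] in eventually_elim)
    case (elim x)
    then have s: "square_integrable (\<lambda>y. cnj (k (x, y)))" by (auto simp: square_integrable_def)
    have "cmod (LINT y|lborel. k (x, y) * r i y) = cmod (cinner (abs_l2 (\<lambda>y. cnj (k (x, y)))) (e i))" for i
    proof -
      have "cinner (abs_l2 (\<lambda>y. cnj (k (x, y)))) (abs_l2 (r i)) = (LINT y|lborel. cnj (k (x, y)) * cnj (r i y))"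
        by (intro cinner_abs_l2 s r)
      also have "\<dots> = cnj (LINT y|lborel. k (x, y) * r i y)" unfolding cnj_integral by simp
      finally show ?thesis by (simp add: r_def)
    qed
    then have "(\<Sum>i. ennreal ((cmod (LINT y|lborel. k (x, y) * r i y))\<^sup>2)) = ennreal ((norm (abs_l2 (\<lambda>y. cnj (k (x, y)))))\<^sup>2)"
      using parseval_ennreal[OF e] by simp
    also have "\<dots> = (\<integral>\<^sup>+y. ennreal ((cmod (k (x, y)))\<^sup>2) \<partial>lborel)"
      by (simp add: ennreal_power2_norm_abs_l2[OF s])
    finally show ?case .
  qed
  also have "\<dots> = ennreal ((norm (abs_l2 k))\<^sup>2)"
    by (simp add: nn_integral_lborel_fst ennreal_power2_norm_abs_l2[OF k])
  finally show ?thesis .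
qed

lemma hilbert_schmidt_kernel_op:
  fixes k :: "'a::euclidean_space \<times> 'a \<Rightarrow> complex"
  assumes k: "square_integrable k"
  shows "hilbert_schmidt (kernel_op k)"
  unfolding hilbert_schmidt_def
proof (intro conjI allI)
  show "bounded_linear (kernel_op k)"
    by (rule bounded_linear_intro[where K = "norm (abs_l2 k)"])
       (use norm_kernel_op_le[OF k] in \<open>auto simp: kernel_op_add kernel_op_scaleC k scaleR_l2_eq mult.commute\<close>)
qed (auto simp: kernel_op_scaleC HS_norm_sq_kernel_op k)

text \<open>Polarization of \<open>HS_norm_sq_kernel_op\<close>, applied to the series over the basis term by term.\<close>

lemma HS_inner_kernel_op:
  fixes k k' :: "'a::euclidean_space \<times> 'a \<Rightarrow> complex"
  assumes k: "square_integrable k" "square_integrable k'"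
  shows "HS_inner (kernel_op k) (kernel_op k') = cinner (abs_l2 k) (abs_l2 k')"
proof -
  have nrm: "(\<lambda>i. complex_of_real ((norm (kernel_op h (some_onb i)))\<^sup>2)) sums complex_of_real ((norm (abs_l2 h))\<^sup>2)"
    if "square_integrable h" for h :: "'a \<times> 'a \<Rightarrow> complex"
  proof -
    have "(\<lambda>i. ennreal ((norm (kernel_op h (some_onb i)))\<^sup>2)) sums ennreal ((norm (abs_l2 h))\<^sup>2)"
      using HS_norm_sq_kernel_op[OF that] unfolding HS_norm_sq_def by (metis summableI summable_sums)
    then show ?thesis by (intro sums_of_real) (simp add: sums_ennreal)
  qed
  have ik: "square_integrable (\<lambda>p. \<i> * k' p)" by (intro square_integrable_cmult k)
  define t where "t i = cinner (kernel_op k (some_onb i)) (kernel_op k' (some_onb i))" for i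
  have "(\<lambda>i. 4 * t i) sums (4 * cinner (abs_l2 k) (abs_l2 k'))"
    unfolding t_def cinner_polarization kernel_op_kernel_add[OF k, symmetric] kernel_op_kernel_diff[OF k, symmetric]
      kernel_op_kernel_cmult[OF k(2), symmetric] kernel_op_kernel_add[OF k(1) ik, symmetric]
      kernel_op_kernel_diff[OF k(1) ik, symmetric] abs_l2_add[OF k] abs_l2_minus[OF k] abs_l2_scaleC[OF k(2)]
      abs_l2_add[OF k(1) ik] abs_l2_minus[OF k(1) ik]
    by (intro sums_add sums_diff sums_mult nrm square_integrable_add square_integrable_minus k ik)
  then have "(\<lambda>i. (4 * t i) / 4) sums ((4 * cinner (abs_l2 k) (abs_l2 k')) / 4)" by (rule sums_divide)
  then show ?thesis by (simp add: HS_inner_def t_def sums_iff)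
qed

lemma cinner_kernel_op:
  fixes k :: "'a::euclidean_space \<times> 'a \<Rightarrow> complex"
  assumes k: "square_integrable k"
  shows "cinner (kernel_op k f) g = (LINT x|lborel. (LINT y|lborel. k (x, y) * rep_l2 f y) * cnj (rep_l2 g x))"
  using cinner_abs_l2[OF kernel_op_square_integrable[OF k square_integrable_rep_l2] square_integrable_rep_l2]
  by (simp add: kernel_op_def)

section \<open>Fields of Hilbert--Schmidt operators\<close>

lemma field_norm_sq_lebesgue:
  "field_norm_sq (F :: real \<Rightarrow> (real ^ 'n::finite) l2 \<Rightarrow> (real ^ 'n) l2)
    = (\<integral>\<^sup>+lam. HS_norm_sq (F lam) * ennreal (\<bar>lam\<bar> ^ CARD('n)) \<partial>lebesgue_on (- {0}))"
  unfolding field_norm_sq_def by (subst nn_integral_restrict_space) auto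

lemma AE_lborel_nonzero: "AE lam in (lborel :: real measure). lam \<noteq> 0"
  by (rule AE_lborel_singleton)

lemma field_norm_sq_lborel:
  "field_norm_sq (F :: real \<Rightarrow> (real ^ 'n::finite) l2 \<Rightarrow> (real ^ 'n) l2)
    = (\<integral>\<^sup>+lam. HS_norm_sq (F lam) * ennreal (\<bar>lam\<bar> ^ CARD('n)) \<partial>lborel)"
  unfolding field_norm_sq_def nn_integral_completion
  by (rule nn_integral_cong_AE) (use AE_lborel_nonzero in \<open>auto elim!: eventually_mono\<close>)

text \<open>By Parseval's identity the norm is a countable sum of measurable functions.\<close>

lemma measurable_norm_weak:
  fixes u :: "'c \<Rightarrow> 'a::euclidean_space l2"
  assumes [measurable]: "\<And>\<psi>. (\<lambda>x. cinner (u x) \<psi>) \<in> borel_measurable M"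
  shows "(\<lambda>x. ennreal ((norm (u x))\<^sup>2)) \<in> borel_measurable M"
  unfolding parseval_ennreal[OF some_onb, symmetric] by measurable

text \<open>The factor \<open>\<bar>lam\<bar> powr (- n / 2)\<close> that compensates the weight \<open>\<bar>lam\<bar> ^ n\<close> of the Plancherel measure.\<close>

definition hs_scale :: "nat \<Rightarrow> real \<Rightarrow> complex" where
  "hs_scale n lam = complex_of_real (1 / sqrt (\<bar>lam\<bar> ^ n))"

lemma measurable_hs_scale [measurable]: "hs_scale n \<in> borel_measurable borel"
  unfolding hs_scale_def by measurable

text \<open>The slices of a square integrable function serve as kernels. With the factor in front, the norm
  of the function equals the weighted norm of the field (\<open>field_norm_sq_kernel_field\<close>). On the
  null set of bad slices the zero operator keeps the field Hilbert--Schmidt.\<close>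

definition kernel_field :: "(real \<times> (real ^ 'n::finite) \<times> (real ^ 'n)) l2 \<Rightarrow>
    real \<Rightarrow> (real ^ 'n) l2 \<Rightarrow> (real ^ 'n) l2" where
  "kernel_field K lam =
    (if lam \<noteq> 0 \<and> square_integrable (\<lambda>p. rep_l2 K (lam, p))
     then kernel_op (\<lambda>p. hs_scale CARD('n) lam * rep_l2 K (lam, p))
     else (\<lambda>_. 0))"

lemma AE_good_slice:
  "AE lam in lborel. lam \<noteq> 0 \<and> square_integrable (\<lambda>p. rep_l2 K (lam :: real, p :: 'b::euclidean_space))"
  using AE_lborel_nonzero AE_slice_square_integrable[OF square_integrable_rep_l2[of K]]
  by eventually_elim simp

lemma hilbert_schmidt_zero: "hilbert_schmidt (\<lambda>_. 0)"
  by (simp add: hilbert_schmidt_def HS_norm_sq_def bounded_linear_zero)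

lemma hilbert_schmidt_kernel_field: "hilbert_schmidt (kernel_field K lam)"
  by (auto simp: kernel_field_def hilbert_schmidt_zero intro!: hilbert_schmidt_kernel_op square_integrable_cmult)

lemma measurable_kernel_field:
  fixes K :: "(real \<times> (real ^ 'n::finite) \<times> (real ^ 'n)) l2"
  shows "(\<lambda>lam. cinner (kernel_field K lam f) g) \<in> borel_measurable borel"
proof -
  define good where "good lam \<longleftrightarrow> lam \<noteq> 0 \<and> (\<integral>\<^sup>+p. ennreal ((cmod (rep_l2 K (lam, p)))\<^sup>2) \<partial>lborel) < \<infinity>" for lam
  have [measurable]: "Measurable.pred borel good" unfolding good_def by measurable
  have g: "good lam \<longleftrightarrow> lam \<noteq> 0 \<and> square_integrable (\<lambda>p. rep_l2 K (lam, p))" for lam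
    unfolding good_def square_integrable_iff_nn by (auto intro: measurable_slice)
  have "cinner (kernel_field K lam f) g = (if good lam then
      (LINT x|lborel. (LINT y|lborel. hs_scale CARD('n) lam * rep_l2 K (lam, x, y) * rep_l2 f y) * cnj (rep_l2 g x))
      else 0)" for lam
    unfolding kernel_field_def g by (auto simp: cinner_kernel_op square_integrable_cmult)
  then show ?thesis by simp
qed

lemma HS_norm_sq_kernel_field:
  fixes K :: "(real \<times> (real ^ 'n::finite) \<times> (real ^ 'n)) l2"
  assumes "lam \<noteq> 0" "square_integrable (\<lambda>p. rep_l2 K (lam, p))"
  shows "HS_norm_sq (kernel_field K lam) * ennreal (\<bar>lam\<bar> ^ CARD('n))
    = (\<integral>\<^sup>+p. ennreal ((cmod (rep_l2 K (lam, p)))\<^sup>2) \<partial>lborel)"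
proof -
  define w where "w = sqrt (\<bar>lam\<bar> ^ CARD('n))"
  have w: "w > 0" "w\<^sup>2 = \<bar>lam\<bar> ^ CARD('n)" using assms by (auto simp: w_def)
  have "HS_norm_sq (kernel_field K lam) = ennreal ((norm (hs_scale CARD('n) lam *\<^sub>C abs_l2 (\<lambda>p. rep_l2 K (lam, p))))\<^sup>2)"
    using assms by (simp add: kernel_field_def HS_norm_sq_kernel_op square_integrable_cmult abs_l2_scaleC)
  also have "\<dots> * ennreal (w\<^sup>2) = ennreal ((norm (abs_l2 (\<lambda>p. rep_l2 K (lam, p))))\<^sup>2)"
    using w(1) by (simp add: hs_scale_def w_def[symmetric] ennreal_mult[symmetric] norm_divide power_divide power_mult_distrib)
  finally show ?thesis by (simp add: w(2) ennreal_power2_norm_abs_l2 assms)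
qed

lemma field_norm_sq_kernel_field: "field_norm_sq (kernel_field K) = ennreal ((norm K)\<^sup>2)"
proof -
  have "field_norm_sq (kernel_field K) = (\<integral>\<^sup>+lam. \<integral>\<^sup>+p. ennreal ((cmod (rep_l2 K (lam, p)))\<^sup>2) \<partial>lborel \<partial>lborel)"
    unfolding field_norm_sq_lborel
    by (rule nn_integral_cong_AE, use AE_good_slice[of K] in eventually_elim) (simp add: HS_norm_sq_kernel_field)
  then show ?thesis by (simp add: ennreal_power2_norm_l2 nn_integral_lborel_fst)
qed

lemma L2_field_kernel_field: "L2_field (kernel_field K)"
  unfolding L2_field_def
  by (auto simp: hilbert_schmidt_kernel_field field_norm_sq_kernel_field
      intro!: measurable_restrict_space1 measurable_completion measurable_kernel_field)

lemma kernel_field_eq_slice: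
  fixes h :: "real \<times> (real ^ 'n::finite) \<times> (real ^ 'n) \<Rightarrow> complex"
  assumes h: "square_integrable h"
  shows "AE lam in lborel. square_integrable (\<lambda>p. h (lam, p)) \<and>
    kernel_field (abs_l2 h) lam = kernel_op (\<lambda>p. hs_scale CARD('n) lam * h (lam, p))"
  using AE_good_slice[of "abs_l2 h"] AE_slice_square_integrable[OF h] AE_slice[OF AE_rep_abs_l2[OF h]]
proof eventually_elim
  case (elim lam)
  have "kernel_op (\<lambda>p. hs_scale CARD('n) lam * rep_l2 (abs_l2 h) (lam, p))
      = kernel_op (\<lambda>p. hs_scale CARD('n) lam * h (lam, p))"
    by (rule kernel_op_cong) (use elim in \<open>auto intro!: square_integrable_cmult\<close>)
  then show ?case using elim by (simp add: kernel_field_def)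
qed

lemma kernel_field_diff:
  fixes K K' :: "(real \<times> (real ^ 'n::finite) \<times> (real ^ 'n)) l2"
  shows "AE lam in lborel. \<forall>f. kernel_field (K - K') lam f = kernel_field K lam f - kernel_field K' lam f"
proof -
  have s: "square_integrable (\<lambda>q. rep_l2 K q - rep_l2 K' q)"
    by (intro square_integrable_minus square_integrable_rep_l2)
  have e: "abs_l2 (\<lambda>q. rep_l2 K q - rep_l2 K' q) = K - K'"
    by (simp add: abs_l2_minus[symmetric] square_integrable_rep_l2)
  show ?thesis
    using kernel_field_eq_slice[OF s] AE_good_slice[of K] AE_good_slice[of K']
  proof eventually_elim
    case (elim lam)
    then show ?case
      by (simp add: e kernel_field_def right_diff_distrib kernel_op_kernel_diff square_integrable_cmult)
  qed
qed

lemma HS_inner_kernel_field: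
  fixes K K' :: "(real \<times> (real ^ 'n::finite) \<times> (real ^ 'n)) l2"
  shows "AE lam in lborel. HS_inner (kernel_field K lam) (kernel_field K' lam) * complex_of_real (\<bar>lam\<bar> ^ CARD('n))
    = (LINT p|lborel. rep_l2 K (lam, p) * cnj (rep_l2 K' (lam, p)))"
  using AE_good_slice[of K] AE_good_slice[of K']
proof eventually_elim
  case (elim lam)
  define w where "w = sqrt (\<bar>lam\<bar> ^ CARD('n))"
  have w: "w > 0" "w * w = \<bar>lam\<bar> ^ CARD('n)" using elim by (auto simp: w_def)
  have "HS_inner (kernel_field K lam) (kernel_field K' lam)
    = cinner (hs_scale CARD('n) lam *\<^sub>C abs_l2 (\<lambda>p. rep_l2 K (lam, p))) (hs_scale CARD('n) lam *\<^sub>C abs_l2 (\<lambda>p. rep_l2 K' (lam, p)))"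
    using elim by (simp add: kernel_field_def HS_inner_kernel_op square_integrable_cmult abs_l2_scaleC)
  also have "\<dots> * complex_of_real (w * w) = cinner (abs_l2 (\<lambda>p. rep_l2 K (lam, p))) (abs_l2 (\<lambda>p. rep_l2 K' (lam, p)))"
    using w(1) by (simp add: hs_scale_def w_def[symmetric])
  finally show ?case unfolding w(2) using elim by (simp add: cinner_abs_l2)
qed

definition weakly_measurable_field :: "(real \<Rightarrow> 'a::euclidean_space l2 \<Rightarrow> 'a l2) \<Rightarrow> bool" where
  "weakly_measurable_field F \<longleftrightarrow>
    (\<forall>\<phi> \<psi>. (\<lambda>lam. cinner (F lam \<phi>) \<psi>) \<in> borel_measurable (lebesgue_on (- {0})))"

text \<open>Two limits of the same sequence of fields have distance zero. Only the values on the chosen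
  basis enter the Hilbert--Schmidt norm, and they are all that the later formulas use.\<close>

lemma field_limit_unique:
  fixes F F' :: "real \<Rightarrow> (real ^ 'n::finite) l2 \<Rightarrow> (real ^ 'n) l2"
  assumes meas: "weakly_measurable_field F" "weakly_measurable_field F'" "\<And>j. weakly_measurable_field (H j)"
    and lim: "(\<lambda>j. field_norm_sq (\<lambda>lam f. H j lam f - F lam f)) \<longlonglongrightarrow> 0"
      "(\<lambda>j. field_norm_sq (\<lambda>lam f. H j lam f - F' lam f)) \<longlonglongrightarrow> 0"
  shows "AE lam in lborel. \<forall>i. F lam (some_onb i) = F' lam (some_onb i)"
proof -
  let ?M = "lebesgue_on (- {0::real})"
  have one: "AE lam in lborel. F lam (some_onb i) = F' lam (some_onb i)" for i
  proof -
    define e where "e = (some_onb i :: (real ^ 'n) l2)"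
    define c where "c lam = ennreal (\<bar>lam\<bar> ^ CARD('n))" for lam :: real
    have [measurable]: "c \<in> borel_measurable ?M"
      unfolding c_def by (intro measurable_restrict_space1 measurable_completion) measurable
    have d: "(\<lambda>lam. ennreal ((norm (S lam e - T lam e))\<^sup>2)) \<in> borel_measurable ?M"
      if "weakly_measurable_field S" "weakly_measurable_field T" for S T
    proof (rule measurable_norm_weak)
      fix \<psi> :: "(real ^ 'n) l2"
      have [measurable]: "(\<lambda>lam. cinner (S lam e) \<psi>) \<in> borel_measurable ?M" "(\<lambda>lam. cinner (T lam e) \<psi>) \<in> borel_measurable ?M"
        using that unfolding weakly_measurable_field_def by blast+
      show "(\<lambda>lam. cinner (S lam e - T lam e) \<psi>) \<in> borel_measurable ?M"
        unfolding cinner_diff_left by measurable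
    qed
    note [measurable] = d[OF meas(3) meas(1)] d[OF meas(3) meas(2)] d[OF meas(1) meas(2)]
    have le: "(\<integral>\<^sup>+lam. ennreal ((norm (S lam e - T lam e))\<^sup>2) * c lam \<partial>?M) \<le> field_norm_sq (\<lambda>lam f. S lam f - T lam f)" for S T
      unfolding field_norm_sq_lebesgue c_def
    proof (intro nn_integral_mono mult_right_mono)
      fix lam
      define a where "a i = ennreal ((norm (S lam (some_onb i) - T lam (some_onb i)))\<^sup>2)" for i
      have "(\<Sum>i\<in>{i}. a i) \<le> suminf a" by (intro sum_le_suminf) auto
      then show "ennreal ((norm (S lam e - T lam e))\<^sup>2) \<le> HS_norm_sq (\<lambda>f. S lam f - T lam f)"
        by (simp add: HS_norm_sq_def e_def a_def[abs_def])
    qed simp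
    have "(\<integral>\<^sup>+lam. ennreal ((norm (F lam e - F' lam e))\<^sup>2) * c lam \<partial>?M)
      \<le> 2 * field_norm_sq (\<lambda>lam f. H j lam f - F lam f) + 2 * field_norm_sq (\<lambda>lam f. H j lam f - F' lam f)" for j
    proof -
      have "(norm (F lam e - F' lam e))\<^sup>2 \<le> 2 * (norm (H j lam e - F lam e))\<^sup>2 + 2 * (norm (H j lam e - F' lam e))\<^sup>2" for lam
      proof -
        have "norm (F lam e - F' lam e) \<le> norm (H j lam e - F lam e) + norm (H j lam e - F' lam e)"
          using norm_triangle_ineq4[of "H j lam e - F' lam e" "H j lam e - F lam e"] by simp
        then have "(norm (F lam e - F' lam e))\<^sup>2 \<le> (norm (H j lam e - F lam e) + norm (H j lam e - F' lam e))\<^sup>2"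
          by (rule power_mono) simp
        then show ?thesis
          using sum_squares_bound[of "norm (H j lam e - F lam e)" "norm (H j lam e - F' lam e)"] by (simp add: power2_sum)
      qed
      then have "(\<integral>\<^sup>+lam. ennreal ((norm (F lam e - F' lam e))\<^sup>2) * c lam \<partial>?M)
        \<le> (\<integral>\<^sup>+lam. ennreal (2 * (norm (H j lam e - F lam e))\<^sup>2 + 2 * (norm (H j lam e - F' lam e))\<^sup>2) * c lam \<partial>?M)"
        by (intro nn_integral_mono mult_right_mono ennreal_leI) auto
      also have "\<dots> = (\<integral>\<^sup>+lam. 2 * (ennreal ((norm (H j lam e - F lam e))\<^sup>2) * c lam) + 2 * (ennreal ((norm (H j lam e - F' lam e))\<^sup>2) * c lam) \<partial>?M)"
        by (intro nn_integral_cong) (simp add: ennreal_plus ennreal_mult distrib_right mult.assoc)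
      also have "\<dots> = 2 * (\<integral>\<^sup>+lam. ennreal ((norm (H j lam e - F lam e))\<^sup>2) * c lam \<partial>?M) + 2 * (\<integral>\<^sup>+lam. ennreal ((norm (H j lam e - F' lam e))\<^sup>2) * c lam \<partial>?M)"
        by (subst nn_integral_add) (auto simp: nn_integral_cmult)
      also have "\<dots> \<le> 2 * field_norm_sq (\<lambda>lam f. H j lam f - F lam f) + 2 * field_norm_sq (\<lambda>lam f. H j lam f - F' lam f)"
        by (intro add_mono mult_left_mono le) auto
      finally show ?thesis .
    qed
    moreover have "(\<lambda>j. 2 * field_norm_sq (\<lambda>lam f. H j lam f - F lam f) + 2 * field_norm_sq (\<lambda>lam f. H j lam f - F' lam f))
        \<longlonglongrightarrow> 2 * 0 + 2 * 0"
      by (intro tendsto_add ennreal_tendsto_cmult lim) auto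
    ultimately have "(\<integral>\<^sup>+lam. ennreal ((norm (F lam e - F' lam e))\<^sup>2) * c lam \<partial>?M) \<le> 2 * 0 + 2 * 0"
      by (intro LIMSEQ_le_const) auto
    then have "(\<integral>\<^sup>+lam. ennreal ((norm (F lam e - F' lam e))\<^sup>2) * c lam \<partial>?M) = 0" by simp
    then have "AE lam in ?M. ennreal ((norm (F lam e - F' lam e))\<^sup>2) * c lam = 0"
      by (subst (asm) nn_integral_0_iff_AE) measurable
    then have "AE lam in lebesgue. lam \<noteq> 0 \<longrightarrow> ennreal ((norm (F lam e - F' lam e))\<^sup>2) * c lam = 0"
      by (subst (asm) AE_restrict_space_iff) auto
    then have "AE lam in lborel. lam \<noteq> 0 \<longrightarrow> ennreal ((norm (F lam e - F' lam e))\<^sup>2) * c lam = 0"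
      by (simp only: AE_completion_iff)
    then show ?thesis
      using AE_lborel_nonzero
    proof eventually_elim
      case (elim lam)
      then have "\<bar>lam\<bar> ^ CARD('n) > 0" by simp
      then have "c lam \<noteq> 0" by (simp only: c_def ennreal_eq_0_iff not_le)
      then have "ennreal ((norm (F lam e - F' lam e))\<^sup>2) = 0" using elim by simp
      then show ?case by (simp add: e_def)
    qed
  qed
  then show ?thesis unfolding AE_all_countable by blast
qed

section \<open>The Fourier transform of the Heisenberg group as a kernel operator\<close>

lemma measurable_fst_borel [measurable]:
  "fst \<in> borel_measurable (borel :: ('a::euclidean_space \<times> 'b::euclidean_space) measure)"
  by (intro borel_measurable_continuous_onI continuous_intros)

lemma measurable_snd_borel [measurable]:
  "snd \<in> borel_measurable (borel :: ('a::euclidean_space \<times> 'b::euclidean_space) measure)"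
  by (intro borel_measurable_continuous_onI continuous_intros)

text \<open>The rearrangement of coordinates \<open>(y, x, t) \<mapsto> (x, y, t)\<close>, which makes the variable that is
  not Fourier transformed the outer one.\<close>

definition swap_xy :: "'n::finite heis \<Rightarrow> 'n heis" where
  "swap_xy = (\<lambda>(y, x, t). (x, y, t))"

lemma measurable_swap_xy [measurable]: "(swap_xy :: 'n::finite heis \<Rightarrow> 'n heis) \<in> borel_measurable borel"
proof -
  have "continuous_on UNIV (swap_xy :: 'n heis \<Rightarrow> 'n heis)"
    unfolding swap_xy_def case_prod_beta by (intro continuous_intros)
  then show ?thesis by (rule borel_measurable_continuous_onI)
qed

lemma nn_integral_swap_xy:
  assumes [measurable]: "h \<in> borel_measurable borel"
  shows "(\<integral>\<^sup>+X. h (swap_xy X) \<partial>lborel) = (\<integral>\<^sup>+X. h (X :: 'n::finite heis) \<partial>lborel)"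
proof -
  have [measurable]: "h \<in> borel_measurable (borel \<Otimes>\<^sub>M (borel \<Otimes>\<^sub>M borel))" by (simp add: borel_prod)
  have "(\<integral>\<^sup>+X. h (swap_xy X) \<partial>lborel) = (\<integral>\<^sup>+y. \<integral>\<^sup>+x. \<integral>\<^sup>+t. h (x, y, t) \<partial>lborel \<partial>lborel \<partial>lborel)"
    by (subst nn_integral_lborel_fst, simp, intro nn_integral_cong, subst nn_integral_lborel_fst)
       (auto simp: swap_xy_def)
  also have "\<dots> = (\<integral>\<^sup>+x. \<integral>\<^sup>+y. \<integral>\<^sup>+t. h (x, y, t) \<partial>lborel \<partial>lborel \<partial>lborel)"
    by (rule lborel_pair.Fubini') measurable
  also have "\<dots> = (\<integral>\<^sup>+X. h X \<partial>lborel)"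
    by (subst nn_integral_lborel_fst, simp, intro nn_integral_cong, subst nn_integral_lborel_fst)
       (auto intro: measurable_slice)
  finally show ?thesis .
qed

lemma distr_swap_xy: "distr lborel borel swap_xy = (lborel :: 'n::finite heis measure)"
proof (rule measure_eqI)
  fix A assume "A \<in> sets (distr lborel borel (swap_xy :: 'n heis \<Rightarrow> 'n heis))"
  then have [measurable]: "A \<in> sets borel" by simp
  have "emeasure (distr lborel borel swap_xy) A = (\<integral>\<^sup>+X. indicator A X \<partial>distr lborel borel swap_xy)" by simp
  also have "\<dots> = (\<integral>\<^sup>+X. indicator A (swap_xy X) \<partial>lborel)" by (intro nn_integral_distr) auto
  also have "\<dots> = emeasure lborel A" by (subst nn_integral_swap_xy) auto
  finally show "emeasure (distr lborel borel swap_xy) A = emeasure lborel A" .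
qed simp

definition slice_y :: "('n::finite heis \<Rightarrow> complex) \<Rightarrow> real ^ 'n \<Rightarrow> (real ^ 'n) \<times> real \<Rightarrow> complex" where
  "slice_y f y = (\<lambda>z. f (fst z, y, snd z))"

lemma slice_y_eq: "slice_y f y z = f (swap_xy (y, z))"
  by (cases z) (simp add: slice_y_def swap_xy_def)

lemma measurable_slice_y:
  assumes [measurable]: "f \<in> borel_measurable borel" shows "slice_y f y \<in> borel_measurable borel"
  unfolding slice_y_def by measurable

lemma AE_slice_y:
  assumes f: "integrable lborel f" "square_integrable f"
  shows "AE y in lborel. integrable lborel (slice_y f y) \<and> square_integrable (slice_y f y)"
proof -
  have [measurable]: "f \<in> borel_measurable borel" using f by measurable
  have "square_integrable (\<lambda>X. f (swap_xy X))"
    by (rule square_integrable_compose[OF measurable_swap_xy distr_swap_xy f(2)])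
  from AE_slice_square_integrable[OF this]
  have s: "AE y in lborel. square_integrable (slice_y f y)" by (simp add: slice_y_eq[abs_def])
  have "integrable (distr lborel borel swap_xy) f" using f(1) by (simp add: distr_swap_xy)
  then have "integrable lborel (\<lambda>X. f (swap_xy X))" by (subst (asm) integrable_distr_eq) auto
  then have "integrable (lborel \<Otimes>\<^sub>M lborel) (\<lambda>X. f (swap_xy X))" by (simp only: lborel_prod)
  then have "AE y in lborel. integrable lborel (\<lambda>z. f (swap_xy (y, z)))" by (rule lborel_pair.AE_integrable_fst')
  then have "AE y in lborel. integrable lborel (slice_y f y)" by (simp add: slice_y_eq[abs_def])
  with s show ?thesis by eventually_elim simp
qed

text \<open>The kernel of the operator: substituting \<open>\<eta> = \<xi> + y\<close> in the formula for the representation,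
  the variables \<open>x\<close> and \<open>t\<close> are Fourier transformed, with dual variables
  \<open>lam / 2 * (\<xi> + \<eta>)\<close> and \<open>lam\<close>.\<close>

definition heis_kernel :: "('n::finite heis \<Rightarrow> complex) \<Rightarrow> real \<times> (real ^ 'n) \<times> (real ^ 'n) \<Rightarrow> complex" where
  "heis_kernel f = (\<lambda>(lam, \<xi>, \<eta>). fourier (slice_y f (\<eta> - \<xi>)) ((lam / 2) *\<^sub>R (\<xi> + \<eta>), lam))"

lemma measurable_fourier_slice [measurable]:
  fixes f :: "'n::finite heis \<Rightarrow> complex"
  assumes [measurable]: "f \<in> borel_measurable borel"
  shows "(\<lambda>(y, w). fourier (slice_y f y) w) \<in> borel_measurable borel"
proof -
  have "(\<lambda>(p::(real^'n) \<times> ((real^'n) \<times> real)). LINT z|lborel. f (fst z, fst p, snd z) * cis (2 * pi * (snd p \<bullet> z))) \<in> borel_measurable borel"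
    by measurable
  then show ?thesis by (simp add: fourier_def slice_y_def case_prod_beta)
qed

lemma measurable_heis_kernel [measurable]:
  fixes f :: "'n::finite heis \<Rightarrow> complex"
  assumes [measurable]: "f \<in> borel_measurable borel"
  shows "heis_kernel f \<in> borel_measurable borel"
proof -
  have "(\<lambda>p::real \<times> (real^'n) \<times> (real^'n). (snd (snd p) - fst (snd p), ((fst p / 2) *\<^sub>R (fst (snd p) + snd (snd p)), fst p))) \<in> borel_measurable borel"
    by measurable
  from measurable_compose[OF this measurable_fourier_slice[OF assms]]
  show ?thesis by (simp add: heis_kernel_def case_prod_beta)
qed

text \<open>The factor absorbs the weight of the Plancherel measure, so that the target of the isometry
  is an unweighted space.\<close>

definition heis_plancherel_fun :: "('n::finite heis \<Rightarrow> complex) \<Rightarrow> real \<times> (real ^ 'n) \<times> (real ^ 'n) \<Rightarrow> complex" where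
  "heis_plancherel_fun f p = complex_of_real (sqrt (\<bar>fst p\<bar> ^ CARD('n))) * heis_kernel f p"

lemma measurable_heis_plancherel_fun [measurable]:
  assumes [measurable]: "f \<in> borel_measurable borel"
  shows "heis_plancherel_fun f \<in> borel_measurable borel"
  unfolding heis_plancherel_fun_def by measurable

text \<open>The change of variables \<open>y = \<eta> - \<xi>\<close>, \<open>\<omega> = lam / 2 * (\<xi> + \<eta>)\<close> has Jacobian \<open>\<bar>lam\<bar> ^ n\<close>. This
  is where the weight of the Plancherel measure comes from.\<close>

lemma nn_integral_affine_fibre:
  fixes H :: "(real ^ 'n::finite) \<times> (real ^ 'n) \<Rightarrow> ennreal"
  assumes [measurable]: "H \<in> borel_measurable borel" and lam: "lam \<noteq> 0"
  shows "ennreal (\<bar>lam\<bar> ^ CARD('n)) * (\<integral>\<^sup>+\<xi>. \<integral>\<^sup>+\<eta>. H (\<eta> - \<xi>, (lam / 2) *\<^sub>R (\<xi> + \<eta>)) \<partial>lborel \<partial>lborel)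
    = (\<integral>\<^sup>+y. \<integral>\<^sup>+\<omega>. H (y, \<omega>) \<partial>lborel \<partial>lborel)"
proof -
  have "(\<integral>\<^sup>+\<eta>. H (\<eta> - \<xi>, (lam / 2) *\<^sub>R (\<xi> + \<eta>)) \<partial>lborel) = (\<integral>\<^sup>+y. H (y, (lam / 2) *\<^sub>R y + lam *\<^sub>R \<xi>) \<partial>lborel)" for \<xi>
  proof -
    have "(\<integral>\<^sup>+y. H ((\<xi> + y) - \<xi>, (lam / 2) *\<^sub>R (\<xi> + (\<xi> + y))) \<partial>lborel) = (\<integral>\<^sup>+\<eta>. H (\<eta> - \<xi>, (lam / 2) *\<^sub>R (\<xi> + \<eta>)) \<partial>lborel)"
      by (rule nn_integral_lborel_plus) measurable
    moreover have "(lam / 2) *\<^sub>R (\<xi> + (\<xi> + y)) = (lam / 2) *\<^sub>R y + lam *\<^sub>R \<xi>" for y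
    proof -
      have "(lam / 2) *\<^sub>R \<xi> + (lam / 2) *\<^sub>R \<xi> = lam *\<^sub>R \<xi>"
        unfolding scaleR_left.add[symmetric] by simp
      then show ?thesis unfolding scaleR_add_right by (metis add.assoc add.commute)
    qed
    ultimately show ?thesis by simp
  qed
  then have "ennreal (\<bar>lam\<bar> ^ CARD('n)) * (\<integral>\<^sup>+\<xi>. \<integral>\<^sup>+\<eta>. H (\<eta> - \<xi>, (lam / 2) *\<^sub>R (\<xi> + \<eta>)) \<partial>lborel \<partial>lborel)
    = ennreal (\<bar>lam\<bar> ^ CARD('n)) * (\<integral>\<^sup>+\<xi>. \<integral>\<^sup>+y. H (y, (lam / 2) *\<^sub>R y + lam *\<^sub>R \<xi>) \<partial>lborel \<partial>lborel)" by simp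
  also have "(\<integral>\<^sup>+\<xi>. \<integral>\<^sup>+y. H (y, (lam / 2) *\<^sub>R y + lam *\<^sub>R \<xi>) \<partial>lborel \<partial>lborel)
    = (\<integral>\<^sup>+y. \<integral>\<^sup>+\<xi>. H (y, (lam / 2) *\<^sub>R y + lam *\<^sub>R \<xi>) \<partial>lborel \<partial>lborel)"
    by (rule lborel_pair.Fubini') measurable
  also have "ennreal (\<bar>lam\<bar> ^ CARD('n)) * \<dots> = (\<integral>\<^sup>+y. ennreal (\<bar>lam\<bar> ^ CARD('n)) * (\<integral>\<^sup>+\<xi>. H (y, (lam / 2) *\<^sub>R y + lam *\<^sub>R \<xi>) \<partial>lborel) \<partial>lborel)"
    by (intro nn_integral_cmult[symmetric]) measurable
  also have "\<dots> = (\<integral>\<^sup>+y. \<integral>\<^sup>+\<omega>. H (y, \<omega>) \<partial>lborel \<partial>lborel)"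
  proof (intro nn_integral_cong)
    fix y :: "real ^ 'n"
    have "(\<lambda>\<omega>. H (y, \<omega>)) \<in> borel_measurable borel" by measurable
    from nn_integral_lborel_affine[OF this lam, of "(lam / 2) *\<^sub>R y"]
    show "ennreal (\<bar>lam\<bar> ^ CARD('n)) * (\<integral>\<^sup>+\<xi>. H (y, (lam / 2) *\<^sub>R y + lam *\<^sub>R \<xi>) \<partial>lborel) = (\<integral>\<^sup>+\<omega>. H (y, \<omega>) \<partial>lborel)"
      by simp
  qed
  finally show ?thesis .
qed

text \<open>After the change of variables of \<open>nn_integral_affine_fibre\<close>, the kernel is the Euclidean Fourier
  transform in \<open>(x, t)\<close> for fixed \<open>y\<close>, and Plancherel's theorem applies for almost every \<open>y\<close>.\<close>

lemma heis_plancherel_fun_isometry: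
  fixes f :: "'n::finite heis \<Rightarrow> complex"
  assumes f: "integrable lborel f" "square_integrable f"
  shows "(\<integral>\<^sup>+p. ennreal ((cmod (heis_plancherel_fun f p))\<^sup>2) \<partial>lborel) = (\<integral>\<^sup>+X. ennreal ((cmod (f X))\<^sup>2) \<partial>lborel)"
proof -
  have fm [measurable]: "f \<in> borel_measurable borel" using f by measurable
  define h :: "(real ^ 'n) \<times> (real ^ 'n) \<times> real \<Rightarrow> ennreal"
    where "h = (\<lambda>(y, w). ennreal ((cmod (fourier (slice_y f y) w))\<^sup>2))"
  have hm: "h \<in> borel_measurable borel"
  proof -
    have [measurable]: "(\<lambda>p. fourier (slice_y f (fst p)) (snd p)) \<in> borel_measurable borel"
      using measurable_fourier_slice[OF fm] by (simp add: split_def)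
    show ?thesis unfolding h_def case_prod_beta by measurable
  qed
  note [measurable] = hm hm[folded borel_prod]
  have "(\<integral>\<^sup>+p. ennreal ((cmod (heis_plancherel_fun f p))\<^sup>2) \<partial>lborel)
    = (\<integral>\<^sup>+lam. \<integral>\<^sup>+q. ennreal ((cmod (heis_plancherel_fun f (lam, q)))\<^sup>2) \<partial>lborel \<partial>lborel)"
    by (rule nn_integral_lborel_fst) measurable
  also have "\<dots> = (\<integral>\<^sup>+lam. \<integral>\<^sup>+y. \<integral>\<^sup>+\<omega>. h (y, \<omega>, lam) \<partial>lborel \<partial>lborel \<partial>lborel)"
  proof (rule nn_integral_cong_AE, use AE_lborel_nonzero in eventually_elim)
    case (elim lam)
    have m: "(\<lambda>q. ennreal ((cmod (heis_plancherel_fun f (lam, q)))\<^sup>2)) \<in> borel_measurable borel"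
      by measurable
    have "(\<integral>\<^sup>+q. ennreal ((cmod (heis_plancherel_fun f (lam, q)))\<^sup>2) \<partial>lborel)
      = (\<integral>\<^sup>+\<xi>. \<integral>\<^sup>+\<eta>. ennreal ((cmod (heis_plancherel_fun f (lam, \<xi>, \<eta>)))\<^sup>2) \<partial>lborel \<partial>lborel)"
      by (rule nn_integral_lborel_fst[OF m])
    also have "\<dots> = (\<integral>\<^sup>+\<xi>. \<integral>\<^sup>+\<eta>. ennreal (\<bar>lam\<bar> ^ CARD('n)) * h (\<eta> - \<xi>, (lam / 2) *\<^sub>R (\<xi> + \<eta>), lam) \<partial>lborel \<partial>lborel)"
      by (intro nn_integral_cong)
         (simp add: heis_plancherel_fun_def heis_kernel_def h_def norm_mult power_mult_distrib ennreal_mult)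
    also have "\<dots> = ennreal (\<bar>lam\<bar> ^ CARD('n)) * (\<integral>\<^sup>+\<xi>. \<integral>\<^sup>+\<eta>. h (\<eta> - \<xi>, (lam / 2) *\<^sub>R (\<xi> + \<eta>), lam) \<partial>lborel \<partial>lborel)"
      by (subst nn_integral_cmult[symmetric], measurable) (intro nn_integral_cong nn_integral_cmult, measurable)
    also have "\<dots> = (\<integral>\<^sup>+y. \<integral>\<^sup>+\<omega>. h (y, \<omega>, lam) \<partial>lborel \<partial>lborel)"
      using nn_integral_affine_fibre[OF _ elim, of "\<lambda>(y, \<omega>). h (y, \<omega>, lam)"] by (simp add: case_prod_beta)
    finally show ?case .
  qed
  also have "\<dots> = (\<integral>\<^sup>+y. \<integral>\<^sup>+lam. \<integral>\<^sup>+\<omega>. h (y, \<omega>, lam) \<partial>lborel \<partial>lborel \<partial>lborel)"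
    by (rule lborel_pair.Fubini') measurable
  also have "\<dots> = (\<integral>\<^sup>+y. \<integral>\<^sup>+w. h (y, w) \<partial>lborel \<partial>lborel)"
    by (intro nn_integral_cong nn_integral_lborel_snd[symmetric]) measurable
  also have "\<dots> = (\<integral>\<^sup>+y. \<integral>\<^sup>+z. ennreal ((cmod (f (swap_xy (y, z))))\<^sup>2) \<partial>lborel \<partial>lborel)"
  proof (rule nn_integral_cong_AE, use AE_slice_y[OF f] in eventually_elim)
    case (elim y)
    then show ?case using plancherel[of "slice_y f y"] by (simp add: h_def slice_y_eq)
  qed
  also have "\<dots> = (\<integral>\<^sup>+X. ennreal ((cmod (f (swap_xy X)))\<^sup>2) \<partial>lborel)"
    by (rule nn_integral_lborel_fst[symmetric]) measurable
  also have "\<dots> = (\<integral>\<^sup>+X. ennreal ((cmod (f X))\<^sup>2) \<partial>lborel)"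
    by (rule nn_integral_swap_xy) measurable
  finally show ?thesis .
qed

definition schrodinger_phase :: "real \<Rightarrow> 'n::finite heis \<Rightarrow> real ^ 'n \<Rightarrow> complex" where
  "schrodinger_phase lam = (\<lambda>(x, y, t) \<xi>. cis (2 * pi * (lam * t + lam * (x \<bullet> \<xi> + (1/2) * (x \<bullet> y)))))"

lemma schrodinger_eq:
  "schrodinger lam (x, y, t) \<phi> = abs_l2 (\<lambda>\<xi>. schrodinger_phase lam (x, y, t) \<xi> * rep_l2 \<phi> (\<xi> + y))"
proof -
  have p: "exp (2 * pi * \<i> * lam * t) * exp (2 * pi * \<i> * lam * (x \<bullet> \<xi> + (1/2) * (x \<bullet> y)))
      = schrodinger_phase lam (x, y, t) \<xi>" for \<xi>
    unfolding schrodinger_phase_def case_prod_conv cis_conv_exp exp_add[symmetric]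
    by (rule arg_cong[where f = exp]) (simp add: algebra_simps)
  have "schrodinger lam (x, y, t) (abs_l2 (rep_l2 \<phi>)) = abs_l2 ((\<lambda>(x, y, t :: real) f \<xi>. exp (2 * pi * \<i> * lam * t)
        * exp (2 * pi * \<i> * lam * (inner x \<xi> + (1/2) * inner x y)) * f (\<xi> + y)) (x, y, t) (rep_l2 \<phi>))"
    by (intro schrodinger.abs_eq) (simp add: square_integrable_rep_l2)
  then show ?thesis by (simp only: abs_rep_l2 case_prod_conv p)
qed

lemma cmod_schrodinger_phase [simp]: "cmod (schrodinger_phase lam X \<xi>) = 1"
  by (cases X) (simp add: schrodinger_phase_def)

lemma measurable_schrodinger_phase [measurable]:
  "(\<lambda>p. schrodinger_phase lam (fst p) (snd p)) \<in> borel_measurable (borel :: ('n::finite heis \<times> (real ^ 'n)) measure)"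
  unfolding schrodinger_phase_def split_def by measurable

lemma measurable_schrodinger_phase' [measurable]:
  "schrodinger_phase lam (X :: 'n::finite heis) \<in> borel_measurable borel"
  unfolding schrodinger_phase_def split_def by measurable

lemma cinner_schrodinger:
  "cinner (schrodinger lam X \<phi>) \<psi>
    = (LINT \<xi>|lborel. schrodinger_phase lam X \<xi> * rep_l2 \<phi> (\<xi> + fst (snd X)) * cnj (rep_l2 \<psi> \<xi>))"
proof (cases X)
  case (fields x y t)
  have "square_integrable (\<lambda>\<xi>. rep_l2 \<phi> (\<xi> + y))"
    using square_integrable_shift[OF square_integrable_rep_l2, of \<phi> "- y"] by simp
  then have "square_integrable (\<lambda>\<xi>. schrodinger_phase lam (x, y, t) \<xi> * rep_l2 \<phi> (\<xi> + y))"
    by (simp add: square_integrable_def norm_mult)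
  from cinner_abs_l2[OF this square_integrable_rep_l2[of \<psi>]]
  show ?thesis by (simp add: fields schrodinger_eq)
qed

text \<open>The weak operator integral defining the Fourier transform of an integrable function is
  evaluated by Fubini's theorem.\<close>

lemma fourier_L1_eq_kernel_op:
  fixes f :: "'n::finite heis \<Rightarrow> complex"
  assumes f: "integrable lborel f" and k: "square_integrable (\<lambda>p. heis_kernel f (lam, p))"
  shows "fourier_L1 f lam = kernel_op (\<lambda>p. heis_kernel f (lam, p))"
proof
  fix \<phi> :: "(real ^ 'n) l2"
  have fm [measurable]: "f \<in> borel_measurable borel" using f by auto
  define u where "u = rep_l2 \<phi>"
  have su: "square_integrable u" and [measurable]: "u \<in> borel_measurable borel"
    by (auto simp: u_def square_integrable_rep_l2)
  have key: "cinner (kernel_op (\<lambda>p. heis_kernel f (lam, p)) \<phi>) \<psi>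
      = (LINT X|lborel. f X * cinner (schrodinger lam X \<phi>) \<psi>)" for \<psi>
  proof -
    define v where "v = rep_l2 \<psi>"
    have sv: "square_integrable v" and [measurable]: "v \<in> borel_measurable borel"
      by (auto simp: v_def square_integrable_rep_l2)
    define T where "T X \<xi> = f X * (schrodinger_phase lam X \<xi> * u (\<xi> + fst (snd X)) * cnj (v \<xi>))" for X \<xi>
    have Tm: "(\<lambda>p. T (fst p) (snd p)) \<in> borel_measurable borel" unfolding T_def by measurable
    have T: "integrable (lborel \<Otimes>\<^sub>M lborel) (case_prod T)"
    proof (rule lborel_pair.Fubini_integrable)
      show "case_prod T \<in> borel_measurable (lborel \<Otimes>\<^sub>M lborel)"
        using Tm by (simp add: split_def lborel_prod)
      define au av where "au x = complex_of_real (cmod (u x))" and "av x = complex_of_real (cmod (v x))" for x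
      have s: "square_integrable au" "square_integrable av"
        using su sv by (auto simp: square_integrable_def au_def[abs_def] av_def[abs_def])
      have sy: "square_integrable (\<lambda>\<xi>. au (\<xi> + y))" for y
        using square_integrable_shift[OF s(1), of "- y"] by simp
      define n where "n y = (LINT \<xi>|lborel. cmod (u (\<xi> + y)) * cmod (v \<xi>))" for y
      have [measurable]: "n \<in> borel_measurable borel" unfolding n_def by measurable
      have n: "\<bar>n y\<bar> \<le> norm (abs_l2 au) * norm (abs_l2 av)" for y
      proof -
        have "complex_of_real (n y) = cinner (abs_l2 (\<lambda>\<xi>. au (\<xi> + y))) (abs_l2 av)"
          unfolding cinner_abs_l2[OF sy s(2)] n_def by (simp add: au_def av_def flip: integral_complex_of_real)
        then have "\<bar>n y\<bar> = cmod (cinner (abs_l2 (\<lambda>\<xi>. au (\<xi> + y))) (abs_l2 av))" by (metis norm_of_real)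
        also have "\<dots> \<le> norm (abs_l2 (\<lambda>\<xi>. au (\<xi> + y))) * norm (abs_l2 av)" by (rule cmod_cinner_le)
        finally show ?thesis using norm_shift[OF s(1), of "- y"] by simp
      qed
      have "(LINT \<xi>|lborel. norm (T X \<xi>)) = cmod (f X) * n (fst (snd X))" for X
        by (simp add: T_def norm_mult n_def)
      moreover have "integrable lborel (\<lambda>X. cmod (f X) * n (fst (snd X)))"
      proof (rule Bochner_Integration.integrable_bound)
        show "integrable lborel (\<lambda>X. cmod (f X) * (norm (abs_l2 au) * norm (abs_l2 av)))"
          using f by (intro integrable_mult_left integrable_norm)
        show "AE X in lborel. norm (cmod (f X) * n (fst (snd X))) \<le> norm (cmod (f X) * (norm (abs_l2 au) * norm (abs_l2 av)))"
          using n by (intro AE_I2) (simp add: abs_mult mult_left_mono)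
      qed measurable
      ultimately show "integrable lborel (\<lambda>X. LINT \<xi>|lborel. norm (case (X, \<xi>) of (X, \<xi>) \<Rightarrow> T X \<xi>))" by simp
      show "AE X in lborel. integrable lborel (\<lambda>\<xi>. case (X, \<xi>) of (X, \<xi>) \<Rightarrow> T X \<xi>)"
      proof (intro AE_I2)
        fix X :: "'n heis"
        have [measurable]: "T X \<in> borel_measurable borel" unfolding T_def by measurable
        have "integrable lborel (\<lambda>\<xi>. f X * (au (\<xi> + fst (snd X)) * cnj (av \<xi>)))"
          by (intro integrable_mult_right square_integrable_mult sy s)
        then show "integrable lborel (\<lambda>\<xi>. case (X, \<xi>) of (X, \<xi>) \<Rightarrow> T X \<xi>)"
          by (rule Bochner_Integration.integrable_bound) (auto simp: T_def norm_mult au_def av_def)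
      qed
    qed
    have inner: "AE \<xi> in lborel. (LINT X|lborel. T X \<xi>) = (LINT \<eta>|lborel. heis_kernel f (lam, \<xi>, \<eta>) * u \<eta>) * cnj (v \<xi>)"
      using lborel_pair.AE_integrable_snd[OF T]
    proof eventually_elim
      case (elim \<xi>)
      have [measurable]: "(\<lambda>X. T X \<xi>) \<in> borel_measurable borel" using elim by auto
      have i: "integrable (lborel \<Otimes>\<^sub>M lborel) (\<lambda>Y. T (swap_xy Y) \<xi>)"
        using elim distr_swap_xy[where 'n = 'n] integrable_distr_eq[of swap_xy lborel borel "\<lambda>X. T X \<xi>"]
        by (simp add: lborel_prod)
      have "(LINT X|lborel. T X \<xi>) = (LINT X|distr lborel borel swap_xy. T X \<xi>)" by (simp only: distr_swap_xy)
      also have "\<dots> = (LINT Y|lborel. T (swap_xy Y) \<xi>)" by (rule integral_distr) auto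
      also have "\<dots> = (LINT y|lborel. LINT z|lborel. T (swap_xy (y, z)) \<xi>)"
        using lborel_pair.integral_fst'[OF i] by (simp add: lborel_prod)
      also have "\<dots> = (LINT y|lborel. heis_kernel f (lam, \<xi>, \<xi> + y) * u (\<xi> + y) * cnj (v \<xi>))"
      proof (rule Bochner_Integration.integral_cong[OF refl])
        fix y
        have "T (swap_xy (y, z)) \<xi> = (slice_y f y z * cis (2 * pi * (((lam / 2) *\<^sub>R (\<xi> + (\<xi> + y)), lam) \<bullet> z))) * (u (\<xi> + y) * cnj (v \<xi>))" for z
        proof (cases z)
          case (Pair x t)
          have e: "lam * t + lam * (x \<bullet> \<xi> + (1/2) * (x \<bullet> y)) = ((lam / 2) *\<^sub>R (\<xi> + (\<xi> + y)), lam) \<bullet> (x, t)"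
          proof -
            have "((lam / 2) *\<^sub>R (\<xi> + (\<xi> + y)), lam) \<bullet> (x, t) = (lam / 2) * (x \<bullet> \<xi> + (x \<bullet> \<xi> + x \<bullet> y)) + lam * t"
              by (simp only: inner_Pair inner_scaleR_right inner_add_right inner_real_def inner_commute[of _ x])
            then show ?thesis by (simp add: field_simps)
          qed
          show ?thesis
            unfolding Pair e[symmetric]
            by (simp add: T_def swap_xy_def slice_y_def schrodinger_phase_def)
        qed
        then have "(LINT z|lborel. T (swap_xy (y, z)) \<xi>)
          = (LINT z|lborel. (slice_y f y z * cis (2 * pi * (((lam / 2) *\<^sub>R (\<xi> + (\<xi> + y)), lam) \<bullet> z))) * (u (\<xi> + y) * cnj (v \<xi>)))"
          by (simp only:)
        also have "\<dots> = fourier (slice_y f y) ((lam / 2) *\<^sub>R (\<xi> + (\<xi> + y)), lam) * (u (\<xi> + y) * cnj (v \<xi>))"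
          unfolding fourier_def by (rule integral_mult_left_zero)
        finally show "(LINT z|lborel. T (swap_xy (y, z)) \<xi>) = heis_kernel f (lam, \<xi>, \<xi> + y) * u (\<xi> + y) * cnj (v \<xi>)"
          by (simp add: heis_kernel_def)
      qed
      also have "\<dots> = (LINT \<eta>|lborel. heis_kernel f (lam, \<xi>, \<eta>) * u \<eta> * cnj (v \<xi>))"
      proof -
        have "(\<lambda>\<eta>. heis_kernel f (lam, \<xi>, \<eta>) * u \<eta> * cnj (v \<xi>)) \<in> borel_measurable borel" by measurable
        from integral_shift[OF this, of "- \<xi>"] show ?thesis by (simp add: add.commute)
      qed
      also have "\<dots> = (LINT \<eta>|lborel. heis_kernel f (lam, \<xi>, \<eta>) * u \<eta>) * cnj (v \<xi>)" by (rule integral_mult_left_zero)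
      finally show ?case .
    qed
    have "(LINT X|lborel. f X * cinner (schrodinger lam X \<phi>) \<psi>) = (LINT X|lborel. LINT \<xi>|lborel. T X \<xi>)"
      by (simp add: cinner_schrodinger T_def u_def v_def)
    also have "\<dots> = (LINT \<xi>|lborel. LINT X|lborel. T X \<xi>)"
      by (rule lborel_pair.Fubini_integral[symmetric, OF T])
    also have "\<dots> = (LINT \<xi>|lborel. (LINT \<eta>|lborel. heis_kernel f (lam, \<xi>, \<eta>) * u \<eta>) * cnj (v \<xi>))"
    proof (rule integral_cong_AE)
      have "(\<lambda>(\<xi>, X). T X \<xi>) \<in> borel_measurable (lborel \<Otimes>\<^sub>M lborel)"
      proof -
        have [measurable]: "(\<lambda>p::(real^'n) \<times> 'n heis. schrodinger_phase lam (snd p) (fst p)) \<in> borel_measurable borel"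
          unfolding schrodinger_phase_def split_def by measurable
        have "(\<lambda>p. T (snd p) (fst p)) \<in> borel_measurable borel" unfolding T_def by measurable
        then show ?thesis by (simp add: split_def lborel_prod)
      qed
      then show "(\<lambda>\<xi>. LINT X|lborel. T X \<xi>) \<in> borel_measurable lborel"
        by (rule lborel.borel_measurable_lebesgue_integral)
      have "(\<lambda>(\<xi>, \<eta>). heis_kernel f (lam, \<xi>, \<eta>) * u \<eta>) \<in> borel_measurable (lborel \<Otimes>\<^sub>M lborel)"
      proof -
        have "(\<lambda>p. heis_kernel f (lam, fst p, snd p) * u (snd p)) \<in> borel_measurable borel" by measurable
        then show ?thesis by (simp add: split_def lborel_prod)
      qed
      then have [measurable]: "(\<lambda>\<xi>. LINT \<eta>|lborel. heis_kernel f (lam, \<xi>, \<eta>) * u \<eta>) \<in> borel_measurable lborel"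
        by (rule lborel.borel_measurable_lebesgue_integral)
      show "(\<lambda>\<xi>. (LINT \<eta>|lborel. heis_kernel f (lam, \<xi>, \<eta>) * u \<eta>) * cnj (v \<xi>)) \<in> borel_measurable lborel"
        by measurable
    qed (rule inner)
    also have "\<dots> = cinner (kernel_op (\<lambda>p. heis_kernel f (lam, p)) \<phi>) \<psi>"
      by (simp add: cinner_kernel_op[OF k] u_def v_def)
    finally show ?thesis by simp
  qed
  show "fourier_L1 f lam \<phi> = kernel_op (\<lambda>p. heis_kernel f (lam, p)) \<phi>"
    unfolding fourier_L1_def
  proof (rule the_equality)
    fix w assume w: "\<forall>\<psi>. cinner w \<psi> = (LINT X|lborel. f X * cinner (schrodinger lam X \<phi>) \<psi>)"
    let ?d = "w - kernel_op (\<lambda>p. heis_kernel f (lam, p)) \<phi>"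
    have "cinner ?d ?d = 0" using w key by (simp add: cinner_diff_left)
    then show "w = kernel_op (\<lambda>p. heis_kernel f (lam, p)) \<phi>" by (simp add: cinner_eq_zero_iff)
  qed (use key in blast)
qed

lemma AE_lborel_pairI:
  fixes P :: "'a::euclidean_space \<times> 'b::euclidean_space \<Rightarrow> bool"
  assumes [measurable]: "Measurable.pred borel P" and ae: "AE x in lborel. AE y in lborel. P (x, y)"
  shows "AE p in lborel. P p"
proof -
  have "AE p in lborel \<Otimes>\<^sub>M lborel. P p"
  proof (rule lborel_pair.AE_pair_measure)
    show "{p \<in> space (lborel \<Otimes>\<^sub>M lborel). P p} \<in> sets (lborel \<Otimes>\<^sub>M lborel)"
      unfolding lborel_prod by measurable
  qed (rule ae)
  then show ?thesis by (simp only: lborel_prod)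
qed

text \<open>The exceptional null set of values \<open>y\<close> in \<open>AE_slice_y\<close> remains null when \<open>y = \<eta> - \<xi>\<close> is a
  function of the kernel variables.\<close>

lemma AE_heis_kernel_slice:
  fixes f :: "'n::finite heis \<Rightarrow> complex"
  assumes f: "integrable lborel f" "square_integrable f"
  shows "AE p in (lborel :: (real \<times> (real^'n) \<times> (real^'n)) measure).
    integrable lborel (slice_y f (snd (snd p) - fst (snd p)))"
proof -
  have fm [measurable]: "f \<in> borel_measurable borel" using f by measurable
  define P where "P y \<longleftrightarrow> (\<integral>\<^sup>+z. ennreal (cmod (f (fst z, y, snd z))) \<partial>lborel) < \<infinity>" for y
  have [measurable]: "Measurable.pred borel P" unfolding P_def by measurable
  have P: "P y \<longleftrightarrow> integrable lborel (slice_y f y)" for y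
    unfolding P_def integrable_iff_bounded using measurable_slice_y[OF fm, of y]
    by (simp add: slice_y_def)
  have "AE y in lborel. P y" using AE_slice_y[OF f] by (simp add: P)
  then have shift: "AE \<eta> in lborel. P (\<eta> - \<xi>)" for \<xi>
    by (rule AE_compose[OF _ distr_lborel_diff, rotated]) measurable
  have "AE q in lborel. P (snd q - fst q)"
  proof (rule AE_lborel_pairI)
    show "Measurable.pred borel (\<lambda>q::(real^'n)\<times>(real^'n). P (snd q - fst q))" by measurable
  qed (use shift in simp)
  then have "AE p in (lborel :: (real \<times> (real^'n) \<times> (real^'n)) measure). P (snd (snd p) - fst (snd p))"
  proof (intro AE_lborel_pairI)
    show "Measurable.pred borel (\<lambda>p::real \<times> (real^'n)\<times>(real^'n). P (snd (snd p) - fst (snd p)))" by measurable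
  qed simp
  then show ?thesis by (simp add: P)
qed

lemma heis_plancherel_fun_square_integrable:
  assumes "integrable lborel f" "square_integrable f"
  shows "square_integrable (heis_plancherel_fun f)"
  unfolding square_integrable_iff_nn heis_plancherel_fun_isometry[OF assms]
  using assms by (auto simp: square_integrable_iff_nn)

lemma heis_plancherel_fun_add:
  fixes f g :: "'n::finite heis \<Rightarrow> complex"
  assumes f: "integrable lborel f" "square_integrable f" and g: "integrable lborel g" "square_integrable g"
  shows "AE p in lborel. heis_plancherel_fun (\<lambda>X. f X + g X) p = heis_plancherel_fun f p + heis_plancherel_fun g p"
  using AE_heis_kernel_slice[OF f] AE_heis_kernel_slice[OF g]
proof eventually_elim
  case (elim p)
  obtain lam \<xi> \<eta> where p: "p = (lam, \<xi>, \<eta>)" by (cases p)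
  have [measurable]: "f \<in> borel_measurable borel" "g \<in> borel_measurable borel" using f g by auto
  have i: "integrable lborel (\<lambda>z. slice_y h (\<eta> - \<xi>) z * cis (2 * pi * (w \<bullet> z)))"
    if "integrable lborel (slice_y h (\<eta> - \<xi>))" for h w
    using that by (rule Bochner_Integration.integrable_bound) (use that in \<open>auto simp: norm_mult\<close>)
  have "fourier (slice_y (\<lambda>X. f X + g X) (\<eta> - \<xi>)) w = fourier (slice_y f (\<eta> - \<xi>)) w + fourier (slice_y g (\<eta> - \<xi>)) w" for w
  proof -
    have "fourier (slice_y (\<lambda>X. f X + g X) (\<eta> - \<xi>)) w
      = (LINT z|lborel. slice_y f (\<eta> - \<xi>) z * cis (2 * pi * (w \<bullet> z)) + slice_y g (\<eta> - \<xi>) z * cis (2 * pi * (w \<bullet> z)))"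
      by (simp add: fourier_def slice_y_def distrib_right)
    also have "\<dots> = fourier (slice_y f (\<eta> - \<xi>)) w + fourier (slice_y g (\<eta> - \<xi>)) w"
      unfolding fourier_def using elim by (intro Bochner_Integration.integral_add i) (auto simp: p)
    finally show ?thesis .
  qed
  then show ?case by (simp add: p heis_plancherel_fun_def heis_kernel_def distrib_left)
qed

lemma heis_plancherel_fun_cmult: "heis_plancherel_fun (\<lambda>X. c * f X) = (\<lambda>p. c * heis_plancherel_fun f p)"
proof
  fix p
  have "fourier (slice_y (\<lambda>X. c * f X) y) w = c * fourier (slice_y f y) w" for y w
    unfolding fourier_def slice_y_def by (simp add: mult.assoc)
  then show "heis_plancherel_fun (\<lambda>X. c * f X) p = c * heis_plancherel_fun f p"
    by (cases p) (simp add: heis_plancherel_fun_def heis_kernel_def)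
qed

text \<open>The difference of the two images is the image of the difference, up to a null set, and its norm
  vanishes by the isometry property.\<close>

lemma heis_plancherel_fun_AE_cong:
  fixes f g :: "'n::finite heis \<Rightarrow> complex"
  assumes f: "integrable lborel f" "square_integrable f" and g: "integrable lborel g" "square_integrable g"
    and eq: "AE X in lborel. f X = g X"
  shows "abs_l2 (heis_plancherel_fun f) = abs_l2 (heis_plancherel_fun g)"
proof -
  let ?d = "\<lambda>X. f X - g X"
  have [measurable]: "f \<in> borel_measurable borel" "g \<in> borel_measurable borel" using f g by auto
  have d: "integrable lborel ?d" "square_integrable ?d" using f g by (auto intro: square_integrable_minus)
  have "(\<integral>\<^sup>+p. ennreal ((cmod (heis_plancherel_fun ?d p))\<^sup>2) \<partial>lborel) = (\<integral>\<^sup>+X. ennreal ((cmod (?d X))\<^sup>2) \<partial>(lborel :: 'n heis measure))"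
    by (rule heis_plancherel_fun_isometry[OF d])
  also have "\<dots> = 0" using eq by (subst nn_integral_0_iff_AE) auto
  finally have "AE p in lborel. ennreal ((cmod (heis_plancherel_fun ?d p))\<^sup>2) = 0"
    by (subst (asm) nn_integral_0_iff_AE) (use d in measurable)
  then have "AE p in lborel. heis_plancherel_fun f p = heis_plancherel_fun g p"
    using heis_plancherel_fun_add[OF d g] by eventually_elim simp
  then show ?thesis by (intro abs_l2_eqI heis_plancherel_fun_square_integrable f g)
qed

section \<open>The Plancherel isometry on all square integrable functions\<close>

definition L1_L2 :: "'n::finite heis l2 set" where
  "L1_L2 = {f. integrable lborel (rep_l2 f)}"

definition heis_plancherel0 :: "'n::finite heis l2 \<Rightarrow> (real \<times> (real ^ 'n) \<times> (real ^ 'n)) l2" where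
  "heis_plancherel0 f = abs_l2 (heis_plancherel_fun (rep_l2 f))"

lemma integrable_rep_abs_l2:
  assumes "integrable lborel f" "square_integrable f"
  shows "integrable lborel (rep_l2 (abs_l2 f))"
  using assms(1) by (rule integrable_cong_AE_imp) (use AE_rep_abs_l2[OF assms(2)] in \<open>auto elim: eventually_mono\<close>)

lemma abs_l2_in_L1_L2: "integrable lborel f \<Longrightarrow> square_integrable f \<Longrightarrow> abs_l2 f \<in> L1_L2"
  by (simp add: L1_L2_def integrable_rep_abs_l2)

lemma L1_L2_add: "f \<in> L1_L2 \<Longrightarrow> g \<in> L1_L2 \<Longrightarrow> f + g \<in> L1_L2"
  using abs_l2_in_L1_L2[of "\<lambda>x. rep_l2 f x + rep_l2 g x"]
  by (simp add: L1_L2_def square_integrable_add square_integrable_rep_l2 flip: abs_l2_add)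

lemma L1_L2_scaleC: "f \<in> L1_L2 \<Longrightarrow> c *\<^sub>C f \<in> L1_L2"
  using abs_l2_in_L1_L2[of "\<lambda>x. c * rep_l2 f x"]
  by (simp add: L1_L2_def square_integrable_cmult square_integrable_rep_l2 flip: abs_l2_scaleC)

lemma heis_plancherel0_abs_l2:
  assumes "integrable lborel f" "square_integrable f"
  shows "heis_plancherel0 (abs_l2 f) = abs_l2 (heis_plancherel_fun f)"
  unfolding heis_plancherel0_def using assms
  by (intro heis_plancherel_fun_AE_cong integrable_rep_abs_l2 square_integrable_rep_l2 AE_rep_abs_l2)

lemma heis_plancherel0_add:
  assumes "f \<in> L1_L2" "g \<in> L1_L2"
  shows "heis_plancherel0 (f + g) = heis_plancherel0 f + heis_plancherel0 g"
proof -
  note r = square_integrable_rep_l2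
  have i: "integrable lborel (rep_l2 f)" "integrable lborel (rep_l2 g)" using assms by (auto simp: L1_L2_def)
  have "heis_plancherel0 (abs_l2 (\<lambda>x. rep_l2 f x + rep_l2 g x)) = abs_l2 (heis_plancherel_fun (\<lambda>x. rep_l2 f x + rep_l2 g x))"
    using i by (intro heis_plancherel0_abs_l2 square_integrable_add r) auto
  also have "\<dots> = abs_l2 (\<lambda>p. heis_plancherel_fun (rep_l2 f) p + heis_plancherel_fun (rep_l2 g) p)"
    using i by (intro abs_l2_eqI heis_plancherel_fun_square_integrable square_integrable_add r heis_plancherel_fun_add) auto
  also have "\<dots> = heis_plancherel0 f + heis_plancherel0 g"
    unfolding heis_plancherel0_def using i by (intro abs_l2_add[symmetric] heis_plancherel_fun_square_integrable r)
  finally show ?thesis by (simp add: r flip: abs_l2_add)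
qed

lemma heis_plancherel0_scaleC:
  assumes "f \<in> L1_L2"
  shows "heis_plancherel0 (c *\<^sub>C f) = c *\<^sub>C heis_plancherel0 f"
proof -
  note r = square_integrable_rep_l2
  have i: "integrable lborel (rep_l2 f)" using assms by (auto simp: L1_L2_def)
  have "heis_plancherel0 (abs_l2 (\<lambda>x. c * rep_l2 f x)) = abs_l2 (heis_plancherel_fun (\<lambda>x. c * rep_l2 f x))"
    using i by (intro heis_plancherel0_abs_l2 square_integrable_cmult r) auto
  also have "\<dots> = c *\<^sub>C heis_plancherel0 f"
    unfolding heis_plancherel0_def heis_plancherel_fun_cmult
    using i by (intro abs_l2_scaleC[symmetric] heis_plancherel_fun_square_integrable r)
  finally show ?thesis by (simp add: r flip: abs_l2_scaleC)
qed

lemma norm_heis_plancherel0: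
  assumes "f \<in> L1_L2" shows "norm (heis_plancherel0 f) = norm f"
proof -
  have i: "integrable lborel (rep_l2 f)" using assms by (auto simp: L1_L2_def)
  have "ennreal ((norm (heis_plancherel0 f))\<^sup>2) = ennreal ((norm f)\<^sup>2)"
    unfolding heis_plancherel0_def ennreal_power2_norm_l2[of f]
    by (simp add: ennreal_power2_norm_abs_l2 heis_plancherel_fun_square_integrable heis_plancherel_fun_isometry i square_integrable_rep_l2)
  then show ?thesis by (simp add: power2_eq_iff_nonneg)
qed

lemma L1_L2_minus: "f \<in> L1_L2 \<Longrightarrow> g \<in> L1_L2 \<Longrightarrow> f - g \<in> L1_L2"
  using L1_L2_add[of f "(-1) *\<^sub>C g"] L1_L2_scaleC[of g "-1"] scaleR_l2_eq[of "-1" g]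
  by (simp add: diff_conv_add_uminus del: add_uminus_conv_diff)

lemma heis_plancherel0_minus:
  assumes "f \<in> L1_L2" "g \<in> L1_L2"
  shows "heis_plancherel0 (f - g) = heis_plancherel0 f - heis_plancherel0 g"
  using heis_plancherel0_add[OF L1_L2_minus[OF assms] assms(2)] by simp

lemma L1_L2_dense: "\<exists>g. (\<forall>j. g j \<in> L1_L2) \<and> g \<longlonglongrightarrow> (f :: 'n::finite heis l2)"
proof -
  have "\<exists>h. h \<in> L1_L2 \<and> norm (h - f) < inverse (real (Suc j))" for j
    using test_function_dense[of "inverse (real (Suc j))" f] test_function_integrable abs_l2_in_L1_L2
    by (metis inverse_positive_iff_positive of_nat_0_less_iff zero_less_Suc)
  then obtain g where g: "\<And>j. g j \<in> L1_L2" "\<And>j. norm (g j - f) < inverse (real (Suc j))" by metis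
  have "(\<lambda>j. g j - f) \<longlonglongrightarrow> 0"
    by (rule Lim_null_comparison[OF _ LIMSEQ_inverse_real_of_nat]) (use less_imp_le[OF g(2)] in auto)
  then show ?thesis using g(1) LIM_zero_cancel by blast
qed

text \<open>The continuous extension from the dense subspace \<open>L1_L2\<close>. By \<open>heis_plancherel_limit\<close>
  every approximating sequence has the same limit.\<close>

definition heis_plancherel :: "'n::finite heis l2 \<Rightarrow> (real \<times> (real ^ 'n) \<times> (real ^ 'n)) l2" where
  "heis_plancherel f = lim (\<lambda>j. heis_plancherel0 ((SOME g. (\<forall>j. g j \<in> L1_L2) \<and> g \<longlonglongrightarrow> f) j))"

text \<open>Since \<open>heis_plancherel0\<close> preserves distances, images of convergent sequences are Cauchy, and
  images of two sequences with the same limit approach each other.\<close>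

lemma heis_plancherel_limit:
  assumes g: "\<And>j. g j \<in> L1_L2" "g \<longlonglongrightarrow> f"
  shows "(\<lambda>j. heis_plancherel0 (g j)) \<longlonglongrightarrow> heis_plancherel f"
proof -
  define a where "a = (SOME g. (\<forall>j. g j \<in> L1_L2) \<and> g \<longlonglongrightarrow> f)"
  have a: "\<And>j. a j \<in> L1_L2" "a \<longlonglongrightarrow> f"
    using someI_ex[OF L1_L2_dense[of f]] by (auto simp: a_def)
  have dist0: "dist (heis_plancherel0 u) (heis_plancherel0 v) = dist u v" if "u \<in> L1_L2" "v \<in> L1_L2" for u v :: "'a heis l2"
    using that by (simp add: dist_norm norm_heis_plancherel0 L1_L2_minus flip: heis_plancherel0_minus)
  have "Cauchy a" using a(2) by (rule LIMSEQ_imp_Cauchy)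
  then have "Cauchy (\<lambda>j. heis_plancherel0 (a j))" unfolding Cauchy_def dist0[OF a(1) a(1)] .
  then have "(\<lambda>j. heis_plancherel0 (a j)) \<longlonglongrightarrow> heis_plancherel f"
    unfolding heis_plancherel_def a_def[symmetric] by (simp add: Cauchy_convergent convergent_LIMSEQ_iff[symmetric])
  moreover have "(\<lambda>j. heis_plancherel0 (g j) - heis_plancherel0 (a j)) \<longlonglongrightarrow> 0"
  proof -
    have "(\<lambda>j. g j - a j) \<longlonglongrightarrow> f - f" by (intro tendsto_diff g a)
    then have "(\<lambda>j. norm (g j - a j)) \<longlonglongrightarrow> 0" by (simp add: tendsto_norm_zero_iff)
    then show ?thesis
      by (subst tendsto_norm_zero_iff[symmetric]) (simp add: norm_heis_plancherel0 L1_L2_minus g a flip: heis_plancherel0_minus)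
  qed
  ultimately have "(\<lambda>j. heis_plancherel0 (g j) - heis_plancherel0 (a j) + heis_plancherel0 (a j)) \<longlonglongrightarrow> 0 + heis_plancherel f"
    by (intro tendsto_add)
  then show ?thesis by simp
qed

lemma heis_plancherel_add: "heis_plancherel (f + g) = heis_plancherel f + heis_plancherel g"
proof -
  obtain a b where a: "\<And>j. a j \<in> L1_L2" "a \<longlonglongrightarrow> f" and b: "\<And>j. b j \<in> L1_L2" "b \<longlonglongrightarrow> g"
    using L1_L2_dense by metis
  have "(\<lambda>j. heis_plancherel0 (a j + b j)) \<longlonglongrightarrow> heis_plancherel (f + g)"
    by (intro heis_plancherel_limit L1_L2_add tendsto_add a b)
  moreover have "(\<lambda>j. heis_plancherel0 (a j + b j)) \<longlonglongrightarrow> heis_plancherel f + heis_plancherel g"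
    unfolding heis_plancherel0_add[OF a(1) b(1)] by (intro tendsto_add heis_plancherel_limit a b)
  ultimately show ?thesis by (rule LIMSEQ_unique)
qed

lemma heis_plancherel_scaleC: "heis_plancherel (c *\<^sub>C f) = c *\<^sub>C heis_plancherel f"
proof -
  obtain a where a: "\<And>j. a j \<in> L1_L2" "a \<longlonglongrightarrow> f" using L1_L2_dense by metis
  have "(\<lambda>j. heis_plancherel0 (c *\<^sub>C a j)) \<longlonglongrightarrow> heis_plancherel (c *\<^sub>C f)"
    by (intro heis_plancherel_limit L1_L2_scaleC tendsto_scaleC a)
  moreover have "(\<lambda>j. heis_plancherel0 (c *\<^sub>C a j)) \<longlonglongrightarrow> c *\<^sub>C heis_plancherel f"
    unfolding heis_plancherel0_scaleC[OF a(1)] by (intro tendsto_scaleC heis_plancherel_limit a)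
  ultimately show ?thesis by (rule LIMSEQ_unique)
qed

lemma heis_plancherel_minus: "heis_plancherel (f - g) = heis_plancherel f - heis_plancherel g"
  using heis_plancherel_add[of "f - g" g] by simp

lemma norm_heis_plancherel: "norm (heis_plancherel f) = norm f"
proof -
  obtain a where a: "\<And>j. a j \<in> L1_L2" "a \<longlonglongrightarrow> f" using L1_L2_dense by metis
  have "(\<lambda>j. norm (heis_plancherel0 (a j))) \<longlonglongrightarrow> norm (heis_plancherel f)"
    by (intro tendsto_norm heis_plancherel_limit a)
  moreover have "(\<lambda>j. norm (heis_plancherel0 (a j))) \<longlonglongrightarrow> norm f"
    unfolding norm_heis_plancherel0[OF a(1)] by (intro tendsto_norm a)
  ultimately show ?thesis by (rule LIMSEQ_unique)
qed

lemma cinner_heis_plancherel: "cinner (heis_plancherel f) (heis_plancherel g) = cinner f g"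
proof -
  have "4 * cinner (heis_plancherel f) (heis_plancherel g) = 4 * cinner f g"
    unfolding cinner_polarization heis_plancherel_add[symmetric] heis_plancherel_minus[symmetric]
      heis_plancherel_scaleC[symmetric] norm_heis_plancherel ..
  then show ?thesis by simp
qed

section \<open>The Fourier transform of a square integrable function\<close>

lemma fourier_L1_kernel_field:
  fixes f :: "'n::finite heis l2"
  assumes f: "f \<in> L1_L2"
  shows "AE lam in lborel. fourier_L1 (rep_l2 f) lam = kernel_field (heis_plancherel0 f) lam"
proof -
  have i: "integrable lborel (rep_l2 f)" using f by (simp add: L1_L2_def)
  have s: "square_integrable (heis_plancherel_fun (rep_l2 f))"
    by (intro heis_plancherel_fun_square_integrable i square_integrable_rep_l2)
  show ?thesis
    using kernel_field_eq_slice[OF s] AE_lborel_nonzero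
  proof eventually_elim
    case (elim lam)
    have e: "(\<lambda>p. hs_scale CARD('n) lam * heis_plancherel_fun (rep_l2 f) (lam, p)) = (\<lambda>p. heis_kernel (rep_l2 f) (lam, p))"
    proof
      fix p
      have "sqrt (\<bar>lam\<bar> ^ CARD('n)) \<noteq> 0" using elim by simp
      then have "hs_scale CARD('n) lam * complex_of_real (sqrt (\<bar>lam\<bar> ^ CARD('n))) = 1"
        unfolding hs_scale_def by (simp flip: of_real_mult del: real_sqrt_eq_zero_cancel_iff)
      then show "hs_scale CARD('n) lam * heis_plancherel_fun (rep_l2 f) (lam, p) = heis_kernel (rep_l2 f) (lam, p)"
        by (simp add: heis_plancherel_fun_def flip: mult.assoc)
    qed
    have "square_integrable (\<lambda>p. heis_kernel (rep_l2 f) (lam, p))"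
      unfolding e[symmetric] using elim by (intro square_integrable_cmult) simp
    from fourier_L1_eq_kernel_op[OF i this] show ?case using elim by (simp add: heis_plancherel0_def e)
  qed
qed

lemma field_norm_sq_cong_AE:
  assumes "AE lam in lborel. F lam = F' lam"
  shows "field_norm_sq F = field_norm_sq F'"
  unfolding field_norm_sq_lborel
  by (rule nn_integral_cong_AE) (use assms in eventually_elim, simp)

lemma field_norm_sq_fourier_L1_minus:
  assumes "g \<in> L1_L2"
  shows "field_norm_sq (\<lambda>lam f. fourier_L1 (rep_l2 g) lam f - kernel_field K lam f)
    = ennreal ((norm (heis_plancherel0 g - K))\<^sup>2)"
proof -
  have "AE lam in lborel. (\<lambda>f. fourier_L1 (rep_l2 g) lam f - kernel_field K lam f) = kernel_field (heis_plancherel0 g - K) lam"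
    using fourier_L1_kernel_field[OF assms] kernel_field_diff[of "heis_plancherel0 g" K]
    by eventually_elim auto
  then show ?thesis by (simp only: field_norm_sq_cong_AE field_norm_sq_kernel_field)
qed

text \<open>The field distance between an approximation and the proposed limit is the distance of their
  kernels, which tends to zero.\<close>

lemma is_fourier_L2_heis_plancherel: "is_fourier_L2 \<phi> (kernel_field (heis_plancherel \<phi>))"
  unfolding is_fourier_L2_def
proof (intro conjI allI impI L2_field_kernel_field)
  fix g assume "(\<forall>j. integrable lborel (rep_l2 (g j))) \<and> g \<longlonglongrightarrow> \<phi>"
  then have g: "\<And>j. g j \<in> L1_L2" "g \<longlonglongrightarrow> \<phi>" by (auto simp: L1_L2_def)
  have "(\<lambda>j. (norm (heis_plancherel0 (g j) - heis_plancherel \<phi>))\<^sup>2) \<longlonglongrightarrow> 0\<^sup>2"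
    by (intro tendsto_power tendsto_norm_zero LIM_zero heis_plancherel_limit g)
  then have "(\<lambda>j. ennreal ((norm (heis_plancherel0 (g j) - heis_plancherel \<phi>))\<^sup>2)) \<longlonglongrightarrow> ennreal (0\<^sup>2)"
    by (rule tendsto_ennrealI)
  then show "(\<lambda>j. field_norm_sq (\<lambda>lam f. fourier_L1 (rep_l2 (g j)) lam f - kernel_field (heis_plancherel \<phi>) lam f)) \<longlonglongrightarrow> 0"
    by (simp add: field_norm_sq_fourier_L1_minus g)
qed

text \<open>Existence makes the choice in \<open>fourier_L2\<close> meaningful, and uniqueness of limits identifies the
  chosen field almost everywhere.\<close>

lemma fourier_L2_eq_kernel_field:
  "AE lam in lborel. \<forall>i. fourier_L2 \<phi> lam (some_onb i) = kernel_field (heis_plancherel \<phi>) lam (some_onb i)"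
proof -
  have F: "is_fourier_L2 \<phi> (fourier_L2 \<phi>)"
    unfolding fourier_L2_def by (rule someI[of "is_fourier_L2 \<phi>", OF is_fourier_L2_heis_plancherel])
  obtain g where g: "\<And>j. g j \<in> L1_L2" "g \<longlonglongrightarrow> \<phi>" using L1_L2_dense by metis
  have w: "weakly_measurable_field F" if "L2_field F" for F
    using that by (simp add: L2_field_def weakly_measurable_field_def)
  have lim: "(\<lambda>j. field_norm_sq (\<lambda>lam f. kernel_field (heis_plancherel0 (g j)) lam f - F lam f)) \<longlonglongrightarrow> 0"
    if "is_fourier_L2 \<phi> F" for F
  proof -
    have "field_norm_sq (\<lambda>lam f. kernel_field (heis_plancherel0 (g j)) lam f - F lam f)
      = field_norm_sq (\<lambda>lam f. fourier_L1 (rep_l2 (g j)) lam f - F lam f)" for j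
      by (rule field_norm_sq_cong_AE) (use fourier_L1_kernel_field[OF g(1)[of j]] in eventually_elim, simp)
    then show ?thesis using that g by (simp add: is_fourier_L2_def L1_L2_def)
  qed
  show ?thesis
    by (rule field_limit_unique[where H = "\<lambda>j. kernel_field (heis_plancherel0 (g j))"])
       (use F is_fourier_L2_heis_plancherel[of \<phi>] in \<open>auto intro!: w lim L2_field_kernel_field simp: is_fourier_L2_def\<close>)
qed

section \<open>Inner products of translates\<close>

lemma left_trans_abs_l2:
  assumes "square_integrable u"
  shows "left_trans h (abs_l2 u) = abs_l2 (\<lambda>X. u (heis_mult (heis_inv h) X))"
  using assms by (intro left_trans.abs_eq) auto

lemma square_integrable_heis_mult:
  assumes "square_integrable u"
  shows "square_integrable (\<lambda>X. u (heis_mult h X))"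
  by (rule square_integrable_compose[OF heis_mult_measurable lborel_distr_heis_mult assms])

lemma left_trans_eq: "left_trans h f = abs_l2 (\<lambda>X. rep_l2 f (heis_mult (heis_inv h) X))"
  using left_trans_abs_l2[OF square_integrable_rep_l2, of h f] by simp

lemma left_trans_add: "left_trans h (f + g) = left_trans h f + left_trans h g"
proof -
  note r = square_integrable_rep_l2
  have "left_trans h (abs_l2 (\<lambda>X. rep_l2 f X + rep_l2 g X)) = left_trans h f + left_trans h g"
    by (simp add: left_trans_abs_l2 left_trans_eq[of h f] left_trans_eq[of h g] square_integrable_add abs_l2_add r square_integrable_heis_mult)
  then show ?thesis by (simp add: r flip: abs_l2_add)
qed

lemma left_trans_minus: "left_trans h (f - g) = left_trans h f - left_trans h g"
  using left_trans_add[of h "f - g" g] by simp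

lemma cinner_left_trans: "cinner (left_trans h f) (left_trans h g) = cinner f g"
proof -
  let ?T = "heis_mult (heis_inv h)"
  have "cinner (left_trans h f) (left_trans h g) = (LINT X|lborel. rep_l2 f (?T X) * cnj (rep_l2 g (?T X)))"
    unfolding left_trans_eq by (intro cinner_abs_l2 square_integrable_heis_mult square_integrable_rep_l2)
  also have "\<dots> = (LINT X|distr lborel borel ?T. rep_l2 f X * cnj (rep_l2 g X))"
    by (rule integral_distr[symmetric]) (auto intro: heis_mult_measurable)
  also have "\<dots> = cinner f g" by (simp add: lborel_distr_heis_mult cinner_rep_l2)
  finally show ?thesis .
qed

lemma norm_left_trans: "norm (left_trans h f) = norm f"
  unfolding norm_l2_def inner_l2_def cinner_left_trans ..

lemma heis_inv_mult: "heis_inv (heis_mult g h) = heis_mult (heis_inv h) (heis_inv g)"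
  by (cases g; cases h) (simp add: heis_inv_def heis_mult_def inner_commute algebra_simps)

lemma left_trans_left_trans: "left_trans g (left_trans h f) = left_trans (heis_mult g h) f"
proof -
  have "left_trans g (left_trans h f) = abs_l2 (\<lambda>X. rep_l2 f (heis_mult (heis_inv h) (heis_mult (heis_inv g) X)))"
    unfolding left_trans_eq[of h f] by (intro left_trans_abs_l2 square_integrable_heis_mult square_integrable_rep_l2)
  then show ?thesis
    by (simp add: left_trans_eq[of "heis_mult g h"] heis_inv_mult flip: heis_mult_assoc)
qed

lemma left_trans_L1_L2:
  assumes "f \<in> L1_L2" shows "left_trans h f \<in> L1_L2"
proof -
  let ?T = "heis_mult (heis_inv h)"
  have "integrable (distr lborel borel ?T) (rep_l2 f)" using assms by (simp add: L1_L2_def lborel_distr_heis_mult)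
  then have "integrable lborel (\<lambda>X. rep_l2 f (?T X))"
    by (subst (asm) integrable_distr_eq) (auto intro: heis_mult_measurable)
  then show ?thesis
    unfolding left_trans_eq by (intro abs_l2_in_L1_L2 square_integrable_heis_mult square_integrable_rep_l2)
qed

lemma tendsto_left_trans:
  assumes "g \<longlonglongrightarrow> f" shows "(\<lambda>j. left_trans h (g j)) \<longlonglongrightarrow> left_trans h f"
proof -
  have "(\<lambda>j. norm (g j - f)) \<longlonglongrightarrow> 0" using assms by (simp add: tendsto_norm_zero_iff LIM_zero)
  then have "(\<lambda>j. left_trans h (g j) - left_trans h f) \<longlonglongrightarrow> 0"
    by (subst tendsto_norm_zero_iff[symmetric]) (simp add: norm_left_trans flip: left_trans_minus)
  then show ?thesis by (rule LIM_zero_cancel)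
qed

text \<open>A central translation acts on the transform as a modulation in \<open>lam\<close>.\<close>

definition modulate :: "real \<Rightarrow> (real \<times> 'b::euclidean_space) l2 \<Rightarrow> (real \<times> 'b) l2" where
  "modulate m K = abs_l2 (\<lambda>p. cis (2 * pi * m * fst p) * rep_l2 K p)"

lemma square_integrable_modulate:
  fixes u :: "real \<times> 'b::euclidean_space \<Rightarrow> complex"
  assumes "square_integrable u"
  shows "square_integrable (\<lambda>p. cis (2 * pi * m * fst p) * u p)"
proof -
  have [measurable]: "u \<in> borel_measurable borel" using assms by auto
  show ?thesis using assms by (simp add: square_integrable_def norm_mult)
qed

lemma modulate_abs_l2:
  assumes "square_integrable u"
  shows "modulate m (abs_l2 u) = abs_l2 (\<lambda>p. cis (2 * pi * m * fst p) * u p)"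
  unfolding modulate_def using AE_rep_abs_l2[OF assms]
  by (intro abs_l2_eqI square_integrable_modulate square_integrable_rep_l2 assms) (auto elim: eventually_mono)

lemma modulate_minus: "modulate m (f - g) = modulate m f - modulate m g"
proof -
  note r = square_integrable_rep_l2
  have "modulate m (abs_l2 (\<lambda>p. rep_l2 f p - rep_l2 g p)) = modulate m f - modulate m g"
    by (simp add: modulate_abs_l2 modulate_def[of m f] modulate_def[of m g] square_integrable_minus abs_l2_minus r
        square_integrable_modulate right_diff_distrib)
  then show ?thesis by (simp add: r flip: abs_l2_minus)
qed

lemma norm_modulate: "norm (modulate m K) = norm K"
proof -
  have "(norm (modulate m K))\<^sup>2 = (norm K)\<^sup>2"
    unfolding modulate_def
    by (subst power2_norm_abs_l2) (simp_all add: power2_norm_l2 square_integrable_modulate square_integrable_rep_l2 norm_mult)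
  then show ?thesis by (simp add: power2_eq_iff_nonneg)
qed

lemma tendsto_modulate:
  assumes "g \<longlonglongrightarrow> f" shows "(\<lambda>j. modulate m (g j)) \<longlonglongrightarrow> modulate m f"
proof -
  have "(\<lambda>j. norm (g j - f)) \<longlonglongrightarrow> 0" using assms by (simp add: tendsto_norm_zero_iff LIM_zero)
  then have "(\<lambda>j. modulate m (g j) - modulate m f) \<longlonglongrightarrow> 0"
    by (subst tendsto_norm_zero_iff[symmetric]) (simp add: norm_modulate flip: modulate_minus)
  then show ?thesis by (rule LIM_zero_cancel)
qed

lemma heis_plancherel_fun_central:
  fixes f :: "'n::finite heis \<Rightarrow> complex"
  assumes fm: "f \<in> borel_measurable borel"
  shows "heis_plancherel_fun (\<lambda>X. f (heis_mult (heis_inv (0, 0, m)) X)) p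
    = cis (2 * pi * m * fst p) * heis_plancherel_fun f p"
proof (cases p)
  case (fields lam \<xi> \<eta>)
  let ?f = "\<lambda>X. f (heis_mult (heis_inv (0, 0, m)) X)"
  have "fourier (slice_y ?f y) (\<omega>, lam) = cis (2 * pi * m * lam) * fourier (slice_y f y) (\<omega>, lam)" for y \<omega>
  proof -
    define h where "h z = slice_y f y z * cis (2 * pi * ((\<omega>, lam) \<bullet> z))" for z
    have [measurable]: "slice_y f y \<in> borel_measurable borel" by (rule measurable_slice_y[OF fm])
    have hm: "h \<in> borel_measurable borel" unfolding h_def by measurable
    have "slice_y ?f y z * cis (2 * pi * ((\<omega>, lam) \<bullet> z)) = cis (2 * pi * m * lam) * h (z - (0, m))" for z
    proof (cases z)
      case (Pair x t)
      have "2 * pi * ((\<omega>, lam) \<bullet> (x, t)) = 2 * pi * m * lam + 2 * pi * ((\<omega>, lam) \<bullet> ((x, t) - (0, m)))"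
        by (simp add: algebra_simps)
      then have "cis (2 * pi * ((\<omega>, lam) \<bullet> (x, t))) = cis (2 * pi * m * lam) * cis (2 * pi * ((\<omega>, lam) \<bullet> ((x, t) - (0, m))))"
        by (simp only: cis_mult)
      moreover have "slice_y ?f y (x, t) = slice_y f y ((x, t) - (0, m))"
        by (simp add: slice_y_def heis_mult_def heis_inv_def)
      ultimately show ?thesis by (simp only: Pair h_def mult_ac)
    qed
    then have "fourier (slice_y ?f y) (\<omega>, lam) = (LINT z|lborel. cis (2 * pi * m * lam) * h (z - (0, m)))"
      by (simp only: fourier_def)
    also have "\<dots> = cis (2 * pi * m * lam) * (LINT z|lborel. h (z - (0, m)))" by (rule integral_mult_right_zero)
    also have "(LINT z|lborel. h (z - (0, m))) = fourier (slice_y f y) (\<omega>, lam)"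
      unfolding integral_shift[OF hm] by (simp add: h_def[abs_def] fourier_def)
    finally show ?thesis .
  qed
  then show ?thesis by (simp add: fields heis_plancherel_fun_def heis_kernel_def)
qed

lemma heis_plancherel_central: "heis_plancherel (left_trans (0, 0, m) f) = modulate m (heis_plancherel f)"
proof -
  obtain a where a: "\<And>j. a j \<in> L1_L2" "a \<longlonglongrightarrow> f" using L1_L2_dense by metis
  have eq: "heis_plancherel0 (left_trans (0, 0, m) g) = modulate m (heis_plancherel0 g)" if g: "g \<in> L1_L2" for g :: "'a heis l2"
  proof -
    let ?T = "heis_mult (heis_inv (0, 0, m))"
    have i: "integrable lborel (rep_l2 g)" using g by (simp add: L1_L2_def)
    have "integrable (distr lborel borel ?T) (rep_l2 g)" using i by (simp add: lborel_distr_heis_mult)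
    then have iT: "integrable lborel (\<lambda>X. rep_l2 g (?T X))"
      by (subst (asm) integrable_distr_eq) (auto intro: heis_mult_measurable)
    have "heis_plancherel0 (left_trans (0, 0, m) g) = abs_l2 (heis_plancherel_fun (\<lambda>X. rep_l2 g (?T X)))"
      unfolding left_trans_eq by (intro heis_plancherel0_abs_l2 iT square_integrable_heis_mult square_integrable_rep_l2)
    also have "heis_plancherel_fun (\<lambda>X. rep_l2 g (?T X)) = (\<lambda>p. cis (2 * pi * m * fst p) * heis_plancherel_fun (rep_l2 g) p)"
      by (intro ext heis_plancherel_fun_central) measurable
    also have "abs_l2 \<dots> = modulate m (heis_plancherel0 g)"
      unfolding heis_plancherel0_def
      by (intro modulate_abs_l2[symmetric] heis_plancherel_fun_square_integrable i square_integrable_rep_l2)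
    finally show ?thesis .
  qed
  have "(\<lambda>j. heis_plancherel0 (left_trans (0, 0, m) (a j))) \<longlonglongrightarrow> heis_plancherel (left_trans (0, 0, m) f)"
    by (intro heis_plancherel_limit left_trans_L1_L2 tendsto_left_trans a)
  moreover have "(\<lambda>j. heis_plancherel0 (left_trans (0, 0, m) (a j))) \<longlonglongrightarrow> modulate m (heis_plancherel f)"
    unfolding eq[OF a(1)] by (intro tendsto_modulate heis_plancherel_limit a)
  ultimately show ?thesis by (rule LIMSEQ_unique)
qed

subsection \<open>Periodization\<close>

text \<open>The integers are enumerated so that this is a series of functions. It is measurable everywhere,
  and almost everywhere it agrees with the unordered sum (\<open>periodization_has_sum\<close>).\<close>

definition periodization :: "(real \<Rightarrow> complex) \<Rightarrow> real \<Rightarrow> complex" where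
  "periodization g lam = (\<Sum>n. g (lam + real_of_int (int_decode n)))"

lemma measurable_periodization [measurable]:
  assumes [measurable]: "g \<in> borel_measurable borel"
  shows "periodization g \<in> borel_measurable borel"
  unfolding periodization_def by measurable

text \<open>Every real number lies in exactly one of the cells \<open>(r, r + 1]\<close>.\<close>

lemma period_cell:
  "lam \<in> {real_of_int (int_decode k)<..real_of_int (int_decode k) + 1} \<longleftrightarrow> k = int_encode (\<lceil>lam\<rceil> - 1)"
proof -
  have "lam \<in> {real_of_int (int_decode k)<..real_of_int (int_decode k) + 1} \<longleftrightarrow> \<lceil>lam\<rceil> = int_decode k + 1"
    unfolding ceiling_eq_iff by auto
  also have "\<dots> \<longleftrightarrow> k = int_encode (\<lceil>lam\<rceil> - 1)"
    by (metis add_diff_cancel_right' diff_add_cancel int_decode_inverse int_encode_inverse)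
  finally show ?thesis .
qed

lemma nn_integral_periodization:
  fixes u :: "real \<Rightarrow> ennreal"
  assumes [measurable]: "u \<in> borel_measurable borel"
  shows "(\<Sum>n. \<integral>\<^sup>+lam. indicator {0<..1} lam * u (lam + real_of_int (int_decode n)) \<partial>lborel) = (\<integral>\<^sup>+lam. u lam \<partial>lborel)"
proof -
  define r where "r n = real_of_int (int_decode n)" for n
  have s1: "(\<Sum>n. indicator {r n<..r n + 1} lam) = (1::ennreal)" for lam
  proof -
    define n where "n = int_encode (\<lceil>lam\<rceil> - 1)"
    have eq: "lam \<in> {r k<..r k + 1} \<longleftrightarrow> k = n" for k
      unfolding r_def n_def by (rule period_cell)
    have "(\<lambda>k. indicator {r k<..r k + 1} lam) = (\<lambda>k. if k = n then 1 else 0 :: ennreal)"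
      using eq by (auto simp: indicator_def fun_eq_iff)
    then show ?thesis using sums_single[of n "\<lambda>_. 1 :: ennreal"] by (simp add: sums_iff)
  qed
  have "(\<integral>\<^sup>+lam. indicator {0<..1} lam * u (lam + r n) \<partial>lborel) = (\<integral>\<^sup>+lam. indicator {r n<..r n + 1} lam * u lam \<partial>lborel)" for n
  proof -
    have "(\<integral>\<^sup>+lam. indicator {r n<..r n + 1} (r n + lam) * u (r n + lam) \<partial>lborel) = (\<integral>\<^sup>+lam. indicator {r n<..r n + 1} lam * u lam \<partial>lborel)"
      by (rule nn_integral_lborel_plus) measurable
    then show ?thesis by (simp add: indicator_def add.commute)
  qed
  then have "(\<Sum>n. \<integral>\<^sup>+lam. indicator {0<..1} lam * u (lam + r n) \<partial>lborel) = (\<integral>\<^sup>+lam. (\<Sum>n. indicator {r n<..r n + 1} lam * u lam) \<partial>lborel)"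
    by (subst nn_integral_suminf) auto
  also have "\<dots> = (\<integral>\<^sup>+lam. u lam \<partial>lborel)" by (simp add: ennreal_suminf_multc s1)
  finally show ?thesis by (simp add: r_def)
qed

lemma integral_period_cells:
  fixes u :: "real \<Rightarrow> complex"
  assumes u: "integrable lborel u"
  shows "(\<Sum>n. LINT lam|lborel. indicator {0<..1} lam *\<^sub>R u (lam + real_of_int (int_decode n))) = (LINT lam|lborel. u lam)"
proof -
  have [measurable]: "u \<in> borel_measurable borel" using u by auto
  define r where "r n = real_of_int (int_decode n)" for n
  define A where "A n = {r n<..r n + 1}" for n
  have eq: "lam \<in> A k \<longleftrightarrow> k = int_encode (\<lceil>lam\<rceil> - 1)" for k lam
    unfolding A_def r_def by (rule period_cell)
  have U: "(\<Union>n. A n) = UNIV" using eq by auto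
  have "(LINT lam:(\<Union>n. A n)|lborel. u lam) = (\<Sum>n. (LINT lam:A n|lborel. u lam))"
  proof (rule lebesgue_integral_countable_add)
    show "A n \<in> sets lborel" for n by (simp add: A_def)
    show "A i \<inter> A j = {}" if "i \<noteq> j" for i j using eq that by auto
    show "set_integrable lborel (\<Union>n. A n) u" using u by (simp add: U set_integrable_def)
  qed
  moreover have "(LINT lam:A n|lborel. u lam) = (LINT lam|lborel. indicator {0<..1} lam *\<^sub>R u (lam + r n))" for n
  proof -
    have "(LINT lam|lborel. indicator (A n) (lam - (- r n)) *\<^sub>R u (lam - (- r n))) = (LINT lam|lborel. indicator (A n) lam *\<^sub>R u lam)"
      by (rule integral_shift) (simp add: A_def)
    moreover have "indicator (A n) (lam - (- r n)) = (indicator {0<..1} lam :: real)" for lam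
      by (simp add: A_def indicator_def)
    ultimately show ?thesis by (simp add: set_lebesgue_integral_def)
  qed
  ultimately show ?thesis by (simp add: U set_lebesgue_integral_def r_def)
qed

text \<open>The integral of \<open>\<bar>g\<bar>\<close> over the line is the sum of its integrals over the cells, so the series
  converges absolutely almost everywhere and may be integrated term by term. Multiplication by an
  exponential of period \<open>1\<close> commutes with periodization.\<close>

lemma
  fixes g :: "real \<Rightarrow> complex"
  assumes g: "integrable lborel g"
  shows periodization_has_sum: "AE lam in lborel. lam \<in> {0<..1} \<longrightarrow>
      ((\<lambda>r. g (lam + real_of_int r)) has_sum periodization g lam) UNIV"
    and integrable_periodization: "set_integrable lborel {0<..1} (periodization g)"
    and integral_periodization: "(LINT lam:{0<..1}|lborel. cis (2 * pi * real_of_int m * lam) * periodization g lam)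
      = (LINT lam|lborel. cis (2 * pi * real_of_int m * lam) * g lam)"
proof -
  have [measurable]: "g \<in> borel_measurable borel" using g by auto
  define r where "r n = real_of_int (int_decode n)" for n
  define h where "h n lam = indicator {0<..1} lam *\<^sub>R g (lam + r n)" for n lam
  have [measurable]: "h n \<in> borel_measurable borel" for n unfolding h_def by measurable
  have nh: "ennreal (norm (h n lam)) = indicator {0<..1} lam * ennreal (norm (g (lam + r n)))" for n lam
    by (simp add: h_def indicator_def)
  have tot: "(\<Sum>n. \<integral>\<^sup>+lam. ennreal (norm (h n lam)) \<partial>lborel) = (\<integral>\<^sup>+lam. ennreal (norm (g lam)) \<partial>lborel)"
    unfolding nh r_def by (rule nn_integral_periodization) measurable
  also have fin: "\<dots> < \<infinity>" using g by (simp add: integrable_iff_bounded)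
  finally have sfin: "(\<Sum>n. \<integral>\<^sup>+lam. ennreal (norm (h n lam)) \<partial>lborel) < \<infinity>" .
  have ih: "integrable lborel (h n)" for n
  proof -
    have "(\<Sum>k\<in>{n}. \<integral>\<^sup>+lam. ennreal (norm (h k lam)) \<partial>lborel) \<le> (\<Sum>n. \<integral>\<^sup>+lam. ennreal (norm (h n lam)) \<partial>lborel)"
      by (intro sum_le_suminf) auto
    then have "(\<integral>\<^sup>+lam. ennreal (norm (h n lam)) \<partial>lborel) < \<infinity>" using sfin by (simp add: le_less_trans)
    then show ?thesis by (simp add: integrable_iff_bounded)
  qed
  have sn: "summable (\<lambda>n. LINT lam|lborel. norm (h n lam))"
  proof (rule summable_suminf_not_top)
    have "(\<Sum>n. ennreal (LINT lam|lborel. norm (h n lam))) = (\<Sum>n. \<integral>\<^sup>+lam. ennreal (norm (h n lam)) \<partial>lborel)"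
      by (intro suminf_cong nn_integral_eq_integral[symmetric]) (use ih in auto)
    then show "(\<Sum>n. ennreal (LINT lam|lborel. norm (h n lam))) \<noteq> \<top>" using sfin by simp
  qed simp
  have ae: "AE lam in lborel. summable (\<lambda>n. norm (h n lam))"
  proof -
    have "(\<integral>\<^sup>+lam. (\<Sum>n. ennreal (norm (h n lam))) \<partial>lborel) \<noteq> \<infinity>"
      using sfin by (subst nn_integral_suminf) auto
    then have "AE lam in lborel. (\<Sum>n. ennreal (norm (h n lam))) \<noteq> \<infinity>" by (intro nn_integral_PInf_AE) measurable
    then show ?thesis by eventually_elim (auto intro: summable_suminf_not_top)
  qed
  have sh: "(\<Sum>n. h n lam) = indicator {0<..1} lam *\<^sub>R periodization g lam" for lam
    by (simp add: h_def periodization_def r_def indicator_def)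
  show "AE lam in lborel. lam \<in> {0<..1} \<longrightarrow> ((\<lambda>r. g (lam + real_of_int r)) has_sum periodization g lam) UNIV"
    using ae
  proof (eventually_elim, intro impI)
    fix lam :: real assume lam: "summable (\<lambda>n. norm (h n lam))" "lam \<in> {0<..1}"
    then have s: "summable (\<lambda>n. norm (g (lam + r n)))" by (simp add: h_def)
    then have "(\<lambda>n. g (lam + r n)) sums periodization g lam"
      unfolding periodization_def r_def[symmetric] by (rule summable_sums[OF summable_norm_cancel])
    with s have "((\<lambda>n. g (lam + r n)) has_sum periodization g lam) UNIV" by (rule norm_summable_imp_has_sum)
    then show "((\<lambda>r. g (lam + real_of_int r)) has_sum periodization g lam) UNIV"
      unfolding r_def using has_sum_reindex_bij_betw[of int_decode UNIV UNIV "\<lambda>r. g (lam + real_of_int r)"]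
      by (simp add: bij_int_decode)
  qed
  show "set_integrable lborel {0<..1} (periodization g)"
    unfolding set_integrable_def sh[symmetric] by (rule integrable_suminf[OF ih ae sn])
  define e where "e lam = cis (2 * pi * real_of_int m * lam)" for lam
  have [measurable]: "e \<in> borel_measurable borel" unfolding e_def by measurable
  have e1: "norm (e lam) = 1" for lam by (simp add: e_def)
  have er: "e (lam + r n) = e lam" for lam n
  proof -
    have "2 * pi * real_of_int m * (lam + r n) = 2 * pi * real_of_int m * lam + 2 * pi * real_of_int (m * int_decode n)"
      by (simp add: r_def algebra_simps)
    then show ?thesis unfolding e_def by (simp only: cis_mult[symmetric] cis_multiple_2pi[OF Ints_of_int] mult_1_right)
  qed
  have ieh: "integrable lborel (\<lambda>lam. e lam * h n lam)" for n
    by (rule Bochner_Integration.integrable_bound[OF ih[of n]]) (auto simp: norm_mult e1)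
  have "(LINT lam:{0<..1}|lborel. e lam * periodization g lam) = (LINT lam|lborel. (\<Sum>n. e lam * h n lam))"
    unfolding set_lebesgue_integral_def
  proof (rule integral_cong_AE)
    show "AE lam in lborel. indicator {0<..1} lam *\<^sub>R (e lam * periodization g lam) = (\<Sum>n. e lam * h n lam)"
      using ae
    proof eventually_elim
      case (elim lam)
      then show ?case using suminf_mult[OF summable_norm_cancel[OF elim], of "e lam"] by (simp add: sh)
    qed
  qed measurable
  also have "\<dots> = (\<Sum>n. LINT lam|lborel. e lam * h n lam)"
    by (rule integral_suminf[OF ieh]) (use ae sn in \<open>auto simp: norm_mult e1\<close>)
  also have "\<dots> = (\<Sum>n. LINT lam|lborel. indicator {0<..1} lam *\<^sub>R (e (lam + r n) * g (lam + r n)))"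
    by (simp add: er h_def)
  also have "\<dots> = (LINT lam|lborel. e lam * g lam)"
    unfolding r_def
  proof (rule integral_period_cells)
    show "integrable lborel (\<lambda>lam. e lam * g lam)"
      by (rule Bochner_Integration.integrable_bound[OF g]) (auto simp: norm_mult e1)
  qed
  finally show "(LINT lam:{0<..1}|lborel. cis (2 * pi * real_of_int m * lam) * periodization g lam)
      = (LINT lam|lborel. cis (2 * pi * real_of_int m * lam) * g lam)"
    by (simp add: e_def)
qed

text \<open>For the kernels of two functions, this is the Hilbert--Schmidt inner product of their transforms
  at \<open>lam\<close>, including the Plancherel weight (\<open>HS_inner_fourier_L2\<close>).\<close>

definition fibre_inner :: "(real \<times> 'b::euclidean_space) l2 \<Rightarrow> (real \<times> 'b) l2 \<Rightarrow> real \<Rightarrow> complex" where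
  "fibre_inner K K' lam = (LINT p|lborel. rep_l2 K (lam, p) * cnj (rep_l2 K' (lam, p)))"

lemma integrable_fibre_inner: "integrable lborel (fibre_inner K K')"
proof -
  have "integrable (lborel \<Otimes>\<^sub>M lborel) (\<lambda>p. rep_l2 K p * cnj (rep_l2 K' p))"
    unfolding lborel_prod by (intro square_integrable_mult square_integrable_rep_l2)
  from lborel_pair.integrable_fst'[OF this] show ?thesis by (simp add: fibre_inner_def[abs_def])
qed

lemma integral_fibre_inner:
  "(LINT lam|lborel. cis (2 * pi * m * lam) * fibre_inner K K' lam) = cinner (modulate m K) K'"
proof -
  note r = square_integrable_rep_l2
  have i: "integrable (lborel \<Otimes>\<^sub>M lborel) (\<lambda>p. cis (2 * pi * m * fst p) * rep_l2 K p * cnj (rep_l2 K' p))"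
    unfolding lborel_prod by (intro square_integrable_mult square_integrable_modulate r)
  have "cinner (modulate m K) K' = cinner (modulate m K) (abs_l2 (rep_l2 K'))" by simp
  also have "\<dots> = (LINT p|lborel. cis (2 * pi * m * fst p) * rep_l2 K p * cnj (rep_l2 K' p))"
    unfolding modulate_def by (intro cinner_abs_l2 square_integrable_modulate r)
  also have "\<dots> = (LINT lam|lborel. LINT p|lborel. cis (2 * pi * m * lam) * rep_l2 K (lam, p) * cnj (rep_l2 K' (lam, p)))"
    using lborel_pair.integral_fst'[OF i] by (simp add: lborel_prod)
  also have "\<dots> = (LINT lam|lborel. cis (2 * pi * m * lam) * fibre_inner K K' lam)"
    by (simp add: fibre_inner_def mult.assoc)
  finally show ?thesis by simp
qed

lemma HS_inner_fourier_L2: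
  fixes \<phi> \<psi> :: "'n::finite heis l2"
  shows "AE lam in lborel. HS_inner (fourier_L2 \<phi> lam) (fourier_L2 \<psi> lam) * complex_of_real (\<bar>lam\<bar> ^ CARD('n))
    = fibre_inner (heis_plancherel \<phi>) (heis_plancherel \<psi>) lam"
  using fourier_L2_eq_kernel_field[of \<phi>] fourier_L2_eq_kernel_field[of \<psi>]
    HS_inner_kernel_field[of "heis_plancherel \<phi>" "heis_plancherel \<psi>"]
  by eventually_elim (simp add: HS_inner_def fibre_inner_def)

text \<open>A Borel measurable version of \<open>G\<close>, which is itself known only up to null sets because
  \<open>fourier_L2\<close> is.\<close>

definition G_density :: "'n::finite heis l2 \<Rightarrow> int ^ 'n \<Rightarrow> int ^ 'n \<Rightarrow> real \<Rightarrow> complex" where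
  "G_density \<phi> k l = periodization (fibre_inner (heis_plancherel \<phi>) (heis_plancherel (translate \<phi> (k, l, 0))))"

lemma AE_shift_real:
  assumes "AE lam in lborel. P (lam :: real)" shows "AE lam in lborel. P (lam + c)"
proof -
  have "AE lam in lborel. P (lam - (- c))" by (rule AE_compose[OF _ distr_lborel_diff assms]) simp
  then show ?thesis by simp
qed

lemma G_eq_density: "AE lam in lborel. lam \<in> {0<..1} \<longrightarrow> G \<phi> k l lam = G_density \<phi> k l lam"
proof -
  let ?\<psi> = "translate \<phi> (k, l, 0)"
  let ?g = "fibre_inner (heis_plancherel \<phi>) (heis_plancherel ?\<psi>)"
  have "AE lam in lborel. \<forall>r::int. HS_inner (fourier_L2 \<phi> (lam + real_of_int r)) (fourier_L2 ?\<psi> (lam + real_of_int r))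
      * complex_of_real (\<bar>lam + real_of_int r\<bar> ^ CARD('a)) = ?g (lam + real_of_int r)"
    unfolding AE_all_countable by (intro allI AE_shift_real HS_inner_fourier_L2)
  then show ?thesis
    using periodization_has_sum[OF integrable_fibre_inner, of "heis_plancherel \<phi>" "heis_plancherel ?\<psi>"]
    by eventually_elim (simp add: G_def G_density_def infsumI)
qed

lemma measurable_G_density [measurable]: "G_density \<phi> k l \<in> borel_measurable borel"
  unfolding G_density_def
  by (rule measurable_periodization)
     (use borel_measurable_integrable[OF integrable_fibre_inner] in simp)

lemma set_integrable_G_density: "set_integrable lborel {0<..1} (G_density \<phi> k l)"
  unfolding G_density_def by (rule integrable_periodization[OF integrable_fibre_inner])

lemma real_vec_zero: "real_vec 0 = 0" by (simp add: real_vec_def vec_eq_iff)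

lemma real_vec_diff: "real_vec (k - k') = real_vec k - real_vec k'"
  by (simp add: real_vec_def vec_eq_iff)

lemma inner_real_vec: "inner (real_vec k) (real_vec l) = real_of_int (\<Sum>i\<in>UNIV. k $ i * l $ i)"
  by (simp add: inner_vec_def real_vec_def)

lemma translate_zero: "translate \<phi> (0, 0, 0) = \<phi>"
proof -
  have "left_trans (0, 0, 0) \<phi> = abs_l2 (rep_l2 \<phi>)"
    unfolding left_trans_eq by (simp add: heis_inv_def heis_mult_one)
  then show ?thesis by (simp add: translate_def real_vec_zero)
qed

text \<open>The isometry turns the central translation into a modulation, whose frequency is an integer, so
  the integral over the line folds to one period.\<close>

lemma cinner_translate_central:
  "cinner (translate \<phi> (0, 0, m)) (translate \<phi> (k, l, 0))
    = (LINT lam:{0<..1}|lborel. cis (2 * pi * real_of_int m * lam) * G_density \<phi> k l lam)"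
proof -
  let ?\<psi> = "translate \<phi> (k, l, 0)"
  have "cinner (translate \<phi> (0, 0, m)) ?\<psi> = cinner (heis_plancherel (left_trans (0, 0, real_of_int m) \<phi>)) (heis_plancherel ?\<psi>)"
    unfolding cinner_heis_plancherel by (simp add: translate_def real_vec_zero)
  also have "\<dots> = (LINT lam|lborel. cis (2 * pi * real_of_int m * lam) * fibre_inner (heis_plancherel \<phi>) (heis_plancherel ?\<psi>) lam)"
    unfolding heis_plancherel_central by (rule integral_fibre_inner[symmetric])
  also have "\<dots> = (LINT lam:{0<..1}|lborel. cis (2 * pi * real_of_int m * lam) * G_density \<phi> k l lam)"
    unfolding G_density_def by (rule integral_periodization[OF integrable_fibre_inner, symmetric])
  finally show ?thesis .
qed

text \<open>The points \<open>(2 k, l, m)\<close> form a subgroup of the Heisenberg group, because the factor \<open>2\<close> cancels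
  the \<open>1/2\<close> in the group law. Left translations are unitary, so a common translation reduces every
  inner product of two translates to the previous case. The bilinear correction of the last index
  comes from the group law.\<close>

lemma cinner_translate:
  fixes \<phi> :: "'n::finite heis l2"
  shows "cinner (translate \<phi> (k, l, m)) (translate \<phi> (k', l', m'))
    = cinner (translate \<phi> (0, 0, m - m' - ((\<Sum>i\<in>UNIV. k $ i * l' $ i) - (\<Sum>i\<in>UNIV. k' $ i * l $ i))))
        (translate \<phi> (k' - k, l' - l, 0))"
proof -
  \<comment> \<open>the two points are \<open>a (0, 0, M)\<close> and \<open>a (2 (k' - k), l' - l, 0)\<close> for a common \<open>a\<close>\<close>
  define M where "M = m - m' - ((\<Sum>i\<in>UNIV. k $ i * l' $ i) - (\<Sum>i\<in>UNIV. k' $ i * l $ i))"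
  define emb :: "'n idx \<Rightarrow> 'n heis" where "emb = (\<lambda>(k, l, m). (2 *\<^sub>R real_vec k, real_vec l, real_of_int m))"
  have t: "translate \<phi> j = left_trans (emb j) \<phi>" for j by (cases j) (simp add: translate_def emb_def)
  define a where "a = heis_mult (emb (k, l, m)) (emb (0, 0, - M))"
  have a1: "heis_mult a (emb (0, 0, M)) = emb (k, l, m)"
    by (simp add: a_def emb_def heis_mult_def real_vec_zero)
  have MM: "real_of_int M = real_of_int m - real_of_int m' - (inner (real_vec k) (real_vec l') - inner (real_vec k') (real_vec l))"
    by (simp add: M_def inner_real_vec)
  have a2: "heis_mult a (emb (k' - k, l' - l, 0)) = emb (k', l', m')"
    by (simp add: a_def emb_def heis_mult_def real_vec_zero real_vec_diff MM inner_diff_left inner_diff_right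
        inner_commute[of "real_vec l"] inner_commute[of "real_vec l'"] algebra_simps)
       (simp add: field_simps)
  have "cinner (translate \<phi> (k, l, m)) (translate \<phi> (k', l', m'))
    = cinner (left_trans a (translate \<phi> (0, 0, M))) (left_trans a (translate \<phi> (k' - k, l' - l, 0)))"
    unfolding t left_trans_left_trans a1 a2 ..
  then show ?thesis unfolding cinner_left_trans M_def .
qed

lemma cinner_translate_same:
  "cinner (translate \<phi> (k, l, m)) (translate \<phi> (k, l, m'))
    = (LINT lam:{0<..1}|lborel. cis (2 * pi * real_of_int (m - m') * lam) * G_density \<phi> 0 0 lam)"
  unfolding cinner_translate[of \<phi> k l m k l m'] by (simp add: cinner_translate_central)

lemma cinner_translate_orthogonal:
  assumes C: "condition_C \<phi>" and ne: "(k, l) \<noteq> (k', l')"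
  shows "cinner (translate \<phi> (k, l, m)) (translate \<phi> (k', l', m')) = 0"
proof -
  have "(k' - k, l' - l) \<noteq> (0, 0)" using ne by auto
  then have "AE lam in lebesgue_on {0<..1}. G \<phi> (k' - k) (l' - l) lam = 0" using C by (auto simp: condition_C_def)
  then have "AE lam in lebesgue. lam \<in> {0<..1} \<longrightarrow> G \<phi> (k' - k) (l' - l) lam = 0"
    by (subst (asm) AE_restrict_space_iff) auto
  then have "AE lam in lborel. lam \<in> {0<..1} \<longrightarrow> G \<phi> (k' - k) (l' - l) lam = 0" by (simp only: AE_completion_iff)
  then have ae: "AE lam in lborel. lam \<in> {0<..1} \<longrightarrow> G_density \<phi> (k' - k) (l' - l) lam = 0"
    using G_eq_density[of \<phi> "k' - k" "l' - l"] by eventually_elim auto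
  have "(LINT lam:{0<..1}|lborel. cis (2 * pi * real_of_int M * lam) * G_density \<phi> (k' - k) (l' - l) lam) = 0" for M
    unfolding set_lebesgue_integral_def
    by (rule integral_eq_zero_AE) (use ae in \<open>eventually_elim, auto simp: indicator_def\<close>)
  then show ?thesis by (simp only: cinner_translate[of \<phi> k l m k' l' m'] cinner_translate_central)
qed

text \<open>The fibre inner product of a kernel with itself is the integral of a square.\<close>

lemma G00_density_nonneg:
  "AE lam in lborel. lam \<in> {0<..1} \<longrightarrow> G_density \<phi> 0 0 lam = complex_of_real (max 0 (Re (G_density \<phi> 0 0 lam)))"
proof -
  let ?K = "heis_plancherel \<phi>"
  have g: "fibre_inner ?K ?K lam = complex_of_real (LINT p|lborel. (cmod (rep_l2 ?K (lam, p)))\<^sup>2)" for lam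
    unfolding fibre_inner_def complex_norm_square[symmetric] by (rule integral_complex_of_real)
  show ?thesis
    using periodization_has_sum[OF integrable_fibre_inner, of ?K ?K]
  proof (eventually_elim, intro impI)
    fix lam :: real
    let ?s = "periodization (fibre_inner ?K ?K) lam"
    assume "lam \<in> {0<..1} \<longrightarrow> ((\<lambda>r. fibre_inner ?K ?K (lam + real_of_int r)) has_sum ?s) UNIV" "lam \<in> {0<..1}"
    then have s: "((\<lambda>r. fibre_inner ?K ?K (lam + real_of_int r)) has_sum ?s) UNIV" by simp
    have "Re ?s \<ge> 0" by (rule has_sum_nonneg[OF has_sum_Re[OF s]]) (simp add: g)
    moreover have "Im ?s = 0"
      using has_sum_unique[OF has_sum_Im[OF s] has_sum_0] by (simp add: g)
    ultimately show "G_density \<phi> 0 0 lam = complex_of_real (max 0 (Re (G_density \<phi> 0 0 lam)))"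
      by (simp add: G_density_def translate_zero complex_eq_iff)
  qed
qed

text \<open>Since \<open>esssup\<close> of a nonmeasurable function is infinite by convention, measurability of \<open>G \<phi> 0 0\<close>
  has to be derived first, from completeness of Lebesgue measure.\<close>

lemma Linf_norm_G00:
  fixes \<phi> :: "'n::finite heis l2"
  shows "Linf_norm (lebesgue_on {0<..1}) (G \<phi> 0 0) < \<infinity> \<longleftrightarrow>
    (\<exists>B. AE lam in lborel. lam \<in> {0<..1} \<longrightarrow> max 0 (Re (G_density \<phi> 0 0 lam)) \<le> B)"
proof -
  let ?M = "lebesgue_on {0<..1::real}"
  define h where "h lam = max 0 (Re (G_density \<phi> 0 0 lam))" for lam
  have [measurable]: "h \<in> borel_measurable borel" unfolding h_def by measurable
  have ae: "AE lam in lborel. lam \<in> {0<..1} \<longrightarrow> G \<phi> 0 0 lam = complex_of_real (h lam)"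
    using G_eq_density[of \<phi> 0 0] G00_density_nonneg[of \<phi>] unfolding h_def by eventually_elim auto
  have aeM: "(AE lam in ?M. P lam) \<longleftrightarrow> (AE lam in lborel. lam \<in> {0<..1} \<longrightarrow> P lam)" for P
    by (subst AE_restrict_space_iff) (auto simp: AE_completion_iff)
  have "G \<phi> 0 0 \<in> borel_measurable ?M"
  proof (rule measurableI)
    fix A :: "complex set" assume "A \<in> sets borel"
    then have [measurable]: "(\<lambda>lam. complex_of_real (h lam)) -` A \<in> sets borel"
      using measurable_sets[of "\<lambda>lam. complex_of_real (h lam)" borel borel A] by simp
    have "G \<phi> 0 0 -` A \<inter> {0<..1} \<in> sets lebesgue"
    proof (rule complete_measure.in_sets_AE[OF completion.complete_measure_axioms])
      have "AE lam in lborel. (lam \<in> (\<lambda>lam. complex_of_real (h lam)) -` A \<inter> {0<..1}) = (lam \<in> G \<phi> 0 0 -` A \<inter> {0<..1})"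
        using ae by eventually_elim auto
      then show "AE lam in lebesgue. (lam \<in> (\<lambda>lam. complex_of_real (h lam)) -` A \<inter> {0<..1}) = (lam \<in> G \<phi> 0 0 -` A \<inter> {0<..1})"
        by (rule AE_completion)
    qed auto
    then show "G \<phi> 0 0 -` A \<inter> space ?M \<in> sets ?M" by (simp add: sets_restrict_space_iff)
  qed simp
  then have "Linf_norm ?M (G \<phi> 0 0) = Inf {z. AE lam in ?M. ereal (cmod (G \<phi> 0 0 lam)) \<le> z}"
    unfolding Linf_norm_def by (intro esssup_eq_AE) measurable
  also have "\<dots> < \<infinity> \<longleftrightarrow> (\<exists>z<\<infinity>. AE lam in lborel. lam \<in> {0<..1} \<longrightarrow> ereal (h lam) \<le> z)"
  proof -
    have "(AE lam in ?M. ereal (cmod (G \<phi> 0 0 lam)) \<le> z) \<longleftrightarrow> (AE lam in lborel. lam \<in> {0<..1} \<longrightarrow> ereal (h lam) \<le> z)" for z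
      unfolding aeM
    proof
      have n: "cmod (complex_of_real (h lam)) = h lam" for lam by (simp add: h_def)
      show "AE lam in lborel. lam \<in> {0<..1} \<longrightarrow> ereal (h lam) \<le> z"
        if "AE lam in lborel. lam \<in> {0<..1} \<longrightarrow> ereal (cmod (G \<phi> 0 0 lam)) \<le> z"
        using that ae by eventually_elim (simp add: n del: norm_of_real)
      show "AE lam in lborel. lam \<in> {0<..1} \<longrightarrow> ereal (cmod (G \<phi> 0 0 lam)) \<le> z"
        if "AE lam in lborel. lam \<in> {0<..1} \<longrightarrow> ereal (h lam) \<le> z"
        using that ae by eventually_elim (simp add: n del: norm_of_real)
    qed
    then show ?thesis by (simp only: Inf_less_iff Bex_def mem_Collect_eq conj_commute)
  qed
  also have "\<dots> \<longleftrightarrow> (\<exists>B. AE lam in lborel. lam \<in> {0<..1} \<longrightarrow> h lam \<le> B)"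
  proof
    assume "\<exists>z<\<infinity>. AE lam in lborel. lam \<in> {0<..1} \<longrightarrow> ereal (h lam) \<le> z"
    then obtain z where z: "z < \<infinity>" "AE lam in lborel. lam \<in> {0<..1} \<longrightarrow> ereal (h lam) \<le> z" by blast
    from z(2) have "AE lam in lborel. lam \<in> {0<..1} \<longrightarrow> h lam \<le> real_of_ereal z"
    proof (eventually_elim, intro impI)
      fix lam :: real assume "lam \<in> {0<..1} \<longrightarrow> ereal (h lam) \<le> z" "lam \<in> {0<..1}"
      then show "h lam \<le> real_of_ereal z" using z(1) by (cases z) auto
    qed
    then show "\<exists>B. AE lam in lborel. lam \<in> {0<..1} \<longrightarrow> h lam \<le> B" by blast
  next
    assume "\<exists>B. AE lam in lborel. lam \<in> {0<..1} \<longrightarrow> h lam \<le> B"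
    then obtain B where "AE lam in lborel. lam \<in> {0<..1} \<longrightarrow> h lam \<le> B" by blast
    then show "\<exists>z<\<infinity>. AE lam in lborel. lam \<in> {0<..1} \<longrightarrow> ereal (h lam) \<le> z"
      by (intro exI[of _ "ereal B"]) simp
  qed
  finally show ?thesis by (simp add: h_def)
qed

section \<open>Trigonometric polynomials\<close>

abbreviation ecis :: "int \<Rightarrow> real \<Rightarrow> complex" where
  "ecis m lam \<equiv> cis (2 * pi * real_of_int m * lam)"

lemma ecis_add: "ecis (m + k) lam = ecis m lam * ecis k lam"
  by (simp add: cis_mult algebra_simps)

lemma ecis_minus: "ecis (m - k) lam = ecis m lam * cnj (ecis k lam)"
  by (simp add: cis_mult cis_cnj algebra_simps)

lemma integral_ecis: "(LINT lam:{0<..1}|lborel. ecis k lam) = (if k = 0 then 1 else 0)"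
proof (cases "k = 0")
  case True
  then show ?thesis by (simp add: set_lebesgue_integral_def)
next
  case False
  define F where "F lam = ecis k lam / (2 * pi * \<i> * of_int k)" for lam
  have "(ecis k has_integral (F 1 - F 0)) {0..1}"
  proof (rule fundamental_theorem_of_calculus)
    fix x :: real
    show "(F has_vector_derivative ecis k x) (at x within {0..1})"
      unfolding F_def cis_conv_exp using False
      by (auto intro!: derivative_eq_intros has_vector_derivative_real_field simp: scaleR_conv_of_real)
  qed simp
  moreover have "F 1 = F 0" by (simp add: F_def cis_multiple_2pi[OF Ints_of_int, of k, simplified mult.commute])
  ultimately have hi: "(ecis k has_integral 0) {0..1}" by simp
  have si: "set_integrable lborel {0..1} (ecis k)"
    by (intro borel_integrable_atLeastAtMost' continuous_intros)
  have "(LINT lam:{0<..1}|lborel. ecis k lam) = (LINT lam:{0..1}|lborel. ecis k lam)"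
    unfolding set_lebesgue_integral_def
    by (rule integral_cong_AE, measurable) (use AE_lborel_nonzero in \<open>eventually_elim, auto simp: indicator_def\<close>)
  also have "\<dots> = 0"
    using set_borel_integral_eq_integral(2)[OF si] integral_unique[OF hi] by simp
  finally show ?thesis using False by simp
qed

definition trig_poly :: "int set \<Rightarrow> (int \<Rightarrow> complex) \<Rightarrow> real \<Rightarrow> complex" where
  "trig_poly A a lam = (\<Sum>m\<in>A. a m * ecis m lam)"

lemma measurable_trig_poly [measurable]: "trig_poly A a \<in> borel_measurable borel"
  unfolding trig_poly_def by measurable

text \<open>Expanding the square expresses the integral through the Fourier coefficients of the weight.\<close>

lemma integral_trig_poly_weight:
  fixes h :: "real \<Rightarrow> real"
  assumes h: "set_integrable lborel {0<..1} h"
  shows "(LINT lam:{0<..1}|lborel. complex_of_real ((cmod (trig_poly A a lam))\<^sup>2 * h lam))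
    = (\<Sum>m\<in>A. \<Sum>k\<in>A. a m * cnj (a k) * (LINT lam:{0<..1}|lborel. ecis (m - k) lam * complex_of_real (h lam)))"
proof -
  have "integrable lborel (\<lambda>lam. indicator {0<..1} lam * h lam)"
    using h by (simp add: set_integrable_def)
  then have hi: "integrable lborel (\<lambda>lam. complex_of_real (indicator {0<..1} lam * h lam))"
    by (rule integrable_of_real)
  define J where "J m k lam = indicator {0<..1} lam *\<^sub>R (ecis (m - k) lam * complex_of_real (h lam))" for m k lam
  have i: "integrable lborel (J m k)" for m k
    unfolding J_def[abs_def]
  proof (rule Bochner_Integration.integrable_bound[OF hi])
    have [measurable]: "(\<lambda>lam. complex_of_real (indicator {0<..1} lam * h lam)) \<in> borel_measurable borel"
      using hi by simp
    have "(\<lambda>lam. ecis (m - k) lam * complex_of_real (indicator {0<..1} lam * h lam)) \<in> borel_measurable borel"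
      by measurable
    then show "(\<lambda>lam. indicator {0<..1} lam *\<^sub>R (ecis (m - k) lam * complex_of_real (h lam))) \<in> borel_measurable lborel"
      by (simp add: scaleR_conv_of_real mult_ac)
  qed (auto simp: norm_mult)
  have "complex_of_real ((cmod (trig_poly A a lam))\<^sup>2 * h lam)
      = (\<Sum>m\<in>A. \<Sum>k\<in>A. (a m * cnj (a k)) * (ecis (m - k) lam * complex_of_real (h lam)))" for lam
  proof -
    have "complex_of_real ((cmod (trig_poly A a lam))\<^sup>2) = (\<Sum>m\<in>A. a m * ecis m lam) * cnj (\<Sum>k\<in>A. a k * ecis k lam)"
      unfolding complex_norm_square trig_poly_def ..
    also have "\<dots> = (\<Sum>m\<in>A. \<Sum>k\<in>A. (a m * cnj (a k)) * ecis (m - k) lam)"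
      unfolding cnj_sum sum_product ecis_minus by (intro sum.cong refl) (simp add: mult_ac)
    finally show ?thesis by (simp add: sum_distrib_right mult.assoc)
  qed
  then have "(LINT lam:{0<..1}|lborel. complex_of_real ((cmod (trig_poly A a lam))\<^sup>2 * h lam))
    = (LINT lam|lborel. (\<Sum>m\<in>A. \<Sum>k\<in>A. (a m * cnj (a k)) * J m k lam))"
    unfolding set_lebesgue_integral_def J_def by (simp only: scaleR_sum_right mult_scaleR_right)
  also have "\<dots> = (\<Sum>m\<in>A. \<Sum>k\<in>A. a m * cnj (a k) * (LINT lam:{0<..1}|lborel. ecis (m - k) lam * complex_of_real (h lam)))"
    unfolding set_lebesgue_integral_def J_def[symmetric]
    by (simp add: Bochner_Integration.integral_sum Bochner_Integration.integrable_sum i)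
  finally show ?thesis .
qed

lemma set_integrable_trig_poly_weight:
  fixes h :: "real \<Rightarrow> real"
  assumes h: "set_integrable lborel {0<..1} h"
  shows "set_integrable lborel {0<..1} (\<lambda>lam. (cmod (trig_poly A a lam))\<^sup>2 * h lam)"
proof -
  define C where "C = (\<Sum>m\<in>A. cmod (a m))\<^sup>2"
  have b: "(cmod (trig_poly A a lam))\<^sup>2 \<le> C" for lam
    unfolding C_def trig_poly_def by (intro power_mono sum_norm_le) (auto simp: norm_mult)
  have hi: "integrable lborel (\<lambda>lam. indicator {0<..1} lam * h lam)" using h by (simp add: set_integrable_def)
  have [measurable]: "(\<lambda>lam. indicator {0<..1} lam * h lam) \<in> borel_measurable borel" using hi by simp
  have "integrable lborel (\<lambda>lam. (cmod (trig_poly A a lam))\<^sup>2 * (indicator {0<..1} lam * h lam))"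
  proof (rule Bochner_Integration.integrable_bound[OF integrable_mult_right[OF hi, of C]])
    show "AE lam in lborel. norm ((cmod (trig_poly A a lam))\<^sup>2 * (indicator {0<..1} lam * h lam)) \<le> norm (C * (indicator {0<..1} lam * h lam))"
      using b by (intro AE_I2) (auto simp: abs_mult C_def intro!: mult_right_mono)
  qed measurable
  then show ?thesis by (simp add: set_integrable_def mult_ac)
qed

lemma integral_trig_poly:
  assumes "finite A"
  shows "(LINT lam:{0<..1}|lborel. (cmod (trig_poly A a lam))\<^sup>2) = (\<Sum>m\<in>A. (cmod (a m))\<^sup>2)"
proof -
  have one: "set_integrable lborel {0<..1} (\<lambda>_::real. 1::real)"
    by (simp add: set_integrable_def)
  have "complex_of_real (LINT lam:{0<..1}|lborel. (cmod (trig_poly A a lam))\<^sup>2)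
    = (LINT lam:{0<..1}|lborel. complex_of_real ((cmod (trig_poly A a lam))\<^sup>2 * 1))"
    by (simp add: set_integral_complex_of_real del: of_real_power)
  also have "\<dots> = (\<Sum>m\<in>A. \<Sum>k\<in>A. a m * cnj (a k) * (if m - k = 0 then 1 else 0))"
    unfolding integral_trig_poly_weight[OF one] by (simp only: integral_ecis of_real_1 mult_1_right)
  also have "\<dots> = (\<Sum>m\<in>A. \<Sum>k\<in>A. if k = m then a m * cnj (a m) else 0)"
    by (intro sum.cong refl) auto
  also have "\<dots> = complex_of_real (\<Sum>m\<in>A. (cmod (a m))\<^sup>2)"
    using assms by (simp add: complex_norm_square del: of_real_power)
  finally show ?thesis by (simp only: of_real_eq_iff)
qed

definition is_trig_poly :: "(real \<Rightarrow> complex) \<Rightarrow> bool" where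
  "is_trig_poly P \<longleftrightarrow> (\<exists>A a. finite A \<and> P = trig_poly A a)"

lemma is_trig_poly_monomial: "is_trig_poly (\<lambda>lam. c * ecis m lam)"
  unfolding is_trig_poly_def by (intro exI[of _ "{m}"] exI[of _ "\<lambda>_. c"]) (auto simp: trig_poly_def fun_eq_iff)

lemma is_trig_poly_add:
  assumes "is_trig_poly P" "is_trig_poly Q" shows "is_trig_poly (\<lambda>lam. P lam + Q lam)"
proof -
  obtain A a B b where A: "finite A" "P = trig_poly A a" and B: "finite B" "Q = trig_poly B b"
    using assms unfolding is_trig_poly_def by blast
  let ?c = "\<lambda>m. (if m \<in> A then a m else 0) + (if m \<in> B then b m else 0)"
  have "trig_poly (A \<union> B) ?c lam = P lam + Q lam" for lam
  proof -
    have "trig_poly (A \<union> B) ?c lam = (\<Sum>m\<in>A \<union> B. if m \<in> A then a m * ecis m lam else 0) + (\<Sum>m\<in>A \<union> B. if m \<in> B then b m * ecis m lam else 0)"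
      unfolding trig_poly_def sum.distrib[symmetric] by (intro sum.cong refl) (simp add: distrib_right)
    then show ?thesis using A B by (simp add: trig_poly_def Int_absorb1 flip: sum.inter_restrict)
  qed
  then show ?thesis using A B unfolding is_trig_poly_def by (intro exI[of _ "A \<union> B"] exI[of _ ?c]) auto
qed

lemma is_trig_poly_sum: "finite I \<Longrightarrow> (\<And>i. i \<in> I \<Longrightarrow> is_trig_poly (P i)) \<Longrightarrow> is_trig_poly (\<lambda>lam. \<Sum>i\<in>I. P i lam)"
proof (induction I rule: finite_induct)
  case empty
  then show ?case using is_trig_poly_monomial[of 0 0] by simp
qed (simp add: is_trig_poly_add)

lemma is_trig_poly_mult:
  assumes "is_trig_poly P" "is_trig_poly Q" shows "is_trig_poly (\<lambda>lam. P lam * Q lam)"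
proof -
  obtain A a B b where A: "finite A" "P = trig_poly A a" and B: "finite B" "Q = trig_poly B b"
    using assms unfolding is_trig_poly_def by blast
  have "(\<lambda>lam. P lam * Q lam) = (\<lambda>lam. \<Sum>m\<in>A. \<Sum>k\<in>B. (a m * b k) * ecis (m + k) lam)"
    unfolding A B trig_poly_def sum_product ecis_add by (simp add: mult_ac)
  then show ?thesis using A(1) B(1) by (simp only: is_trig_poly_sum is_trig_poly_monomial)
qed

text \<open>Real polynomial functions of \<open>Re z\<close> and \<open>Im z\<close> are trigonometric polynomials on the unit
  circle, so the Weierstrass theorem for compact sets applies to them.\<close>

lemma is_trig_poly_polynomial:
  fixes p :: "complex \<Rightarrow> real"
  assumes "real_polynomial_function p"
  shows "is_trig_poly (\<lambda>lam. complex_of_real (p (ecis 1 lam)))"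
  using assms
proof (induction p rule: real_polynomial_function.induct)
  case (linear f)
  have "complex_of_real (f (ecis 1 lam)) = ((f 1 - \<i> * f \<i>) / 2) * ecis 1 lam + ((f 1 + \<i> * f \<i>) / 2) * ecis (-1) lam" for lam
  proof -
    define t where "t = 2 * pi * lam"
    have "cis t = cos t *\<^sub>R 1 + sin t *\<^sub>R \<i>" by (simp add: complex_eq_iff)
    then have "f (cis t) = cos t * f 1 + sin t * f \<i>"
      using linear by (simp add: linear_simps)
    moreover have "complex_of_real (cos t * f 1 + sin t * f \<i>) = ((f 1 - \<i> * f \<i>) / 2) * cis t + ((f 1 + \<i> * f \<i>) / 2) * cis (- t)"
      by (simp add: complex_eq_iff field_simps)
    ultimately show ?thesis by (simp add: t_def)
  qed
  then show ?case by (simp only: is_trig_poly_add is_trig_poly_monomial)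
next
  case (const c)
  show ?case using is_trig_poly_monomial[of "complex_of_real c" 0] by simp
next
  case (add f g)
  then show ?case by (simp add: is_trig_poly_add)
next
  case (mult f g)
  then show ?case by (simp add: is_trig_poly_mult)
qed

text \<open>On the unit circle the polynomials in \<open>Re z\<close> and \<open>Im z\<close> approximate the continuous functions
  \<open>max 0 (1 - j * infdist z F)\<close> uniformly, where \<open>F\<close> is the image of \<open>K\<close>; these decrease to the
  indicator function of \<open>F\<close>. As \<open>K\<close> is a subset of the half-open interval, on which the
  parametrization is injective, the indicator function of \<open>F\<close> pulls back to that of \<open>K\<close>.\<close>

lemma compact_indicator_trig_approx:
  fixes K :: "real set"
  assumes K: "compact K" "K \<subseteq> {0<..1}"
  obtains P where "\<And>j. is_trig_poly (P j)" "\<And>j lam. cmod (P j lam) \<le> 2"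
    "\<And>lam. lam \<in> {0<..1} \<Longrightarrow> (\<lambda>j. P j lam) \<longlonglongrightarrow> indicator K lam"
proof (cases "K = {}")
  case True
  show ?thesis
    by (rule that[of "\<lambda>_ _. 0"]) (use True is_trig_poly_monomial[of 0 0] in auto)
next
  case False
  define F where "F = ecis 1 ` K"
  have cF: "compact F" unfolding F_def using K(1) by (intro compact_continuous_image continuous_intros)
  have neF: "F \<noteq> {}" using False by (simp add: F_def)
  define v :: "nat \<Rightarrow> complex \<Rightarrow> real" where "v j z = max 0 (1 - real j * infdist z F)" for j z
  have v01: "0 \<le> v j z" "v j z \<le> 1" for j z by (auto simp: v_def infdist_nonneg)
  have "\<exists>p. real_polynomial_function p \<and> (\<forall>z\<in>sphere 0 1. \<bar>v j z - p z\<bar> < inverse (real (Suc j)))" for j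
  proof -
    have "continuous_on (sphere 0 1) (v j)" unfolding v_def by (intro continuous_intros)
    from Stone_Weierstrass_polynomial_function[OF compact_sphere this, of "inverse (real (Suc j))"]
    show ?thesis by (auto simp: real_polynomial_function_eq)
  qed
  then obtain p where p: "\<And>j. real_polynomial_function (p j)" "\<And>j z. z \<in> sphere 0 1 \<Longrightarrow> \<bar>v j z - p j z\<bar> < inverse (real (Suc j))"
    by metis
  have pe: "\<bar>v j (ecis 1 lam) - p j (ecis 1 lam)\<bar> < inverse (real (Suc j))" for j lam by (rule p(2)) simp
  show ?thesis
  proof (rule that[of "\<lambda>j lam. complex_of_real (p j (ecis 1 lam))"])
    show "is_trig_poly (\<lambda>lam. complex_of_real (p j (ecis 1 lam)))" for j
      by (rule is_trig_poly_polynomial[OF p(1)])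
    show "cmod (complex_of_real (p j (ecis 1 lam))) \<le> 2" for j lam
    proof -
      have "inverse (real (Suc j)) \<le> 1" by (simp add: inverse_le_1_iff)
      then show ?thesis using pe[of j lam] v01[of j "ecis 1 lam"] unfolding norm_of_real by linarith
    qed
    fix lam :: real assume lam: "lam \<in> {0<..1}"
    have inF: "ecis 1 lam \<in> F \<longleftrightarrow> lam \<in> K"
    proof
      assume "ecis 1 lam \<in> F"
      then obtain \<mu> where \<mu>: "\<mu> \<in> K" "ecis 1 lam = ecis 1 \<mu>" unfolding F_def by blast
      then have "sin (2 * pi * lam) = sin (2 * pi * \<mu>) \<and> cos (2 * pi * lam) = cos (2 * pi * \<mu>)"
        by (simp add: complex_eq_iff)
      then obtain i :: int where "2 * pi * lam = 2 * pi * \<mu> + 2 * pi * of_int i"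
        unfolding sin_cos_eq_iff by blast
      then have "2 * pi * (lam - \<mu>) = 2 * pi * of_int i" by (simp only: right_diff_distrib)
      then have "lam - \<mu> = of_int i" by simp
      moreover have "\<bar>lam - \<mu>\<bar> < 1" using lam \<mu>(1) K(2) by fastforce
      ultimately have "\<bar>of_int i\<bar> < (1::real)" by simp
      then have "i = 0" by linarith
      with \<open>lam - \<mu> = of_int i\<close> \<mu>(1) show "lam \<in> K" by simp
    qed (auto simp: F_def)
    have "(\<lambda>j. v j (ecis 1 lam)) \<longlonglongrightarrow> indicator K lam"
    proof (cases "lam \<in> K")
      case True
      then have "infdist (ecis 1 lam) F = 0" using inF by simp
      then show ?thesis using True by (simp add: v_def)
    next
      case False
      then have "infdist (ecis 1 lam) F > 0"
        using inF cF neF infdist_pos_not_in_closed[of F] compact_imp_closed by blast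
      then obtain N where N: "real N * infdist (ecis 1 lam) F > 1" using reals_Archimedean3 by blast
      have "v j (ecis 1 lam) = 0" if "j \<ge> N" for j
      proof -
        have "real N * infdist (ecis 1 lam) F \<le> real j * infdist (ecis 1 lam) F"
          using that by (intro mult_right_mono) (auto simp: infdist_nonneg)
        then show ?thesis using N by (simp add: v_def)
      qed
      then have "(\<lambda>j. v j (ecis 1 lam)) \<longlonglongrightarrow> 0" by (intro tendsto_eventually eventually_sequentiallyI)
      then show ?thesis using False by simp
    qed
    moreover have "(\<lambda>j. p j (ecis 1 lam) - v j (ecis 1 lam)) \<longlonglongrightarrow> 0"
      by (rule Lim_null_comparison[OF _ LIMSEQ_inverse_real_of_nat])
         (use pe in \<open>auto simp: abs_minus_commute intro!: always_eventually less_imp_le\<close>)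
    ultimately have "(\<lambda>j. (p j (ecis 1 lam) - v j (ecis 1 lam)) + v j (ecis 1 lam)) \<longlonglongrightarrow> 0 + indicator K lam"
      by (intro tendsto_add)
    then have "(\<lambda>j. p j (ecis 1 lam)) \<longlonglongrightarrow> indicator K lam" by simp
    then have "(\<lambda>j. complex_of_real (p j (ecis 1 lam))) \<longlonglongrightarrow> complex_of_real (indicator K lam)" by (rule tendsto_of_real)
    moreover have "complex_of_real (indicator K lam) = indicator K lam" by (simp add: indicator_def)
    ultimately show "(\<lambda>j. complex_of_real (p j (ecis 1 lam))) \<longlonglongrightarrow> indicator K lam" by (simp only:)
  qed
qed

text \<open>Testing the quadratic inequality with trigonometric polynomials that converge to the indicator
  function of a compact set \<open>K\<close> shows that the integral of \<open>h\<close> over \<open>K\<close> is at most \<open>B\<close> times the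
  measure of \<open>K\<close>. By inner regularity the set where \<open>h\<close> exceeds \<open>B + 1\<close> is null; the slack of \<open>1\<close>
  makes the contradiction strict.\<close>

lemma weight_bounded:
  fixes h :: "real \<Rightarrow> real"
  assumes hm [measurable]: "h \<in> borel_measurable borel" and h: "set_integrable lborel {0<..1} h"
    and le: "\<And>A a. finite A \<Longrightarrow> (LINT lam:{0<..1}|lborel. (cmod (trig_poly A a lam))\<^sup>2 * h lam) \<le> B * (\<Sum>m\<in>A. (cmod (a m))\<^sup>2)"
  shows "AE lam in lborel. lam \<in> {0<..1} \<longrightarrow> h lam \<le> B + 1"
proof -
  define E where "E = {lam \<in> {0<..1}. h lam > B + 1}"
  have [measurable]: "E \<in> sets borel" unfolding E_def by measurable
  have hi: "integrable lborel (\<lambda>lam. indicator {0<..1} lam * h lam)" using h by (simp add: set_integrable_def)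
  have Kz: "measure lborel K = 0" if K: "compact K" "K \<subseteq> E" for K
  proof -
    have [measurable]: "K \<in> sets borel" using K(1) by (simp add: compact_imp_closed)
    have K01: "K \<subseteq> {0<..1}" using K(2) by (auto simp: E_def)
    have fin: "emeasure lborel K < \<infinity>" using emeasure_compact_finite[OF K(1)] by simp
    obtain P where P: "\<And>j. is_trig_poly (P j)" "\<And>j lam. cmod (P j lam) \<le> 2"
      "\<And>lam. lam \<in> {0<..1} \<Longrightarrow> (\<lambda>j. P j lam) \<longlonglongrightarrow> indicator K lam"
      using compact_indicator_trig_approx[OF K(1) K01] by blast
    have [measurable]: "P j \<in> borel_measurable borel" for j
      using P(1)[of j] unfolding is_trig_poly_def by auto
    have lim: "(\<lambda>j. LINT lam:{0<..1}|lborel. (cmod (P j lam))\<^sup>2 * g lam) \<longlonglongrightarrow> (LINT lam|lborel. indicator K lam * g lam)"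
      if gm [measurable]: "g \<in> borel_measurable borel" and g: "integrable lborel (\<lambda>lam. indicator {0<..1} lam * g lam)" for g :: "real \<Rightarrow> real"
      unfolding set_lebesgue_integral_def
    proof (rule integral_dominated_convergence[where w = "\<lambda>lam. 4 * \<bar>indicator {0<..1} lam * g lam\<bar>"])
      show "integrable lborel (\<lambda>lam. 4 * \<bar>indicator {0<..1} lam * g lam\<bar>)" using g by simp
      show "AE lam in lborel. (\<lambda>j. indicator {0<..1} lam *\<^sub>R ((cmod (P j lam))\<^sup>2 * g lam)) \<longlonglongrightarrow> indicator K lam * g lam"
      proof (intro AE_I2)
        fix lam
        show "(\<lambda>j. indicator {0<..1} lam *\<^sub>R ((cmod (P j lam))\<^sup>2 * g lam)) \<longlonglongrightarrow> indicator K lam * g lam"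
        proof (cases "lam \<in> {0<..1}")
          case True
          have "(\<lambda>j. (cmod (P j lam))\<^sup>2 * g lam) \<longlonglongrightarrow> (cmod (indicator K lam))\<^sup>2 * g lam"
            by (intro tendsto_intros P(3) True)
          moreover have "(cmod (indicator K lam))\<^sup>2 = (indicator K lam :: real)" by (simp add: indicator_def)
          ultimately show ?thesis using True by simp
        next
          case False
          then show ?thesis using K01 by (auto simp: indicator_def)
        qed
      qed
      show "AE lam in lborel. norm (indicator {0<..1} lam *\<^sub>R ((cmod (P j lam))\<^sup>2 * g lam)) \<le> 4 * \<bar>indicator {0<..1} lam * g lam\<bar>" for j
      proof (intro AE_I2)
        fix lam
        have "(cmod (P j lam))\<^sup>2 \<le> 2\<^sup>2" using P(2) by (intro power_mono) auto
        then show "norm (indicator {0<..1} lam *\<^sub>R ((cmod (P j lam))\<^sup>2 * g lam)) \<le> 4 * \<bar>indicator {0<..1} lam * g lam\<bar>"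
          by (auto simp: abs_mult indicator_def intro!: mult_right_mono)
      qed
    qed measurable
    have "(LINT lam:{0<..1}|lborel. (cmod (P j lam))\<^sup>2 * h lam) \<le> B * (LINT lam:{0<..1}|lborel. (cmod (P j lam))\<^sup>2 * 1)" for j
      using P(1)[of j] le unfolding is_trig_poly_def by (auto simp: integral_trig_poly)
    then have "(LINT lam|lborel. indicator K lam * h lam) \<le> B * (LINT lam|lborel. indicator K lam * 1)"
      by (intro LIMSEQ_le[OF lim tendsto_mult_left[OF lim]]) (auto simp: hi)
    also have "\<dots> = B * measure lborel K" by simp
    finally have up: "(LINT lam|lborel. indicator K lam * h lam) \<le> B * measure lborel K" .
    have "(LINT lam|lborel. indicator K lam * (B + 1)) \<le> (LINT lam|lborel. indicator K lam * h lam)"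
    proof (rule integral_mono)
      show "integrable lborel (\<lambda>lam. indicator K lam * (B + 1))" using fin by simp
      have "integrable lborel (\<lambda>lam. indicator K lam *\<^sub>R (indicator {0<..1} lam * h lam))"
        by (rule integrable_mult_indicator[OF _ hi]) simp
      moreover have "indicator K lam *\<^sub>R (indicator {0<..1} lam * h lam) = indicator K lam * h lam" for lam
        using K01 by (auto simp: indicator_def)
      ultimately show "integrable lborel (\<lambda>lam. indicator K lam * h lam)" by (simp only:)
      show "indicator K lam * (B + 1) \<le> indicator K lam * h lam" for lam
        using K(2) by (auto simp: indicator_def E_def)
    qed
    with up have "measure lborel K * (B + 1) \<le> B * measure lborel K" by simp
    then show ?thesis by (simp add: algebra_simps measure_le_0_iff)
  qed
  have "E \<in> null_sets lborel"
  proof (rule ccontr)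
    assume "E \<notin> null_sets lborel"
    then have pos: "emeasure lborel E > 0" by (auto simp: null_sets_def zero_less_iff_neq_zero)
    have "emeasure lborel E \<le> emeasure lborel {0<..1::real}" by (intro emeasure_mono) (auto simp: E_def)
    then have "emeasure lborel E \<le> 1" by simp
    then have "emeasure lborel E < \<infinity>" by (metis ennreal_one_less_top infinity_ennreal_def le_less_trans)
    then have mp: "measure lborel E > 0" using pos by (simp add: measure_def enn2real_positive_iff)
    have "E \<in> sets lebesgue" by simp
    then obtain T where T: "closed T" "T \<subseteq> E" "E - T \<in> lmeasurable" "emeasure lebesgue (E - T) < ennreal (measure lborel E)"
      using sets_lebesgue_inner_closed mp by metis
    have "T \<subseteq> {0..1}" using T(2) by (auto simp: E_def)
    then have "bounded T" by (rule bounded_subset[OF bounded_closed_interval])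
    then have bT: "compact T" using T(1) by (simp add: compact_eq_bounded_closed)
    have "emeasure lborel (E - T) = emeasure lborel E"
    proof -
      have "emeasure lborel T = 0"
        using Kz[OF bT T(2)] emeasure_compact_finite[OF bT] by (simp add: emeasure_eq_ennreal_measure less_top)
      then have "T \<in> null_sets lborel" using T(1) by (simp add: null_sets_def)
      then show ?thesis by (intro emeasure_Diff_null_set) auto
    qed
    moreover have "emeasure lebesgue (E - T) = emeasure lborel (E - T)"
      using T(1) by (simp add: main_part_sets)
    ultimately show False
      using T(4) \<open>emeasure lborel E < \<infinity>\<close> by (simp add: emeasure_eq_ennreal_measure)
  qed
  then have "AE lam in lborel. lam \<notin> E" by (rule AE_not_in)
  then show ?thesis by eventually_elim (auto simp: E_def not_less)
qed

section \<open>Bessel and Hilbertian families\<close>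

text \<open>Boundedness of the synthesis map on finitely supported coefficients; both the Bessel and
  the Hilbertian property are compared with it.\<close>

definition synthesis_bound :: "('i \<Rightarrow> 'a::euclidean_space l2) \<Rightarrow> real \<Rightarrow> bool" where
  "synthesis_bound f B \<longleftrightarrow>
    (\<forall>c S. finite S \<longrightarrow> (norm (\<Sum>j\<in>S. c j *\<^sub>C f j))\<^sup>2 \<le> B * (\<Sum>j\<in>S. (cmod (c j))\<^sup>2))"

text \<open>Duality: the coefficients \<open>cinner h (f j)\<close> are used as coefficients of the synthesis map, and
  Cauchy--Schwarz for \<open>h\<close> and the resulting vector gives the bound.\<close>

lemma synthesis_bound_imp_bessel:
  fixes f :: "'n::finite idx \<Rightarrow> 'a::euclidean_space l2"
  assumes f: "synthesis_bound f B" and B: "B > 0"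
  shows "bessel_sequence f"
  unfolding bessel_sequence_def
proof (intro exI[of _ B] conjI allI B)
  fix h :: "'a l2"
  have fin: "(\<Sum>j\<in>S. (cmod (cinner h (f j)))\<^sup>2) \<le> B * (norm h)\<^sup>2" if S: "finite S" for S
  proof -
    define \<sigma> where "\<sigma> = (\<Sum>j\<in>S. (cmod (cinner h (f j)))\<^sup>2)"
    define v where "v = (\<Sum>j\<in>S. cinner h (f j) *\<^sub>C f j)"
    have \<sigma>0: "\<sigma> \<ge> 0" unfolding \<sigma>_def by (intro sum_nonneg) auto
    have "cinner h v = (\<Sum>j\<in>S. cnj (cinner h (f j)) * cinner h (f j))"
      unfolding v_def cinner_sum_right by simp
    also have "\<dots> = complex_of_real \<sigma>"
      unfolding \<sigma>_def of_real_sum complex_norm_square by (simp add: mult.commute)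
    finally have "\<sigma> = cmod (cinner h v)" using \<sigma>0 by simp
    also have "\<dots> \<le> norm h * norm v" by (rule cmod_cinner_le)
    finally have "\<sigma>\<^sup>2 \<le> (norm h * norm v)\<^sup>2" using \<sigma>0 by (rule power_mono)
    also have "\<dots> = (norm h)\<^sup>2 * (norm v)\<^sup>2" by (rule power_mult_distrib)
    also have "\<dots> \<le> (norm h)\<^sup>2 * (B * \<sigma>)"
      using f S unfolding synthesis_bound_def v_def \<sigma>_def by (intro mult_left_mono) auto
    finally have "\<sigma> * \<sigma> \<le> (B * (norm h)\<^sup>2) * \<sigma>" by (simp add: power2_eq_square mult_ac)
    then show ?thesis using \<sigma>0 B unfolding \<sigma>_def[symmetric]
      by (cases "\<sigma> = 0") auto
  qed
  show s: "(\<lambda>j. (cmod (cinner h (f j)))\<^sup>2) summable_on UNIV"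
    by (rule nonneg_bdd_above_summable_on) (auto intro!: bdd_aboveI2[where M = "B * (norm h)\<^sup>2"] fin)
  show "(\<Sum>\<^sub>\<infinity>j. (cmod (cinner h (f j)))\<^sup>2) \<le> B * (norm h)\<^sup>2"
    by (rule infsum_le_finite_sums[OF s fin])
qed

text \<open>The converse duality: the Bessel inequality is applied to the synthesized vector itself.\<close>

lemma bessel_imp_synthesis_bound:
  fixes f :: "'n::finite idx \<Rightarrow> 'a::euclidean_space l2"
  assumes "bessel_sequence f"
  shows "\<exists>B\<ge>0. synthesis_bound f B"
proof -
  obtain B where B: "B > 0" and bs: "\<And>h. (\<lambda>j. (cmod (cinner h (f j)))\<^sup>2) summable_on UNIV"
    "\<And>h. (\<Sum>\<^sub>\<infinity>j. (cmod (cinner h (f j)))\<^sup>2) \<le> B * (norm h)\<^sup>2"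
    using assms unfolding bessel_sequence_def by blast
  have "synthesis_bound f B" unfolding synthesis_bound_def
  proof (intro allI impI)
    fix c and S :: "'n idx set" assume S: "finite S"
    define v where "v = (\<Sum>j\<in>S. c j *\<^sub>C f j)"
    define q where "q = (\<Sum>j\<in>S. (cmod (c j))\<^sup>2)"
    have q: "q \<ge> 0" unfolding q_def by (intro sum_nonneg) auto
    have "(norm v)\<^sup>2 = cmod (cinner v v)" by (simp add: cinner_self_norm norm_power)
    also have "cinner v v = cinner (\<Sum>j\<in>S. c j *\<^sub>C f j) v" by (simp add: v_def)
    also have "\<dots> = (\<Sum>j\<in>S. c j * cinner (f j) v)" by (simp add: cinner_sum_left)
    also have "cmod \<dots> \<le> (\<Sum>j\<in>S. cmod (c j) * cmod (cinner v (f j)))"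
      by (rule sum_norm_le) (metis cinner_commute complex_mod_cnj norm_mult order_refl)
    finally have "((norm v)\<^sup>2)\<^sup>2 \<le> (\<Sum>j\<in>S. cmod (c j) * cmod (cinner v (f j)))\<^sup>2" by (rule power_mono) simp
    also have "\<dots> \<le> q * (\<Sum>j\<in>S. (cmod (cinner v (f j)))\<^sup>2)"
      unfolding q_def by (rule Cauchy_Schwarz_ineq_sum)
    also have "\<dots> \<le> q * (B * (norm v)\<^sup>2)"
    proof (rule mult_left_mono[OF _ q])
      have "(\<Sum>j\<in>S. (cmod (cinner v (f j)))\<^sup>2) \<le> (\<Sum>\<^sub>\<infinity>j. (cmod (cinner v (f j)))\<^sup>2)"
        by (rule finite_sum_le_infsum[OF bs(1) S]) auto
      also note bs(2)
      finally show "(\<Sum>j\<in>S. (cmod (cinner v (f j)))\<^sup>2) \<le> B * (norm v)\<^sup>2" .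
    qed
    finally have "(norm v)\<^sup>2 * (norm v)\<^sup>2 \<le> (B * q) * (norm v)\<^sup>2" by (simp add: power2_eq_square mult_ac)
    then have "(norm v)\<^sup>2 \<le> B * q"
    proof (cases "v = 0")
      case False
      then have "(norm v)\<^sup>2 > 0" by simp
      with \<open>(norm v)\<^sup>2 * (norm v)\<^sup>2 \<le> (B * q) * (norm v)\<^sup>2\<close> show ?thesis by (rule mult_right_le_imp_le)
    qed (use q B in simp)
    then show "(norm (\<Sum>j\<in>S. c j *\<^sub>C f j))\<^sup>2 \<le> B * (\<Sum>j\<in>S. (cmod (c j))\<^sup>2)" by (simp add: v_def q_def)
  qed
  then show ?thesis using B by (auto intro: less_imp_le)
qed

lemma cube_mono: "M \<le> N \<Longrightarrow> cube M \<subseteq> cube N"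
  unfolding cube_def by (auto intro: order_trans)

lemma synthesis_bound_imp_hilbertian:
  assumes f: "synthesis_bound f B" and B: "B \<ge> 0"
  shows "hilbertian f"
  unfolding hilbertian_def
proof (intro allI impI)
  fix c :: "'a idx \<Rightarrow> complex"
  assume c: "(\<lambda>j. (cmod (c j))\<^sup>2) summable_on UNIV"
  define s where "s N = (\<Sum>j\<in>cube N. c j *\<^sub>C f j)" for N
  define q where "q N = (\<Sum>j\<in>cube N. (cmod (c j))\<^sup>2)" for N
  have "incseq q" unfolding q_def incseq_def by (auto intro!: sum_mono2 finite_cube cube_mono)
  moreover have "q N \<le> (\<Sum>\<^sub>\<infinity>j. (cmod (c j))\<^sup>2)" for N
    unfolding q_def by (rule finite_sum_le_infsum[OF c finite_cube]) auto
  ultimately have "Cauchy q" using incseq_convergent LIMSEQ_imp_Cauchy by metis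
  have diff: "(norm (s N - s M))\<^sup>2 \<le> B * \<bar>q N - q M\<bar>" if "M \<le> N" for M N
  proof -
    have "s N - s M = (\<Sum>j\<in>cube N - cube M. c j *\<^sub>C f j)"
      unfolding s_def by (rule sum_diff[symmetric, OF finite_cube cube_mono[OF that]])
    moreover have "q N - q M = (\<Sum>j\<in>cube N - cube M. (cmod (c j))\<^sup>2)"
      unfolding q_def by (rule sum_diff[symmetric, OF finite_cube cube_mono[OF that]])
    moreover have "(\<Sum>j\<in>cube N - cube M. (cmod (c j))\<^sup>2) \<ge> 0" by (intro sum_nonneg) auto
    moreover have "(norm (\<Sum>j\<in>cube N - cube M. c j *\<^sub>C f j))\<^sup>2 \<le> B * (\<Sum>j\<in>cube N - cube M. (cmod (c j))\<^sup>2)"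
      using f finite_Diff[OF finite_cube] unfolding synthesis_bound_def by blast
    ultimately show ?thesis by simp
  qed
  have "Cauchy s"
  proof (rule metric_CauchyI)
    fix r :: real assume r: "r > 0"
    then have "r\<^sup>2 / (B + 1) > 0" using B by simp
    then obtain N0 where N0: "\<And>M N. M \<ge> N0 \<Longrightarrow> N \<ge> N0 \<Longrightarrow> \<bar>q N - q M\<bar> < r\<^sup>2 / (B + 1)"
      using metric_CauchyD[OF \<open>Cauchy q\<close>] by (metis dist_real_def)
    have "dist (s M) (s N) < r" if "M \<ge> N0" "M \<le> N" for M N
    proof -
      have "(norm (s N - s M))\<^sup>2 \<le> (B + 1) * \<bar>q N - q M\<bar>"
        using diff[OF that(2)] by (simp add: distrib_right)
      also have "\<dots> < r\<^sup>2" using N0[of M N] that B by (simp add: pos_less_divide_eq mult.commute)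
      finally show ?thesis using r by (simp add: dist_norm norm_minus_commute power2_less_imp_less)
    qed
    then show "\<exists>N0. \<forall>M\<ge>N0. \<forall>N\<ge>N0. dist (s M) (s N) < r" by (metis dist_commute nat_le_linear)
  qed
  then have "convergent s" by (rule Cauchy_convergent)
  then show "convergent (\<lambda>N. \<Sum>j\<in>cube N. c j *\<^sub>C f j)" by (simp add: s_def[abs_def])
qed

lemma finite_subset_cube: "finite F \<Longrightarrow> \<exists>N. F \<subseteq> (cube N :: 'n::finite idx set)"
proof (induction F rule: finite_induct)
  case (insert j F)
  then obtain N where N: "F \<subseteq> cube N" by blast
  obtain k l m where j: "j = (k, l, m)" by (cases j)
  define X where "X = insert \<bar>m\<bar> (range (\<lambda>i. \<bar>k $ i\<bar>) \<union> range (\<lambda>i. \<bar>l $ i\<bar>))"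
  define M where "M = nat (Max X)"
  have le: "x \<le> int M" if "x \<in> X" for x
  proof -
    have "finite X" by (simp add: X_def)
    then have "x \<le> Max X" using that by (rule Max_ge)
    then show ?thesis by (simp add: M_def)
  qed
  have "j \<in> cube M" unfolding j cube_def by (auto intro!: le simp: X_def)
  then have "insert j F \<subseteq> cube (max M N)"
    using N cube_mono[of M "max M N"] cube_mono[of N "max M N"] by auto
  then show ?case by blast
qed simp

text \<open>A gliding hump: if the synthesis map were unbounded on one central fibre, then unit vectors
  with geometrically small coefficients could be moved to disjoint consecutive blocks of the fibre,
  since the norm does not change under a shift of the block. The resulting square summable
  coefficients give partial sums that jump by a unit vector over each block.\<close>

lemma hilbertian_imp_fibre_bound:
  fixes f :: "'n::finite idx \<Rightarrow> 'a::euclidean_space l2"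
  assumes hil: "hilbertian f"
    and shift: "\<And>A a s. finite A \<Longrightarrow> norm (\<Sum>m\<in>A. a m *\<^sub>C f (0, 0, m + s)) = norm (\<Sum>m\<in>A. a m *\<^sub>C f (0, 0, m))"
  shows "\<exists>B. \<forall>A a. finite A \<longrightarrow> (norm (\<Sum>m\<in>A. a m *\<^sub>C f (0, 0, m)))\<^sup>2 \<le> B * (\<Sum>m\<in>A. (cmod (a m))\<^sup>2)"
proof (rule ccontr)
  assume neg: "\<not> ?thesis"
  define e where "e m = f (0, 0, m)" for m
  \<comment> \<open>a unit vector synthesized from coefficients of norm at most \<open>1 / 2^n\<close>, supported in a window of radius \<open>R\<close>\<close>
  define hump where "hump n b R \<longleftrightarrow> norm (\<Sum>m\<in>{- int R..int R}. b m *\<^sub>C e m) = 1 \<and>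
    (\<Sum>m\<in>{- int R..int R}. (cmod (b m))\<^sup>2) \<le> (1/4)^n" for n R :: nat and b :: "int \<Rightarrow> complex"
  have "\<exists>b R. hump n b R" for n
  proof -
    have "\<exists>A a. finite A \<and> \<not> (norm (\<Sum>m\<in>A. a m *\<^sub>C e m))\<^sup>2 \<le> 4^n * (\<Sum>m\<in>A. (cmod (a m))\<^sup>2)"
      using neg unfolding e_def by blast
    then obtain A a where A: "finite A" and big: "(norm (\<Sum>m\<in>A. a m *\<^sub>C e m))\<^sup>2 > 4^n * (\<Sum>m\<in>A. (cmod (a m))\<^sup>2)"
      unfolding not_le by blast
    define t where "t = norm (\<Sum>m\<in>A. a m *\<^sub>C e m)"
    have "(\<Sum>m\<in>A. (cmod (a m))\<^sup>2) \<ge> 0" by (intro sum_nonneg) auto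
    then have "t\<^sup>2 > 0" using big unfolding t_def by (meson le_less_trans mult_nonneg_nonneg zero_le_numeral zero_le_power)
    then have t: "t > 0" by (simp add: t_def)
    define b where "b m = (if m \<in> A then a m / complex_of_real t else 0)" for m
    obtain R where R: "A \<subseteq> {- int R..int R}"
    proof
      show "A \<subseteq> {- int (nat (Max (insert 0 (abs ` A))))..int (nat (Max (insert 0 (abs ` A))))}"
      proof
        fix m assume "m \<in> A"
        then have "\<bar>m\<bar> \<le> Max (insert 0 (abs ` A))" using A by (intro Max_ge) auto
        then show "m \<in> {- int (nat (Max (insert 0 (abs ` A))))..int (nat (Max (insert 0 (abs ` A))))}" by auto
      qed
    qed
    have "(\<Sum>m\<in>{- int R..int R}. b m *\<^sub>C e m) = (\<Sum>m\<in>A. complex_of_real (1/t) *\<^sub>C (a m *\<^sub>C e m))"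
      by (rule sum.mono_neutral_cong_right) (use R in \<open>auto simp: b_def\<close>)
    also have "\<dots> = complex_of_real (1/t) *\<^sub>C (\<Sum>m\<in>A. a m *\<^sub>C e m)" by (rule scaleC_sum_right[symmetric])
    finally have 1: "norm (\<Sum>m\<in>{- int R..int R}. b m *\<^sub>C e m) = 1"
      using t by (simp add: t_def[symmetric] norm_divide)
    have "(\<Sum>m\<in>{- int R..int R}. (cmod (b m))\<^sup>2) = (\<Sum>m\<in>A. (cmod (a m))\<^sup>2 / t\<^sup>2)"
      by (rule sum.mono_neutral_cong_right) (use R t in \<open>auto simp: b_def norm_divide power_divide\<close>)
    also have "\<dots> = (\<Sum>m\<in>A. (cmod (a m))\<^sup>2) / t\<^sup>2" by (rule sum_divide_distrib[symmetric])
    also have "\<dots> \<le> (1/4)^n"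
    proof -
      have "(1/4) ^ n * (4 ^ n * (\<Sum>m\<in>A. (cmod (a m))\<^sup>2)) \<le> (1/4) ^ n * t\<^sup>2"
        using big unfolding t_def by (intro mult_left_mono) auto
      moreover have "(1/4 :: real) ^ n * 4 ^ n = 1" by (simp flip: power_mult_distrib)
      ultimately have "(\<Sum>m\<in>A. (cmod (a m))\<^sup>2) \<le> (1/4) ^ n * t\<^sup>2" by (simp only: mult.assoc[symmetric] mult_1)
      then show ?thesis using \<open>t\<^sup>2 > 0\<close> by (simp only: pos_divide_le_eq)
    qed
    finally have "hump n b R" using 1 by (simp only: hump_def simp_thms)
    then show ?thesis by blast
  qed
  then obtain b R where hump: "\<And>n. hump n (b n) (R n)" by metis
  have b: "norm (\<Sum>m\<in>{- int (R n)..int (R n)}. b n m *\<^sub>C e m) = 1"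
    "(\<Sum>m\<in>{- int (R n)..int (R n)}. (cmod (b n m))\<^sup>2) \<le> (1/4)^n" for n
    using hump[of n] by (simp_all add: hump_def)
  define N where "N = rec_nat 0 (\<lambda>n Nn. Nn + 2 * R n + 1)"
  have NS: "N (Suc n) = N n + 2 * R n + 1" and N0: "N 0 = 0" for n by (simp_all add: N_def)
  have smN: "strict_mono N" unfolding strict_mono_Suc_iff NS by simp
  \<comment> \<open>\<open>s n\<close> is the centre of the \<open>n\<close>-th block, which consists of the integers in \<open>(N n, N (n + 1)]\<close>\<close>
  define s where "s n = int (N n) + int (R n) + 1" for n
  define block where "block n = {int (N n)<..int (N (Suc n))}" for n
  define \<nu> where "\<nu> m = (LEAST n. m \<le> int (N (Suc n)))" for m
  have \<nu>: "\<nu> m = n" if "m \<in> block n" for m n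
    unfolding \<nu>_def
  proof (rule Least_equality)
    fix k assume k: "m \<le> int (N (Suc k))"
    show "n \<le> k"
    proof (rule ccontr)
      assume "\<not> n \<le> k"
      then have "N (Suc k) \<le> N n" using smN by (simp add: strict_mono_less_eq)
      then show False using k that by (simp add: block_def)
    qed
  qed (use that in \<open>simp add: block_def\<close>)
  define c where "c = (\<lambda>(k :: int ^ 'n, l :: int ^ 'n, m). if k = 0 \<and> l = 0 \<and> m > 0 then b (\<nu> m) (m - s (\<nu> m)) else 0)"
  have cube_sum: "(\<Sum>j\<in>cube M. g j) = (\<Sum>m\<in>{0<..int M}. g (0, 0, m))"
    if "\<And>j. c j = 0 \<Longrightarrow> g j = 0" for g :: "'n idx \<Rightarrow> 'z::comm_monoid_add" and M
  proof -
    have "(\<Sum>j\<in>cube M. g j) = (\<Sum>j\<in>(\<lambda>m. (0, 0, m)) ` {0<..int M}. g j)"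
    proof (rule sum.mono_neutral_right[OF finite_cube])
      show "\<forall>j\<in>cube M - (\<lambda>m. (0, 0, m)) ` {0<..int M}. g j = 0"
        by (auto intro!: that simp: c_def cube_def image_iff)
    qed (auto simp: cube_def)
    also have "\<dots> = (\<Sum>m\<in>{0<..int M}. g (0, 0, m))" by (subst sum.reindex) (auto simp: inj_on_def)
    finally show ?thesis .
  qed
  have step: "(\<Sum>j\<in>cube (N (Suc n)). g j) = (\<Sum>j\<in>cube (N n). g j) + (\<Sum>m\<in>{- int (R n)..int (R n)}. g (0, 0, m + s n))"
    if "\<And>j. c j = 0 \<Longrightarrow> g j = 0" for g :: "'n idx \<Rightarrow> 'z::comm_monoid_add" and n
  proof -
    have "{0<..int (N (Suc n))} = {0<..int (N n)} \<union> block n" "{0<..int (N n)} \<inter> block n = {}"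
      by (auto simp: block_def NS)
    then have "(\<Sum>m\<in>{0<..int (N (Suc n))}. g (0, 0, m)) = (\<Sum>m\<in>{0<..int (N n)}. g (0, 0, m)) + (\<Sum>m\<in>block n. g (0, 0, m))"
      by (simp add: sum.union_disjoint block_def)
    also have "(\<Sum>m\<in>block n. g (0, 0, m)) = (\<Sum>m\<in>{- int (R n)..int (R n)}. g (0, 0, m + s n))"
      by (rule sum.reindex_bij_witness[of _ "\<lambda>m. m + s n" "\<lambda>m. m - s n"]) (auto simp: block_def s_def NS)
    finally show ?thesis by (simp add: cube_sum[OF that])
  qed
  have cb: "c (0, 0, m + s n) = b n m" if "m \<in> {- int (R n)..int (R n)}" for m n
  proof -
    have "m + s n \<in> block n" using that by (auto simp: block_def s_def NS)
    moreover from this have "m + s n > 0" by (auto simp: block_def)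
    ultimately show ?thesis by (simp add: c_def \<nu>)
  qed
  \<comment> \<open>the subtracted term leaves room for the next block in the induction\<close>
  have q: "(\<Sum>j\<in>cube (N n). (cmod (c j))\<^sup>2) \<le> 2 - 2 * (1/4)^n" for n
  proof (induction n)
    case 0
    show ?case by (subst cube_sum) (auto simp: N0)
  next
    case (Suc n)
    have "(\<Sum>m\<in>{- int (R n)..int (R n)}. (cmod (c (0, 0, m + s n)))\<^sup>2) \<le> (1/4)^n"
      using b(2)[of n] by (simp add: cb)
    moreover have "(1/4::real)^n \<ge> 0" by simp
    moreover have "(\<Sum>j\<in>cube (N (Suc n)). (cmod (c j))\<^sup>2) = (\<Sum>j\<in>cube (N n). (cmod (c j))\<^sup>2)
        + (\<Sum>m\<in>{- int (R n)..int (R n)}. (cmod (c (0, 0, m + s n)))\<^sup>2)"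
      by (rule step) simp
    ultimately show ?case using Suc unfolding power_Suc by linarith
  qed
  have "(\<lambda>j. (cmod (c j))\<^sup>2) summable_on UNIV"
  proof (rule nonneg_bdd_above_summable_on)
    have "(\<Sum>j\<in>F. (cmod (c j))\<^sup>2) \<le> 2" if F: "finite F" for F
    proof -
      obtain M where M: "F \<subseteq> cube M" using finite_subset_cube[OF F] by blast
      have "M \<le> N M" using smN by (rule strict_mono_imp_increasing)
      then have "F \<subseteq> cube (N M)" using M cube_mono by blast
      then have "(\<Sum>j\<in>F. (cmod (c j))\<^sup>2) \<le> (\<Sum>j\<in>cube (N M). (cmod (c j))\<^sup>2)"
        by (intro sum_mono2 finite_cube) auto
      also have "\<dots> \<le> 2 - 2 * (1/4)^M" by (rule q)
      also have "\<dots> \<le> 2" by simp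
      finally show ?thesis .
    qed
    then show "bdd_above (sum (\<lambda>j. (cmod (c j))\<^sup>2) ` {F. F \<subseteq> UNIV \<and> finite F})"
      by (auto intro!: bdd_aboveI2[where M = 2])
  qed simp
  then obtain L where L: "(\<lambda>M. \<Sum>j\<in>cube M. c j *\<^sub>C f j) \<longlonglongrightarrow> L"
    using hil unfolding hilbertian_def convergent_def by blast
  define T where "T n = (\<Sum>j\<in>cube (N n). c j *\<^sub>C f j)" for n
  have T: "T \<longlonglongrightarrow> L" using LIMSEQ_subseq_LIMSEQ[OF L smN] by (simp add: T_def[abs_def] o_def)
  have "norm (T (Suc n) - T n) = 1" for n
  proof -
    have "T (Suc n) - T n = (\<Sum>m\<in>{- int (R n)..int (R n)}. b n m *\<^sub>C f (0, 0, m + s n))"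
      unfolding T_def by (subst step) (auto simp: cb intro!: sum.cong)
    then show ?thesis using b(1)[of n] shift[of "{- int (R n)..int (R n)}" "b n" "s n"] by (simp add: e_def)
  qed
  moreover have "(\<lambda>n. norm (T (Suc n) - T n)) \<longlonglongrightarrow> norm (L - L)"
    by (intro tendsto_norm tendsto_diff LIMSEQ_Suc T)
  ultimately show False by (simp add: LIMSEQ_const_iff)
qed

section \<open>The translates of a function satisfying condition C\<close>

text \<open>The maximum with \<open>0\<close> makes the weight nonnegative everywhere; by \<open>G00_density_nonneg\<close> it changes
  the density on a null set only.\<close>

lemma norm_fibre_sum:
  fixes \<phi> :: "'n::finite heis l2"
  defines "h \<equiv> \<lambda>lam. max 0 (Re (G_density \<phi> 0 0 lam))"
  shows "(norm (\<Sum>m\<in>A. a m *\<^sub>C translate \<phi> (k, l, m)))\<^sup>2 = (LINT lam:{0<..1}|lborel. (cmod (trig_poly A a lam))\<^sup>2 * h lam)"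
    and "set_integrable lborel {0<..1} h"
proof -
  have hm [measurable]: "h \<in> borel_measurable borel" unfolding h_def by measurable
  have ae: "AE lam in lborel. indicator {0<..1} lam *\<^sub>R G_density \<phi> 0 0 lam = indicator {0<..1} lam *\<^sub>R complex_of_real (h lam)"
    using G00_density_nonneg[of \<phi>] unfolding h_def by eventually_elim (auto simp: indicator_def)
  have "integrable lborel (\<lambda>lam. indicator {0<..1} lam *\<^sub>R complex_of_real (h lam))"
    by (rule integrable_cong_AE_imp[OF set_integrable_G_density[of \<phi> 0 0, unfolded set_integrable_def]])
       (use ae in \<open>auto elim: eventually_mono\<close>)
  from integrable_bounded_linear[OF bounded_linear_Re this]
  show hi: "set_integrable lborel {0<..1} h" by (simp add: set_integrable_def)
  have g: "cinner (translate \<phi> (k, l, m)) (translate \<phi> (k, l, m')) = (LINT lam:{0<..1}|lborel. ecis (m - m') lam * complex_of_real (h lam))" for m m'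
    unfolding cinner_translate_same set_lebesgue_integral_def
    by (rule integral_cong_AE, measurable) (use ae in eventually_elim, simp only: mult_scaleR_right[symmetric])
  have "complex_of_real ((norm (\<Sum>m\<in>A. a m *\<^sub>C translate \<phi> (k, l, m)))\<^sup>2)
    = (\<Sum>m\<in>A. \<Sum>m'\<in>A. a m * cnj (a m') * cinner (translate \<phi> (k, l, m)) (translate \<phi> (k, l, m')))"
    unfolding cinner_self_norm[symmetric] cinner_sum_left cinner_sum_right
    by (subst sum.swap) (simp add: sum_distrib_left mult_ac)
  also have "\<dots> = (LINT lam:{0<..1}|lborel. complex_of_real ((cmod (trig_poly A a lam))\<^sup>2 * h lam))"
    unfolding g by (rule integral_trig_poly_weight[OF hi, symmetric])
  also have "\<dots> = complex_of_real (LINT lam:{0<..1}|lborel. (cmod (trig_poly A a lam))\<^sup>2 * h lam)"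
    by (rule set_integral_complex_of_real)
  finally show "(norm (\<Sum>m\<in>A. a m *\<^sub>C translate \<phi> (k, l, m)))\<^sup>2 = (LINT lam:{0<..1}|lborel. (cmod (trig_poly A a lam))\<^sup>2 * h lam)"
    by (simp only: of_real_eq_iff)
qed

lemma norm_fibre_sum_shift:
  "norm (\<Sum>m\<in>A. a m *\<^sub>C translate \<phi> (k, l, m + s)) = norm (\<Sum>m\<in>A. a m *\<^sub>C translate \<phi> (k, l, m))"
proof -
  have "complex_of_real ((norm (\<Sum>m\<in>A. a m *\<^sub>C translate \<phi> (k, l, m + s)))\<^sup>2) = complex_of_real ((norm (\<Sum>m\<in>A. a m *\<^sub>C translate \<phi> (k, l, m)))\<^sup>2)"
    unfolding cinner_self_norm[symmetric] cinner_sum_left cinner_sum_right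
    by (simp add: cinner_translate_same)
  then have "(norm (\<Sum>m\<in>A. a m *\<^sub>C translate \<phi> (k, l, m + s)))\<^sup>2 = (norm (\<Sum>m\<in>A. a m *\<^sub>C translate \<phi> (k, l, m)))\<^sup>2"
    by (simp only: of_real_eq_iff)
  then show ?thesis by (simp add: power2_eq_iff_nonneg)
qed

text \<open>By condition C the parts of the sum in different fibres are orthogonal, so it suffices to bound
  each fibre, where the weight is replaced by the constant \<open>B\<close>.\<close>

lemma synthesis_bound_translate:
  fixes \<phi> :: "'n::finite heis l2"
  assumes C: "condition_C \<phi>" and B: "AE lam in lborel. lam \<in> {0<..1} \<longrightarrow> max 0 (Re (G_density \<phi> 0 0 lam)) \<le> B"
  shows "synthesis_bound (translate \<phi>) B"
  unfolding synthesis_bound_def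
proof (intro allI impI)
  fix c and S :: "'n idx set" assume S: "finite S"
  have fibre: "(norm (\<Sum>m\<in>A. a m *\<^sub>C translate \<phi> (k, l, m)))\<^sup>2 \<le> B * (\<Sum>m\<in>A. (cmod (a m))\<^sup>2)" if "finite A" for A a k l
  proof -
    have one: "set_integrable lborel {0<..1} (\<lambda>_::real. 1::real)" by (simp add: set_integrable_def)
    have "(norm (\<Sum>m\<in>A. a m *\<^sub>C translate \<phi> (k, l, m)))\<^sup>2 = (LINT lam:{0<..1}|lborel. (cmod (trig_poly A a lam))\<^sup>2 * max 0 (Re (G_density \<phi> 0 0 lam)))"
      by (rule norm_fibre_sum(1))
    also have "\<dots> \<le> (LINT lam:{0<..1}|lborel. B * ((cmod (trig_poly A a lam))\<^sup>2 * 1))"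
    proof (rule set_integral_mono_AE[OF set_integrable_trig_poly_weight[OF norm_fibre_sum(2)] set_integrable_mult_right[OF set_integrable_trig_poly_weight[OF one]]])
      show "AE lam\<in>{0<..1} in lborel. (cmod (trig_poly A a lam))\<^sup>2 * max 0 (Re (G_density \<phi> 0 0 lam)) \<le> B * ((cmod (trig_poly A a lam))\<^sup>2 * 1)"
        using B by eventually_elim (simp add: mult.commute mult_right_mono)
    qed
    also have "\<dots> = B * (\<Sum>m\<in>A. (cmod (a m))\<^sup>2)" by (simp add: integral_trig_poly[OF that])
    finally show ?thesis .
  qed
  define key where "key j = (fst j, fst (snd j))" for j :: "'n idx"
  define v where "v p = (\<Sum>j\<in>{j\<in>S. key j = p}. c j *\<^sub>C translate \<phi> j)" for p :: "(int ^ 'n) \<times> (int ^ 'n)"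
  have vle: "(norm (v p))\<^sup>2 \<le> B * (\<Sum>j\<in>{j\<in>S. key j = p}. (cmod (c j))\<^sup>2)" for p :: "(int ^ 'n) \<times> (int ^ 'n)"
  proof (cases p)
    case (Pair k l)
    define A where "A = {m. (k, l, m) \<in> S}"
    have im: "{j\<in>S. key j = p} = (\<lambda>m. (k, l, m)) ` A" by (auto simp: key_def Pair A_def)
    have inj: "inj_on (\<lambda>m. (k, l, m)) A" by (auto simp: inj_on_def)
    have "finite {j\<in>S. key j = p}" using S by simp
    then have "finite A" unfolding im using inj by (rule finite_imageD)
    then show ?thesis
      unfolding v_def im sum.reindex[OF inj] o_def by (rule fibre)
  qed
  have "(norm (\<Sum>j\<in>S. c j *\<^sub>C translate \<phi> j))\<^sup>2 = (norm (\<Sum>p\<in>key ` S. v p))\<^sup>2"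
    unfolding v_def using S by (subst sum.group) auto
  also have "\<dots> = (\<Sum>p\<in>key ` S. (norm (v p))\<^sup>2)"
  proof (rule norm_sum_Pythagorean)
    show "pairwise (\<lambda>p p'. orthogonal (v p) (v p')) (key ` S)"
    proof (rule pairwiseI)
      fix p p' :: "(int ^ 'n) \<times> (int ^ 'n)" assume ne: "p \<noteq> p'"
      have "cinner (translate \<phi> j) (translate \<phi> j') = 0" if "key j = p" "key j' = p'" for j j'
      proof -
        have "(fst j, fst (snd j)) \<noteq> (fst j', fst (snd j'))" using that ne unfolding key_def by blast
        from cinner_translate_orthogonal[OF C this, of "snd (snd j)" "snd (snd j')"] show ?thesis by simp
      qed
      then have "cinner (v p) (v p') = 0"
        unfolding v_def cinner_sum_left cinner_sum_right by (auto intro!: sum.neutral)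
      then show "orthogonal (v p) (v p')" by (simp add: orthogonal_def inner_l2_def)
    qed
  qed (use S in simp)
  also have "\<dots> \<le> (\<Sum>p\<in>key ` S. B * (\<Sum>j\<in>{j\<in>S. key j = p}. (cmod (c j))\<^sup>2))" by (intro sum_mono vle)
  also have "\<dots> = B * (\<Sum>j\<in>S. (cmod (c j))\<^sup>2)"
    unfolding sum_distrib_left[symmetric] using S by (subst sum.group) auto
  finally show "(norm (\<Sum>j\<in>S. c j *\<^sub>C translate \<phi> j))\<^sup>2 \<le> B * (\<Sum>j\<in>S. (cmod (c j))\<^sup>2)" .
qed

theorem theorem6p4:
  fixes \<phi> :: "'n::finite heis l2"
  assumes "condition_C \<phi>"
    and "in_L1 (lebesgue_on {0<..1}) (recip_G00 \<phi>)"
  shows "(hilbertian (translate \<phi>) \<longleftrightarrow> Linf_norm (lebesgue_on {0<..1}) (G \<phi> 0 0) < \<infinity>) \<and>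
         (Linf_norm (lebesgue_on {0<..1}) (G \<phi> 0 0) < \<infinity> \<longleftrightarrow> bessel_sequence (translate \<phi>))"
proof -
  let ?b = "Linf_norm (lebesgue_on {0<..1}) (G \<phi> 0 0) < \<infinity>"
  have bc: "bessel_sequence (translate \<phi>)" if b: ?b
  proof -
    obtain B where B: "AE lam in lborel. lam \<in> {0<..1} \<longrightarrow> max 0 (Re (G_density \<phi> 0 0 lam)) \<le> B"
      using b unfolding Linf_norm_G00 by blast
    have "AE lam in lborel. lam \<in> {0<..1} \<longrightarrow> max 0 (Re (G_density \<phi> 0 0 lam)) \<le> max B 1"
      using B by eventually_elim auto
    then have "synthesis_bound (translate \<phi>) (max B 1)" by (rule synthesis_bound_translate[OF assms(1)])
    then show ?thesis by (rule synthesis_bound_imp_bessel) simp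
  qed
  have ca: "hilbertian (translate \<phi>)" if "bessel_sequence (translate \<phi>)"
    using bessel_imp_synthesis_bound[OF that] synthesis_bound_imp_hilbertian by blast
  have ab: ?b if hil: "hilbertian (translate \<phi>)"
  proof -
    obtain B where B: "\<And>A a. finite A \<Longrightarrow> (norm (\<Sum>m\<in>A. a m *\<^sub>C translate \<phi> (0, 0, m)))\<^sup>2 \<le> B * (\<Sum>m\<in>A. (cmod (a m))\<^sup>2)"
      using hilbertian_imp_fibre_bound[OF hil norm_fibre_sum_shift] by blast
    have "AE lam in lborel. lam \<in> {0<..1} \<longrightarrow> max 0 (Re (G_density \<phi> 0 0 lam)) \<le> B + 1"
      by (rule weight_bounded[OF _ norm_fibre_sum(2)]) (use B in \<open>simp_all add: norm_fibre_sum(1)\<close>)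
    then show ?thesis unfolding Linf_norm_G00 by blast
  qed
  show ?thesis using bc ca ab by blast
qed

end
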